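(* Let $\gamma>-\frac12$ and set $\nu=\frac{1}{2(1+\gamma)}$, so that $0<\nu<1$. Let $\{W(t):t\ge0\}$ be a standard Wiener process and, for $t\in[0,1]$, let $$W_\gamma(t)=\frac{1}{\sqrt{1+2\gamma}}\Big\{W\big(t^{1+2\gamma}\big)-\int_0^1W\big(u^{1+2\gamma}\big)\,du\Big\}.$$ Then the Karhunen–Loève (KL) expansion of $W_\gamma$ is given by $$W_\gamma(t)\stackrel{\text{law}}{=}\sum_{k=1}^\infty\omega_k\sqrt{\lambda_k}\,e_k(t),$$ where $\{\omega_k:k\ge1\}$ are i.i.d. $N(0,1)$ random variables and, for $k\ge1$ and $t\in(0,1]$, $$\lambda_k=\Big\{\frac{2\nu}{z_{\nu,k}}\Big\}^2\qquad\text{and}\qquad e_k(t)=t^{\frac1{2\nu}-\frac12}\,\frac{J_{\nu-1}\big(z_{\nu,k}\,t^{\frac1{2\nu}}\big)}{\sqrt{\nu}\,J_{\nu-1}(z_{\nu,k})}.$$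
   Context: $\stackrel{\text{law}}{=}$ denotes equality in distribution (of processes). For $\rho\in\mathbb R$, the Bessel function of the first kind of index $\rho$ is $$J_\rho(x)=\big(\tfrac12x\big)^\rho\sum_{k=0}^\infty\frac{(-\frac14x^2)^k}{\Gamma(\rho+k+1)\Gamma(k+1)},\qquad x>0.$$ For $\nu>-1$, $0<z_{\nu,1}<z_{\nu,2}<\cdots$ denotes the increasing sequence of all positive zeros of $J_\nu$. For a centered Gaussian process $\{\zeta(t):t\in[0,1]\}$ with covariance function $K_\zeta(s,t)=E(\zeta(s)\zeta(t))\in L^2([0,1]^2)$, the KL expansion of $\zeta$ is the representation (convergent in expected mean squares) $\zeta(t)\stackrel{\text{law}}{=}\sum_{k\ge1}\omega_k\sqrt{\lambda_k}\,e_k(t)$, where $\{\omega_k\}$ are i.i.d. $N(0,1)$, $\{e_k\}$ is an orthonormal sequence in $L^2([0,1])$, and $\lambda_1\ge\lambda_2\ge\cdots\ge0$ are the eigenvalues (repeated according to multiplicity; the eigenvalue $0$ may be omitted) of the Fredholm operator $T_\zeta h(t)=\int_0^1K_\zeta(s,t)h(s)\,ds$ on $L^2([0,1])$, with $T_\zeta e_k=\lambda_ke_k$ for each $k$. *)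

theory Defs
  imports "HOL-Probability.Probability"
begin

subsection \<open>Bessel functions of the first kind and their positive zeros\<close>

text \<open>At the poles of the Gamma function the library has \<open>Gamma = 0\<close>, hence \<open>1 / Gamma = 0\<close>,
  which is the usual convention for this series when \<open>\<rho>\<close> is a negative integer.\<close>

definition bessel_J :: "real \<Rightarrow> real \<Rightarrow> real" where
  "bessel_J \<rho> x = (x / 2) powr \<rho> *
     (\<Sum>k. (- (x\<^sup>2 / 4)) ^ k / (Gamma (\<rho> + real k + 1) * Gamma (real k + 1)))"

text \<open>The \<open>k\<close>-th positive zero (\<open>k \<ge> 1\<close>) is the zero \<open>x > 0\<close> for which \<open>{0<..x}\<close>
  contains exactly \<open>k\<close> zeros. As infinite sets have cardinality 0, this also requires
  that set of zeros to be finite.\<close>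

definition bessel_zero :: "real \<Rightarrow> nat \<Rightarrow> real" where
  "bessel_zero \<nu> k = (THE x. 0 < x \<and> bessel_J \<nu> x = 0 \<and>
     card {y. 0 < y \<and> y \<le> x \<and> bessel_J \<nu> y = 0} = k)"

subsection \<open>Wiener processes, Gaussian processes, equality in law\<close>

definition wiener_process :: "'a measure \<Rightarrow> (real \<Rightarrow> 'a \<Rightarrow> real) \<Rightarrow> bool" where
  "wiener_process M W \<longleftrightarrow>
     prob_space M \<and>
     (\<forall>t\<ge>0. W t \<in> borel_measurable M) \<and>
     (AE \<omega> in M. W 0 \<omega> = 0) \<and>
     (\<forall>(t :: nat \<Rightarrow> real) n. 0 \<le> t 0 \<and> mono t \<longrightarrow>
        prob_space.indep_vars M (\<lambda>_. borel) (\<lambda>i \<omega>. W (t (Suc i)) \<omega> - W (t i) \<omega>) {..<n}) \<and>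
     (\<forall>s t. 0 \<le> s \<and> s < t \<longrightarrow>
        distributed M lborel (\<lambda>\<omega>. W t \<omega> - W s \<omega>)
          (\<lambda>x. ennreal (normal_density 0 (sqrt (t - s)) x))) \<and>
     (\<forall>\<omega>\<in>space M. continuous_on {0..} (\<lambda>t. W t \<omega>))"

text \<open>The case \<open>\<sigma> = 0\<close> is the degenerate normal law, a point mass at 0.\<close>

definition centered_gaussian_process :: "'a measure \<Rightarrow> real set \<Rightarrow> (real \<Rightarrow> 'a \<Rightarrow> real) \<Rightarrow> bool" where
  "centered_gaussian_process M T X \<longleftrightarrow>
     prob_space M \<and>
     (\<forall>t\<in>T. X t \<in> borel_measurable M) \<and>
     (\<forall>J c. finite J \<and> J \<subseteq> T \<longrightarrow>
        (\<exists>\<sigma>\<ge>0. distr M borel (\<lambda>\<omega>. \<Sum>t\<in>J. c t * X t \<omega>) =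
           (if \<sigma> = 0 then return borel 0
            else density lborel (\<lambda>x. ennreal (normal_density 0 \<sigma> x)))))"

text \<open>Equality of the laws on the product space of all functions on \<open>T\<close>; equivalently, equality
  of all finite-dimensional distributions. Measurability is required because \<^const>\<open>distr\<close>
  is only meaningful for measurable maps.\<close>

definition equal_in_law ::
  "real set \<Rightarrow> 'a measure \<Rightarrow> (real \<Rightarrow> 'a \<Rightarrow> real) \<Rightarrow> 'b measure \<Rightarrow> (real \<Rightarrow> 'b \<Rightarrow> real) \<Rightarrow> bool" where
  "equal_in_law T M X N Y \<longleftrightarrow>
     (\<forall>t\<in>T. X t \<in> borel_measurable M) \<and>
     (\<forall>t\<in>T. Y t \<in> borel_measurable N) \<and>
     distr M (\<Pi>\<^sub>M t\<in>T. borel) (\<lambda>\<omega>. \<lambda>t\<in>T. X t \<omega>) =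
     distr N (\<Pi>\<^sub>M t\<in>T. borel) (\<lambda>\<omega>. \<lambda>t\<in>T. Y t \<omega>)"

definition iid_std_normal :: "'a measure \<Rightarrow> (nat \<Rightarrow> 'a \<Rightarrow> real) \<Rightarrow> bool" where
  "iid_std_normal N \<xi> \<longleftrightarrow>
     prob_space N \<and>
     prob_space.indep_vars N (\<lambda>_. borel) \<xi> {1..} \<and>
     (\<forall>k\<ge>1. distributed N lborel (\<xi> k) (\<lambda>x. ennreal (std_normal_density x)))"

subsection \<open>Fredholm operators on the space of square-integrable functions on the unit interval\<close>

abbreviation I01 :: "real measure" where
  "I01 \<equiv> restrict_space lborel {0..1}"

text \<open>Elements of the Hilbert space are represented by functions; equality in it is equality
  almost everywhere with respect to \<^const>\<open>I01\<close>.\<close>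

definition L2 :: "(real \<Rightarrow> real) set" where
  "L2 = {h. h \<in> borel_measurable I01 \<and> integrable I01 (\<lambda>t. (h t)\<^sup>2)}"

definition orthonormal_L2 :: "(nat \<Rightarrow> real \<Rightarrow> real) \<Rightarrow> bool" where
  "orthonormal_L2 e \<longleftrightarrow>
     (\<forall>k\<ge>1. e k \<in> L2) \<and>
     (\<forall>i\<ge>1. \<forall>j\<ge>1. (LINT t|I01. e i t * e j t) = (if i = j then 1 else 0))"

definition covariance :: "'a measure \<Rightarrow> (real \<Rightarrow> 'a \<Rightarrow> real) \<Rightarrow> real \<Rightarrow> real \<Rightarrow> real" where
  "covariance M X s t = (LINT \<omega>|M. X s \<omega> * X t \<omega>)"

definition L2_kernel :: "(real \<Rightarrow> real \<Rightarrow> real) \<Rightarrow> bool" where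
  "L2_kernel K \<longleftrightarrow>
     (\<lambda>(s, t). K s t) \<in> borel_measurable (I01 \<Otimes>\<^sub>M I01) \<and>
     integrable (I01 \<Otimes>\<^sub>M I01) (\<lambda>(s, t). (K s t)\<^sup>2)"

definition fredholm :: "(real \<Rightarrow> real \<Rightarrow> real) \<Rightarrow> (real \<Rightarrow> real) \<Rightarrow> real \<Rightarrow> real" where
  "fredholm K h t = (LINT s|I01. K s t * h s)"

definition eigenspace :: "(real \<Rightarrow> real \<Rightarrow> real) \<Rightarrow> real \<Rightarrow> (real \<Rightarrow> real) set" where
  "eigenspace K \<mu> = {h \<in> L2. AE t in I01. fredholm K h t = \<mu> * h t}"

text \<open>The eigenspace of \<open>\<mu>\<close>, modulo equality almost everywhere, has dimension \<open>n\<close>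
  (with \<open>n = 0\<close> iff \<open>\<mu>\<close> is not an eigenvalue).\<close>

definition has_multiplicity :: "(real \<Rightarrow> real \<Rightarrow> real) \<Rightarrow> real \<Rightarrow> nat \<Rightarrow> bool" where
  "has_multiplicity K \<mu> n \<longleftrightarrow>
     (\<exists>b :: nat \<Rightarrow> real \<Rightarrow> real.
        (\<forall>i<n. b i \<in> eigenspace K \<mu>) \<and>
        (\<forall>c. (AE t in I01. (\<Sum>i<n. c i * b i t) = 0) \<longrightarrow> (\<forall>i<n. c i = 0)) \<and>
        (\<forall>h\<in>eigenspace K \<mu>. \<exists>c. AE t in I01. h t = (\<Sum>i<n. c i * b i t)))"

text \<open>\<open>\<lambda>\<^sub>1 \<ge> \<lambda>\<^sub>2 \<ge> \<dots> \<ge> 0\<close> lists the eigenvalues with multiplicity, where 0 may be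
  omitted (or listed fewer times than its multiplicity).\<close>

definition eigenvalue_sequence :: "(real \<Rightarrow> real \<Rightarrow> real) \<Rightarrow> (nat \<Rightarrow> real) \<Rightarrow> bool" where
  "eigenvalue_sequence K lam \<longleftrightarrow>
     (\<forall>i\<ge>1. \<forall>j\<ge>i. lam j \<le> lam i) \<and>
     (\<forall>k\<ge>1. 0 \<le> lam k) \<and>
     (\<forall>\<mu>. \<mu> \<noteq> 0 \<longrightarrow>
        finite {k. 1 \<le> k \<and> lam k = \<mu>} \<and> has_multiplicity K \<mu> (card {k. 1 \<le> k \<and> lam k = \<mu>}))"

subsection \<open>Karhunen--Loeve expansions\<close>

definition KL_partial_sum ::
  "(nat \<Rightarrow> 'b \<Rightarrow> real) \<Rightarrow> (nat \<Rightarrow> real) \<Rightarrow> (nat \<Rightarrow> real \<Rightarrow> real) \<Rightarrow> nat \<Rightarrow> real \<Rightarrow> 'b \<Rightarrow> real" where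
  "KL_partial_sum \<xi> lam e n t \<omega> = (\<Sum>k=1..n. \<xi> k \<omega> * sqrt (lam k) * e k t)"

text \<open>Mean-square convergence of the random series, with sum \<open>Y\<close>: at each \<open>t\<close>, and also
  integrated over the unit interval.\<close>

definition KL_series_converges ::
  "'b measure \<Rightarrow> (nat \<Rightarrow> 'b \<Rightarrow> real) \<Rightarrow> (nat \<Rightarrow> real) \<Rightarrow> (nat \<Rightarrow> real \<Rightarrow> real) \<Rightarrow>
   (real \<Rightarrow> 'b \<Rightarrow> real) \<Rightarrow> bool" where
  "KL_series_converges N \<xi> lam e Y \<longleftrightarrow>
     (\<forall>t\<in>{0..1}. Y t \<in> borel_measurable N) \<and>
     (\<forall>t\<in>{0..1}.
        (\<lambda>n. \<integral>\<^sup>+\<omega>. ennreal ((KL_partial_sum \<xi> lam e n t \<omega> - Y t \<omega>)\<^sup>2) \<partial>N) \<longlonglongrightarrow> 0) \<and>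
     (\<lambda>n. \<integral>\<^sup>+t. (\<integral>\<^sup>+\<omega>. ennreal ((KL_partial_sum \<xi> lam e n t \<omega> - Y t \<omega>)\<^sup>2) \<partial>N) \<partial>I01) \<longlonglongrightarrow> 0"

text \<open>The variables \<open>\<xi>\<close> may live on a probability space different from that of \<open>X\<close>.\<close>

definition KL_expansion ::
  "'a measure \<Rightarrow> (real \<Rightarrow> 'a \<Rightarrow> real) \<Rightarrow> 'b measure \<Rightarrow> (nat \<Rightarrow> 'b \<Rightarrow> real) \<Rightarrow>
   (nat \<Rightarrow> real) \<Rightarrow> (nat \<Rightarrow> real \<Rightarrow> real) \<Rightarrow> bool" where
  "KL_expansion M X N \<xi> lam e \<longleftrightarrow>
     centered_gaussian_process M {0..1} X \<and>
     L2_kernel (covariance M X) \<and>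
     iid_std_normal N \<xi> \<and>
     orthonormal_L2 e \<and>
     eigenvalue_sequence (covariance M X) lam \<and>
     (\<forall>k\<ge>1. e k \<in> eigenspace (covariance M X) (lam k)) \<and>
     (\<exists>Y. KL_series_converges N \<xi> lam e Y \<and> equal_in_law {0..1} M X N Y)"

subsection \<open>The mean-centered time-changed Wiener process\<close>

definition W_gamma :: "real \<Rightarrow> (real \<Rightarrow> 'a \<Rightarrow> real) \<Rightarrow> real \<Rightarrow> 'a \<Rightarrow> real" where
  "W_gamma \<gamma> W t \<omega> = 1 / sqrt (1 + 2 * \<gamma>) *
     (W (t powr (1 + 2 * \<gamma>)) \<omega> - (LINT u|I01. W (u powr (1 + 2 * \<gamma>)) \<omega>))"

definition KL_eigenvalue :: "real \<Rightarrow> nat \<Rightarrow> real" where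
  "KL_eigenvalue \<nu> k = (2 * \<nu> / bessel_zero \<nu> k)\<^sup>2"

definition KL_eigenfun_formula :: "real \<Rightarrow> nat \<Rightarrow> real \<Rightarrow> real" where
  "KL_eigenfun_formula \<nu> k t = t powr (1 / (2 * \<nu>) - 1 / 2) *
     (bessel_J (\<nu> - 1) (bessel_zero \<nu> k * t powr (1 / (2 * \<nu>))) /
      (sqrt \<nu> * bessel_J (\<nu> - 1) (bessel_zero \<nu> k)))"

text \<open>The formula is meant for \<open>0 < t\<close>: at 0 it involves \<open>bessel_J (\<nu> - 1) 0\<close> with
  \<open>\<nu> < 1\<close>, where the Bessel function is singular. Being a process on all of \<open>{0..1}\<close>, the
  expansion needs a value at 0, which is the limit from the right.\<close>

definition KL_eigenfun :: "real \<Rightarrow> nat \<Rightarrow> real \<Rightarrow> real" where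
  "KL_eigenfun \<nu> k t =
     (if t = 0 then Lim (at_right 0) (KL_eigenfun_formula \<nu> k) else KL_eigenfun_formula \<nu> k t)"

end

theory Submission
  imports Defs "HOL-Complex_Analysis.Complex_Analysis"
begin

text \<open>
  Put \<open>q = 2 + 2\<gamma>\<close> and \<open>a = q - 1 = 1 + 2\<gamma>\<close>, so that \<open>\<nu> = 1/q\<close> and the process is
  \<open>a\<close> to the power \<open>-1/2\<close> times \<open>W(t^a)\<close> minus its time average. Since \<open>E W(x) W(y)\<close> is the
  integral of \<open>1[v \<le> x] 1[v \<le> y]\<close>, its covariance is
  \<open>K(s,t) = (1/a) \<integral> g\<^sub>s(v) g\<^sub>t(v) dv\<close> over the unit interval, with
  \<open>g\<^sub>t(v) = 1[v \<le> t^a] - (1 - v^(1/a))\<close>.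

  \<^emph>\<open>The spectrum.\<close> The kernel \<open>K\<close> annihilates constants. If \<open>h\<close> is an eigenfunction for
  \<open>\<mu> \<noteq> 0\<close>, then its primitive \<open>F\<close> vanishes at both endpoints and solves
  \<open>F'' = -c t^(q-2) F\<close> with \<open>c = 1/\<mu>\<close>. The solution that vanishes at 0 is unique up to a factor
  and is \<open>F(t) = t \<Phi>(c t^q)\<close>, where \<open>\<Phi>\<close> is the entire function that remains of \<open>J\<^sub>\<nu>\<close> after
  removal of its power; \<open>F'\<close> corresponds to \<open>J\<close> of index \<open>\<nu> - 1\<close> in the same way. So the
  reciprocal eigenvalues are the zeros of \<open>\<Phi>\<close>, which are the numbers \<open>(z/(2\<nu>))\<^sup>2\<close>; every
  eigenvalue is simple, with eigenfunction \<open>F'\<close> (lemmas \<open>eigenspace_Kq\<close> and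
  \<open>fredholm_Kq_Gsol\<close>).

  \<^emph>\<open>Completeness.\<close> Instead of the spectral theorem the proof uses a trace formula. The functions
  \<open>F(v^(1/a))\<close> are orthogonal, and Bessel's inequality for \<open>g\<^sub>t\<close> gives
  \<open>\<Sum>\<^sub>k \<lambda>\<^sub>k e\<^sub>k(t)\<^sup>2 \<le> K(t,t)\<close>. The integral of the difference over \<open>t\<close> is
  \<open>\<integral> K(t,t) dt - \<Sum>\<^sub>k \<lambda>\<^sub>k\<close>, and the first term equals \<open>-\<Phi>'(0)\<close>. As \<open>\<Phi>\<close> has order at most
  1/2 and \<open>\<Phi>(0) = 1\<close>, the reciprocals of its zeros, all of them positive and simple, sum to
  exactly \<open>-\<Phi>'(0)\<close> (\<open>sum_inverse_zeros_bound\<close>). Hence the Mercer remainder tends to 0 in mean,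
  and by its continuity in \<open>t\<close> even uniformly (\<open>mercer_rem_uniform_tendsto\<close>).

  \<^emph>\<open>The process.\<close> Uniform convergence of the Mercer series yields a mean-square limit \<open>Y\<close> of the
  random series, obtained almost surely along one fast subsequence (\<open>series_limit\<close>). Every linear
  combination of values of \<open>Y\<close>, and of values of the given process (\<open>W_gamma_cis\<close>), has the
  characteristic function of a centered normal law whose variance is the quadratic form of
  \<open>K\<close>; a multivariate uniqueness theorem, reduced to the one-dimensional theorem of Levy
  (\<open>joint_char_unique\<close>), turns this into equality of the laws.
\<close>

section \<open>The entire factors of two Bessel functions\<close>

definition bcoeff :: "real \<Rightarrow> nat \<Rightarrow> real" where
  "bcoeff q k = (\<Prod>m=1..k. 1 / (real m * q * (real m * q + 1)))"

text \<open>Up to the factor \<open>(x/2) powr \<nu> / Gamma (\<nu> + 1)\<close>, the value at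
  \<open>(q x / 2)\<^sup>2\<close> is \<open>J\<^sub>\<nu>(x)\<close>, where \<open>\<nu> =
  1/q\<close>. Both this series and the next one are used over the reals, where they describe
  eigenfunctions, and over the complex numbers, where the zeros of this one are counted.\<close>

definition Phi :: "real \<Rightarrow> 'a::{real_normed_field,banach} \<Rightarrow> 'a" where
  "Phi q w = (\<Sum>k. of_real ((-1)^k * bcoeff q k) * w ^ k)"

text \<open>The analogue of \<^const>\<open>Phi\<close> for the Bessel function of index
  \<open>\<nu> - 1\<close>, normalized by \<open>Gamma \<nu>\<close>.\<close>

definition Psi :: "real \<Rightarrow> 'a::{real_normed_field,banach} \<Rightarrow> 'a" where
  "Psi q w = (\<Sum>k. of_real ((-1)^k * (1 + real k * q) * bcoeff q k) * w ^ k)"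

text \<open>The solution of \<open>F'' = - c t^(q-2) F\<close> with \<open>F(0) = 0\<close> and
  \<open>F'(0) = 1\<close>; it is \<open>sqrt t\<close> times a Bessel function of a power of
  \<open>t\<close>. Its derivative is \<open>Gsol\<close> below.\<close>

definition Fsol :: "real \<Rightarrow> 'a::{real_normed_field,banach} \<Rightarrow> real \<Rightarrow> 'a" where
  "Fsol q c t = of_real t * Phi q (c * of_real (t powr q))"

definition Gsol :: "real \<Rightarrow> 'a::{real_normed_field,banach} \<Rightarrow> real \<Rightarrow> 'a" where
  "Gsol q c t = Psi q (c * of_real (t powr q))"

lemma bcoeff_0 [simp]: "bcoeff q 0 = 1"
  by (simp add: bcoeff_def)

lemma bcoeff_Suc: "bcoeff q (Suc k) = bcoeff q k / (real (Suc k) * q * (real (Suc k) * q + 1))"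
  by (simp add: bcoeff_def field_simps)

lemma exp_sums_real: "(\<lambda>k. r ^ k / fact k) sums exp (r::real)"
  using exp_converges[of r] by (simp add: field_simps scaleR_conv_of_real)

text \<open>Each term is the square of \<open>sqrt r ^ k / k!\<close>, and one of the two factors
  is at most the whole exponential series. This is what bounds the order of
  \<^const>\<open>Phi\<close> by 1/2.\<close>

lemma sums_square_exp:
  assumes "0 \<le> r"
  shows "summable (\<lambda>k. r ^ k / (fact k)\<^sup>2 :: real)" "(\<Sum>k. r ^ k / (fact k)\<^sup>2) \<le> exp (2 * sqrt r)"
proof -
  have s: "(\<lambda>k. exp (sqrt r) * (sqrt r ^ k / fact k)) sums (exp (sqrt r) * exp (sqrt r))"
    by (intro sums_mult exp_sums_real)
  have le: "r ^ k / (fact k)\<^sup>2 \<le> exp (sqrt r) * (sqrt r ^ k / fact k)" for k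
  proof -
    have "sqrt r ^ k / fact k = (\<Sum>i\<in>{k}. sqrt r ^ i / fact i)" by simp
    also have "\<dots> \<le> (\<Sum>i. sqrt r ^ i / fact i)"
      using exp_sums_real[of "sqrt r"] assms by (intro sum_le_suminf) (auto simp: sums_iff)
    also have "\<dots> = exp (sqrt r)" using exp_sums_real[of "sqrt r"] by (simp add: sums_iff)
    finally have "(sqrt r ^ k / fact k) * (sqrt r ^ k / fact k) \<le> exp (sqrt r) * (sqrt r ^ k / fact k)"
      using assms by (intro mult_right_mono) auto
    moreover have "(sqrt r ^ k / fact k) * (sqrt r ^ k / fact k) = r ^ k / (fact k)\<^sup>2"
      using assms by (simp add: power2_eq_square flip: power_mult_distrib)
    ultimately show ?thesis by simp
  qed
  show sm: "summable (\<lambda>k. r ^ k / (fact k)\<^sup>2 :: real)"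
    by (rule summable_comparison_test'[OF sums_summable[OF s], of 0]) (use le assms in auto)
  show "(\<Sum>k. r ^ k / (fact k)\<^sup>2) \<le> exp (2 * sqrt r)"
    using suminf_le[OF le sm sums_summable[OF s]] sums_unique[OF s]
    by (simp flip: exp_add)
qed

context
  fixes q :: real
  assumes q: "1 < q"
begin

lemma bcoeff_pos: "0 < bcoeff q k"
proof (induction k)
  case (Suc k)
  have "0 < real (Suc k) * q" using q by (intro mult_pos_pos) auto
  then show ?case unfolding bcoeff_Suc using Suc q by (intro divide_pos_pos mult_pos_pos add_pos_pos) auto
qed simp

text \<open>The factor \<open>1 + kq\<close> cancels against the product after a shift of one
  index: it remains to compare \<open>m q ((m - 1) q + 1)\<close> with
  \<open>m\<^sup>2\<close>.\<close>

lemma bcoeff_le: "(1 + real k * q) * bcoeff q k \<le> 1 / (fact k)\<^sup>2"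
proof (induction k)
  case (Suc k)
  have p: "0 < 1 + real k * q" using q by (simp add: add_pos_nonneg)
  have q1: "real (Suc k) * q + 1 > 0" using q by (simp add: add_pos_nonneg)
  have "(1 + real (Suc k) * q) * bcoeff q (Suc k) = bcoeff q k / (real (Suc k) * q)"
    unfolding bcoeff_Suc using q1 by (simp add: add.commute del: of_nat_Suc)
  also have "\<dots> = ((1 + real k * q) * bcoeff q k) / (real (Suc k) * q * (1 + real k * q))"
    using p by simp
  also have "\<dots> \<le> (1 / (fact k)\<^sup>2) / (real (Suc k) * real (Suc k))"
  proof (rule frac_le)
    show "real (Suc k) * real (Suc k) \<le> real (Suc k) * q * (1 + real k * q)"
    proof -
      have "real k * 1 \<le> real k * q" using q by (intro mult_left_mono) auto
      then have "real (Suc k) \<le> 1 + real k * q" by simp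
      moreover have "real (Suc k) * 1 \<le> real (Suc k) * q" using q by (intro mult_left_mono) auto
      ultimately show ?thesis by (intro mult_mono) auto
    qed
  qed (use Suc in auto)
  also have "\<dots> = 1 / (fact (Suc k))\<^sup>2"
    by (simp add: power2_eq_square field_simps)
  finally show ?case .
qed simp

lemma bcoeff_le': "bcoeff q k \<le> 1 / (fact k)\<^sup>2"
proof -
  have "1 * bcoeff q k \<le> (1 + real k * q) * bcoeff q k"
    using q bcoeff_pos[of k] by (intro mult_right_mono) auto
  with bcoeff_le[of k] show ?thesis by simp
qed

lemma Psi_coeff_norm: 
  "norm (of_real ((-1)^k * (1 + real k * q) * bcoeff q k) * w ^ k :: 'a::{real_normed_field,banach})
    \<le> norm w ^ k / (fact k)\<^sup>2"
proof -
  have "norm (of_real ((-1)^k * (1 + real k * q) * bcoeff q k) * w ^ k) = (1 + real k * q) * bcoeff q k * norm w ^ k"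
    unfolding norm_mult norm_of_real norm_power using q bcoeff_pos[of k] by (simp add: abs_mult)
  also have "\<dots> \<le> 1 / (fact k)\<^sup>2 * norm w ^ k"
    by (intro mult_right_mono bcoeff_le) simp
  finally show ?thesis by simp
qed

lemma Phi_coeff_norm: 
  "norm (of_real ((-1)^k * bcoeff q k) * w ^ k :: 'a::{real_normed_field,banach})
    \<le> norm w ^ k / (fact k)\<^sup>2"
proof -
  have "norm (of_real ((-1)^k * bcoeff q k) * w ^ k) = bcoeff q k * norm w ^ k"
    unfolding norm_mult norm_of_real norm_power using q bcoeff_pos[of k] by (simp add: abs_mult)
  also have "\<dots> \<le> 1 / (fact k)\<^sup>2 * norm w ^ k"
    by (intro mult_right_mono bcoeff_le') simp
  finally show ?thesis by simp
qed

lemma summable_Phi: "summable (\<lambda>k. of_real ((-1)^k * bcoeff q k) * w ^ k :: 'a::{real_normed_field,banach})"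
  by (rule summable_comparison_test'[OF sums_square_exp(1)[of "norm w"], of 0])
    (use Phi_coeff_norm in auto)

lemma summable_Psi: "summable (\<lambda>k. of_real ((-1)^k * (1 + real k * q) * bcoeff q k) * w ^ k :: 'a::{real_normed_field,banach})"
  by (rule summable_comparison_test'[OF sums_square_exp(1)[of "norm w"], of 0])
    (use Psi_coeff_norm in auto)

lemma norm_Phi_le: "norm (Phi q w :: 'a::{real_normed_field,banach}) \<le> exp (2 * sqrt (norm w))"
proof -
  have "norm (Phi q w) \<le> (\<Sum>k. norm w ^ k / (fact k)\<^sup>2)"
    unfolding Phi_def by (rule norm_suminf_le[OF Phi_coeff_norm sums_square_exp(1)]) simp
  also have "\<dots> \<le> exp (2 * sqrt (norm w))" by (rule sums_square_exp) simp
  finally show ?thesis .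
qed

lemma Phi_0 [simp]: "Phi q 0 = 1" and Psi_0 [simp]: "Psi q 0 = 1"
  by (simp_all add: Phi_def Psi_def)

text \<open>The relation \<open>\<Psi> = \<Phi> + q w \<Phi>'\<close> is the derivative of
  \<open>t \<Phi>(c t^q)\<close>, written at \<open>w = c t^q\<close>.\<close>

lemma Phi_has_derivative:
  fixes w :: "'a::{real_normed_field,banach}"
  shows "\<exists>D. (Phi q has_field_derivative D) (at w) \<and> Psi q w = Phi q w + of_real q * w * D"
proof -
  let ?c = "\<lambda>k. of_real ((-1)^k * bcoeff q k) :: 'a"
  let ?D = "\<Sum>n. diffs ?c n * w ^ n"
  have d: "(Phi q has_field_derivative ?D) (at w)"
    unfolding Phi_def[abs_def] by (rule termdiffs_strong_converges_everywhere[OF summable_Phi])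
  have sm: "summable (\<lambda>n. diffs ?c n * w ^ n)"
    by (rule termdiff_converges_all[OF summable_Phi])
  have "(\<lambda>n. of_nat n * ?c n * w ^ (n - Suc 0)) sums ?D"
    by (rule diffs_equiv[OF sm])
  from sums_mult[OF this, of "of_real q * w"]
  have "(\<lambda>n. of_real q * w * (of_nat n * ?c n * w ^ (n - Suc 0))) sums (of_real q * w * ?D)" .
  also have "(\<lambda>n. of_real q * w * (of_nat n * ?c n * w ^ (n - Suc 0))) = (\<lambda>n. of_real (real n * q) * ?c n * w ^ n)"
  proof
    fix n show "of_real q * w * (of_nat n * ?c n * w ^ (n - Suc 0)) = of_real (real n * q) * ?c n * w ^ n"
      by (cases n) (simp_all add: mult_ac)
  qed
  finally have "(\<lambda>n. ?c n * w ^ n + of_real (real n * q) * ?c n * w ^ n) sums (Phi q w + of_real q * w * ?D)"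
    unfolding Phi_def by (intro sums_add summable_sums summable_Phi)
  also have "(\<lambda>n. ?c n * w ^ n + of_real (real n * q) * ?c n * w ^ n) = 
    (\<lambda>k. of_real ((-1)^k * (1 + real k * q) * bcoeff q k) * w ^ k)"
    by (simp add: algebra_simps fun_eq_iff)
  finally have "Psi q w = Phi q w + of_real q * w * ?D"
    unfolding Psi_def by (simp add: sums_iff)
  with d show ?thesis by blast
qed

lemma Phi_deriv_eq:
  "(Phi q has_field_derivative (\<Sum>n. diffs (\<lambda>k. of_real ((-1)^k * bcoeff q k)) n * w ^ n)) (at (w :: 'a::{real_normed_field,banach}))"
  unfolding Phi_def[abs_def] by (rule termdiffs_strong_converges_everywhere[OF summable_Phi])

lemma Phi_deriv_0:
  "(Phi q has_field_derivative - of_real (bcoeff q 1)) (at (0 :: 'a::{real_normed_field,banach}))"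
  using Phi_deriv_eq[of 0] unfolding powser_zero by (simp add: diffs_def)

lemma Psi_has_derivative:
  fixes w :: "'a::{real_normed_field,banach}"
  shows "(Psi q has_field_derivative - Phi q w / of_real q) (at w)"
proof -
  let ?c = "\<lambda>k. of_real ((-1)^k * (1 + real k * q) * bcoeff q k) :: 'a"
  have d: "(Psi q has_field_derivative (\<Sum>n. diffs ?c n * w ^ n)) (at w)"
    unfolding Psi_def[abs_def] by (rule termdiffs_strong_converges_everywhere[OF summable_Psi])
  have "diffs ?c n = - of_real ((-1)^n * bcoeff q n) / of_real q" for n
  proof -
    have p: "real (Suc n) * q + 1 > 0" "real (Suc n) * q > 0" using q by (auto simp: add_pos_nonneg)
    have "real (Suc n) * ((-1)^Suc n * (1 + real (Suc n) * q) * bcoeff q (Suc n)) = - ((-1)^n * bcoeff q n) / q"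
      unfolding bcoeff_Suc using p q by (simp add: divide_simps)
    from arg_cong[OF this, of "of_real :: real \<Rightarrow> 'a"] show ?thesis
      unfolding diffs_def by (simp del: of_nat_Suc)
  qed
  then have "(\<Sum>n. diffs ?c n * w ^ n) = (\<Sum>n. (- 1 / of_real q) * (of_real ((-1)^n * bcoeff q n) * w ^ n))"
    by simp
  also have "\<dots> = (- 1 / of_real q) * Phi q w"
    unfolding Phi_def by (rule suminf_mult[OF summable_Phi])
  finally show ?thesis using d by simp
qed

lemma continuous_on_Phi: "continuous_on A (Phi q :: 'a::{real_normed_field,banach} \<Rightarrow> 'a)"
  by (intro continuous_at_imp_continuous_on ballI DERIV_isCont[OF Phi_deriv_eq])

lemma continuous_on_Psi: "continuous_on A (Psi q :: 'a::{real_normed_field,banach} \<Rightarrow> 'a)"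
  by (intro continuous_at_imp_continuous_on ballI DERIV_isCont[OF Psi_has_derivative])

lemma holomorphic_Phi: "(Phi q :: complex \<Rightarrow> complex) holomorphic_on A"
proof (rule holomorphic_onI)
  fix w
  show "(Phi q :: complex \<Rightarrow> complex) field_differentiable at w within A"
    unfolding field_differentiable_def using has_field_derivative_at_within[OF Phi_deriv_eq] by blast
qed

lemma Phi_of_real: "Phi q (complex_of_real x) = of_real (Phi q x)"
  unfolding Phi_def by (subst suminf_of_real[OF summable_Phi]) simp

text \<open>For a nonpositive argument no term of the alternating series is negative, and the
  first one is 1.\<close>

lemma Phi_nonpos_pos:
  assumes "x \<le> 0" shows "0 < Phi q (x::real)"
proof -
  have nn: "0 \<le> of_real ((-1)^k * bcoeff q k) * x ^ k" for k
  proof -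
    have "of_real ((-1)^k * bcoeff q k) * x ^ k = bcoeff q k * (- x) ^ k"
      unfolding power_minus[of x] by simp
    moreover have "0 \<le> bcoeff q k * (- x) ^ k"
      using assms bcoeff_pos[of k] by (intro mult_nonneg_nonneg zero_le_power) auto
    ultimately show ?thesis by (simp only:)
  qed
  have "1 = (\<Sum>k\<in>{0}. of_real ((-1)^k * bcoeff q k) * x ^ k)" by simp
  also have "\<dots> \<le> Phi q x"
    unfolding Phi_def by (rule sum_le_suminf[OF summable_Phi]) (use nn in auto)
  finally show ?thesis by simp
qed

lemma Fsol_0 [simp]: "Fsol q c 0 = 0" by (simp add: Fsol_def)
lemma Gsol_0 [simp]: "Gsol q c 0 = 1" by (simp add: Gsol_def)
lemma Fsol_1: "Fsol q c 1 = Phi q c" by (simp add: Fsol_def)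
lemma Gsol_1: "Gsol q c 1 = Psi q c" by (simp add: Gsol_def)

lemma powr_q_deriv:
  assumes "0 < t"
  shows "((\<lambda>t. c * of_real (t powr q) :: 'a::{real_normed_field,banach}) has_vector_derivative
     (c * of_real (q * t powr (q - 1)))) (at t)"
  using assms
  by (intro has_vector_derivative_mult_right has_vector_derivative_of_real)
     (simp add: has_real_derivative_powr flip: has_real_derivative_iff_has_vector_derivative)

lemma Fsol_deriv:
  fixes c :: "'a::{real_normed_field,banach}"
  assumes "0 < t"
  shows "(Fsol q c has_vector_derivative Gsol q c t) (at t)"
proof -
  let ?w = "c * of_real (t powr q)"
  obtain D where D: "(Phi q has_field_derivative D) (at ?w)" "Psi q ?w = Phi q ?w + of_real q * ?w * D"
    using Phi_has_derivative by blast
  have "((Phi q \<circ> (\<lambda>t. c * of_real (t powr q))) has_vector_derivative (c * of_real (q * t powr (q - 1))) * D) (at t)"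
    by (rule field_vector_diff_chain_at[OF powr_q_deriv[OF assms] D(1)])
  then have "((\<lambda>t. of_real t * Phi q (c * of_real (t powr q))) has_vector_derivative
      (of_real t * ((c * of_real (q * t powr (q - 1))) * D) + of_real 1 * Phi q ?w)) (at t)"
    unfolding o_def by (intro has_vector_derivative_mult has_vector_derivative_of_real) auto
  moreover have "of_real t * ((c * of_real (q * t powr (q - 1))) * D) = of_real q * ?w * D"
  proof -
    have "t * t powr (q - 1) = t powr q"
      using assms powr_add[of t 1 "q - 1"] by simp
    then have "of_real t * of_real (t powr (q - 1)) = (of_real (t powr q) :: 'a)"
      by (metis of_real_mult)
    moreover have "of_real t * ((c * of_real (q * t powr (q - 1))) * D)
        = of_real q * (c * (of_real t * of_real (t powr (q - 1)))) * D"
      by (simp add: mult_ac)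
    ultimately show ?thesis by (simp only:)
  qed
  moreover have "Gsol q c t = of_real q * ?w * D + of_real 1 * Phi q ?w"
    unfolding Gsol_def D(2) by simp
  ultimately show ?thesis unfolding Fsol_def[abs_def] by (simp only:)
qed

lemma Gsol_deriv:
  fixes c :: "'a::{real_normed_field,banach}"
  assumes "0 < t"
  shows "(Gsol q c has_vector_derivative - c * of_real (t powr (q - 2)) * Fsol q c t) (at t)"
proof -
  let ?w = "c * of_real (t powr q)"
  have "((Psi q \<circ> (\<lambda>t. c * of_real (t powr q))) has_vector_derivative (c * of_real (q * t powr (q - 1))) * (- Phi q ?w / of_real q)) (at t)"
    by (rule field_vector_diff_chain_at[OF powr_q_deriv[OF assms] Psi_has_derivative])
  moreover have "(c * of_real (q * t powr (q - 1))) * (- Phi q ?w / of_real q) = - c * of_real (t powr (q - 2)) * Fsol q c t"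
  proof -
    have "t powr (q - 1) = t powr (q - 2) * t"
      using assms powr_add[of t 1 "q - 2"] by simp
    then show ?thesis unfolding Fsol_def using q by (simp add: field_simps)
  qed
  ultimately show ?thesis unfolding Gsol_def[abs_def] o_def by simp
qed

lemma continuous_on_powr_q: "continuous_on {0..} (\<lambda>t. t powr q)"
  using q by (intro continuous_on_powr' continuous_intros) auto

lemma continuous_on_Fsol: "continuous_on {0..} (Fsol q c :: real \<Rightarrow> 'a::{real_normed_field,banach})"
  unfolding Fsol_def
  by (intro continuous_intros continuous_on_powr_q continuous_on_compose2[OF continuous_on_Phi[of UNIV]]) auto

lemma continuous_on_Gsol: "continuous_on {0..} (Gsol q c :: real \<Rightarrow> 'a::{real_normed_field,banach})"
  unfolding Gsol_def
  by (intro continuous_intros continuous_on_powr_q continuous_on_compose2[OF continuous_on_Psi[of UNIV]]) auto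

end

section \<open>Zeros of the characteristic function\<close>

text \<open>A Pohozaev functional of the solution \<^const>\<open>Fsol\<close>: its derivative is
  a multiple of \<open>t^(q-2) F\<^sup>2\<close> alone, so its boundary values compute the
  weighted norm of \<open>F\<close>.\<close>

definition pohozaev :: "real \<Rightarrow> real \<Rightarrow> real \<Rightarrow> real" where
  "pohozaev q c t = t * (Gsol q c t)\<^sup>2 + c * t powr (q - 1) * (Fsol q c t)\<^sup>2 - Fsol q c t * Gsol q c t"

context
  fixes q :: real
  assumes q: "1 < q"
begin

lemma Phi_ne_0_near_0:
  obtains d where "0 < d" "d < 1" "\<And>t. 0 \<le> t \<Longrightarrow> t \<le> d \<Longrightarrow> Phi q (c * of_real (t powr q) :: 'a::{real_normed_field,banach}) \<noteq> 0"
proof -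
  have "continuous_on {0..} (\<lambda>t. Phi q (c * of_real (t powr q) :: 'a))"
    by (intro continuous_intros continuous_on_powr_q[OF q] continuous_on_compose2[OF continuous_on_Phi[OF q, of UNIV]]) auto
  then have "\<exists>e>0. \<forall>t\<in>{0..}. dist t 0 < e \<longrightarrow> dist (Phi q (c * of_real (t powr q) :: 'a)) (Phi q (c * of_real (0 powr q))) < 1"
    unfolding continuous_on_iff by (rule allE[where x = 1, OF bspec[where x = 0]]) auto
  then obtain e where e: "e > 0" "\<And>t. 0 \<le> t \<Longrightarrow> dist t 0 < e \<Longrightarrow> dist (Phi q (c * of_real (t powr q) :: 'a)) 1 < 1"
    using Phi_0[OF q, where 'a = 'a] by auto
  show ?thesis
  proof (rule that[of "min (e/2) (1/2)"])
    fix t :: real assume "0 \<le> t" "t \<le> min (e/2) (1/2)"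
    then have "dist (Phi q (c * of_real (t powr q) :: 'a)) 1 < 1" using e by (intro e(2)) auto
    then show "Phi q (c * of_real (t powr q) :: 'a) \<noteq> 0" by auto
  qed (use e in auto)
qed

text \<open>The derivative is nonnegative throughout and positive near 0, where
  \<open>F(t)\<close> behaves like \<open>t\<close>. Boundary values of such a function therefore
  cannot agree; this excludes nonreal zeros and double zeros of
  \<^const>\<open>Phi\<close>.\<close>

lemma energy_increases:
  fixes c :: "'a::{real_normed_field,banach}"
  assumes "0 < k" "continuous_on {0..1} f"
    and d: "\<And>t. 0 < t \<Longrightarrow> t < 1 \<Longrightarrow> (f has_real_derivative k * (t powr (q - 2) * (norm (Fsol q c t))\<^sup>2)) (at t)"
  shows "f 0 < f 1"
proof -
  obtain e where e: "0 < e" "e < 1" "\<And>t. 0 \<le> t \<Longrightarrow> t \<le> e \<Longrightarrow> Phi q (c * of_real (t powr q)) \<noteq> 0"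
    using Phi_ne_0_near_0[of c] by metis
  have "f 0 < f e"
  proof (rule DERIV_pos_imp_increasing_open[where f = f])
    show "0 < e" by (rule e)
    fix x assume x: "0 < x" "x < e"
    then have "Fsol q c x \<noteq> 0" using e(3)[of x] by (simp add: Fsol_def)
    then have "0 < k * (x powr (q - 2) * (norm (Fsol q c x))\<^sup>2)" using x assms(1) by simp
    with d[of x] x e show "\<exists>y. DERIV f x :> y \<and> y > 0" by auto
  qed (use e assms(2) in \<open>auto elim: continuous_on_subset\<close>)
  also have "f e \<le> f 1"
  proof (rule DERIV_nonneg_imp_increasing_open[where f = f])
    show "e \<le> 1" using e by simp
    fix x assume x: "e < x" "x < 1"
    have "0 \<le> k * (x powr (q - 2) * (norm (Fsol q c x))\<^sup>2)" using assms(1) by simp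
    with d[of x] x e show "\<exists>y. DERIV f x :> y \<and> y \<ge> 0" by auto
  qed (use e assms(2) in \<open>auto elim: continuous_on_subset\<close>)
  finally show ?thesis .
qed

lemma continuous_on_Fsol_01: "continuous_on {0..1} (Fsol q c :: real \<Rightarrow> 'a::{real_normed_field,banach})"
  and continuous_on_Gsol_01: "continuous_on {0..1} (Gsol q c :: real \<Rightarrow> 'a::{real_normed_field,banach})"
  by (rule continuous_on_subset[OF continuous_on_Fsol[OF q]], simp,
      rule continuous_on_subset[OF continuous_on_Gsol[OF q]], simp)

text \<open>Self-adjointness of the boundary value problem, without integrals: \<open>Im (F cnj
  F')\<close> has derivative \<open>Im c t^(q-2) |F|\<^sup>2\<close> and vanishes at both
  endpoints when \<open>\<Phi>(c) = 0\<close>.\<close>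

lemma Phi_complex_zero_Im:
  fixes c :: complex
  assumes "Phi q c = 0"
  shows "Im c = 0"
proof (rule ccontr)
  assume nz: "Im c \<noteq> 0"
  define f where "f t = Im (Fsol q c t * cnj (Gsol q c t))" for t
  have deriv: "(f has_real_derivative Im c * (t powr (q - 2) * (norm (Fsol q c t))\<^sup>2)) (at t)"
    if t: "0 < t" for t
  proof -
    let ?F = "Fsol q c t" and ?G = "Gsol q c t"
    have "((\<lambda>t. Fsol q c t * cnj (Gsol q c t)) has_vector_derivative
        (?F * cnj (- c * of_real (t powr (q - 2)) * ?F) + ?G * cnj ?G)) (at t)"
      by (intro has_vector_derivative_mult has_vector_derivative_cnj Fsol_deriv[OF q t] Gsol_deriv[OF q t])
    then have "(f has_vector_derivative Im (?F * cnj (- c * of_real (t powr (q - 2)) * ?F) + ?G * cnj ?G)) (at t)"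
      unfolding f_def by (rule bounded_linear.has_vector_derivative[OF bounded_linear_Im])
    moreover have "?F * cnj (- c * of_real (t powr (q - 2)) * ?F) + ?G * cnj ?G
        = - cnj c * of_real (t powr (q - 2) * (norm ?F)\<^sup>2) + of_real ((norm ?G)\<^sup>2)"
      unfolding complex_norm_square of_real_mult by (simp add: mult_ac)
    moreover have "Im (- cnj c * of_real (t powr (q - 2) * (norm ?F)\<^sup>2) + of_real ((norm ?G)\<^sup>2))
        = Im c * (t powr (q - 2) * (norm ?F)\<^sup>2)"
      by (simp flip: of_real_mult of_real_power)
    ultimately show ?thesis
      unfolding has_real_derivative_iff_has_vector_derivative by (simp only:)
  qed
  have cont: "continuous_on {0..1} f"
    unfolding f_def by (intro continuous_intros continuous_on_Fsol_01 continuous_on_Gsol_01)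
  have f01: "f 0 = 0" "f 1 = 0" using assms by (simp_all add: f_def Fsol_0[OF q] Fsol_1[OF q])
  show False
  proof (cases "Im c > 0")
    case True
    have "f 0 < f 1" by (rule energy_increases[OF True cont]) (use deriv in auto)
    with f01 show False by simp
  next
    case False
    then have pos: "0 < - Im c" using nz by simp
    have "- f 0 < - f 1"
    proof (rule energy_increases[OF pos, where c = c and f = "\<lambda>t. - f t"])
      show "continuous_on {0..1} (\<lambda>t. - f t)" using cont by (intro continuous_intros)
      fix t :: real assume "0 < t" "t < 1"
      from DERIV_minus[OF deriv[of t]] this
      show "((\<lambda>t. - f t) has_real_derivative - Im c * (t powr (q - 2) * (norm (Fsol q c t))\<^sup>2)) (at t)" by simp
    qed
    with f01 show False by simp
  qed
qed

lemma Phi_complex_zero: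
  fixes c :: complex
  assumes "Phi q c = 0"
  obtains x where "0 < x" "c = of_real x" "Phi q x = 0"
proof -
  have c: "c = of_real (Re c)" using Phi_complex_zero_Im[OF assms] by (simp add: complex_eq_iff)
  then have 1: "Phi q (Re c) = 0" using assms Phi_of_real[OF q, of "Re c"] by simp
  then have "0 < Re c" using Phi_nonpos_pos[OF q, of "Re c"] by force
  with 1 c that show ?thesis by blast
qed

lemma Fsol_real_deriv: "0 < t \<Longrightarrow> (Fsol q c has_real_derivative Gsol q c t) (at t)"
  using Fsol_deriv[OF q, of t c] by (simp add: has_real_derivative_iff_has_vector_derivative)

lemma Gsol_real_deriv: "0 < t \<Longrightarrow> (Gsol q c has_real_derivative - c * t powr (q - 2) * Fsol q c t) (at t)"
  using Gsol_deriv[OF q, of t c] by (simp add: has_real_derivative_iff_has_vector_derivative)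

lemma pohozaev_deriv:
  assumes t: "0 < t"
  shows "(pohozaev q c has_real_derivative c * q * (t powr (q - 2) * (Fsol q c t)\<^sup>2)) (at t)"
proof -
  have e: "t powr (q - 1) = t powr (q - 2) * t"
    using t powr_add[of t 1 "q - 2"] by simp
  have p: "((\<lambda>t. t powr (q - 1)) has_real_derivative (q - 1) * t powr (q - 2)) (at t)"
    using has_real_derivative_powr[OF t, of "q - 1"] by simp
  show ?thesis unfolding pohozaev_def[abs_def]
    by (rule derivative_eq_intros Fsol_real_deriv[OF t] Gsol_real_deriv[OF t] p refl)+
       (unfold e, simp add: algebra_simps power2_eq_square)
qed

lemma continuous_on_powr_q1: "continuous_on {0..1} (\<lambda>t. t powr (q - 1))"
  using q by (intro continuous_on_powr' continuous_intros) auto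

lemma continuous_on_pohozaev: "continuous_on {0..1} (pohozaev q c)"
  unfolding pohozaev_def by (intro continuous_intros continuous_on_Fsol_01 continuous_on_Gsol_01 continuous_on_powr_q1)

lemma pohozaev_0: "pohozaev q c 0 = 0" and pohozaev_1: "pohozaev q c 1 = (Psi q c)\<^sup>2 + c * (Phi q c)\<^sup>2 - Phi q c * Psi q c"
  by (simp_all add: pohozaev_def Fsol_0[OF q] Fsol_1[OF q] Gsol_1[OF q])

text \<open>At a zero \<open>c\<close> of \<^const>\<open>Phi\<close> the functional
  \<^const>\<open>pohozaev\<close> climbs from 0 to \<open>\<Psi>(c)\<^sup>2\<close>.\<close>

lemma Psi_ne_0:
  assumes "0 < c" "Phi q c = 0" shows "Psi q (c::real) \<noteq> 0"
proof -
  have "pohozaev q c 0 < pohozaev q c 1"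
    by (rule energy_increases[of "c * q", OF _ continuous_on_pohozaev, where c = c])
       (use pohozaev_deriv q assms in auto)
  then show ?thesis using assms by (auto simp: pohozaev_0 pohozaev_1)
qed

text \<open>At a double zero the relation \<open>\<Psi> = \<Phi> + q w \<Phi>'\<close> would make
  \<^const>\<open>Psi\<close> vanish as well.\<close>

lemma Phi_complex_simple_zero:
  fixes c :: complex
  assumes "Phi q c = 0" "(Phi q has_field_derivative D) (at c)"
  shows "D \<noteq> 0"
proof
  assume "D = 0"
  obtain D' where "(Phi q has_field_derivative D') (at c)" "Psi q c = Phi q c + of_real q * c * D'"
    using Phi_has_derivative[OF q] by blast
  with DERIV_unique[OF this(1) assms(2)] \<open>D = 0\<close> assms(1) have P0: "Psi q c = 0" by simp
  obtain x where x: "0 < x" "c = of_real x" "Phi q x = 0" using Phi_complex_zero[OF assms(1)] .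
  have "Psi q c = of_real (Psi q x)"
    unfolding Psi_def x(2) by (subst suminf_of_real[OF summable_Psi[OF q]]) simp
  with P0 Psi_ne_0[OF x(1,3)] show False by simp
qed

lemma finite_Phi_zeros: "finite {c :: complex. Phi q c = 0 \<and> norm c \<le> R}"
proof -
  have "\<not> (Phi q :: complex \<Rightarrow> complex) constant_on UNIV"
  proof
    assume "(Phi q :: complex \<Rightarrow> complex) constant_on UNIV"
    then obtain y where "\<And>c :: complex. Phi q c = y" unfolding constant_on_def by auto
    then have "(Phi q :: complex \<Rightarrow> complex) = (\<lambda>_. y)" by auto
    then have "((Phi q :: complex \<Rightarrow> complex) has_field_derivative 0) (at 0)" by simp
    from DERIV_unique[OF Phi_deriv_0[OF q] this] bcoeff_pos[OF q, of 1] show False by simp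
  qed
  then have "finite {c \<in> cball 0 R. Phi q (c :: complex) = 0}"
    by (intro holomorphic_compact_finite_zeros[where S = UNIV] holomorphic_Phi[OF q]) auto
  then show ?thesis by (rule rev_finite_subset) auto
qed

text \<open>Oscillation of \<open>u'' = - t^(q-2) u\<close> on the half-line. A solution of
  constant sign past \<open>T\<close> is concave in absolute value, hence nondecreasing and
  bounded below by a positive constant; but then its slope decreases at least like \<open>-
  t^(q-1)\<close>, which tends to minus infinity because \<open>q > 1\<close>.\<close>

lemma infinite_Phi_zeros: "\<exists>c>X. Phi q (c :: real) = 0"
proof (rule ccontr)
  assume no: "\<not> ?thesis"
  \<comment> \<open>beyond this point \<open>t^q\<close> exceeds \<open>X\<close>, so the solution has no zero there\<close>
  define T where "T = (max X 1) powr (1 / q) + 1"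
  have T: "T > 1" "\<And>t. t \<ge> T \<Longrightarrow> t powr q > X"
  proof -
    show "T > 1" unfolding T_def by simp
    fix t assume "t \<ge> T"
    then have "max X 1 powr (1 / q) < t" by (simp add: T_def)
    then have "(max X 1 powr (1 / q)) powr q < t powr q" using q by (intro powr_less_mono2) auto
    then show "t powr q > X" using q by (simp add: powr_powr)
  qed
  have nz: "Fsol q (1::real) t \<noteq> 0" if "t \<ge> T" for t :: real
    using no T(1) T(2)[OF that] that by (auto simp: Fsol_def)
  define s where "s = sgn (Fsol q (1::real) T)"
  have s: "s * s = 1" "s * Fsol q 1 T > 0" using nz[of T] by (auto simp: s_def sgn_if)
  define u where "u t = s * Fsol q (1::real) t" for t
  define u' where "u' t = s * Gsol q (1::real) t" for t
  have du: "(u has_real_derivative u' t) (at t)" if "t > 0" for t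
    unfolding u_def u'_def by (intro DERIV_cmult Fsol_real_deriv that)
  have du': "(u' has_real_derivative - (t powr (q - 2) * u t)) (at t)" if "t > 0" for t
    using DERIV_cmult[OF Gsol_real_deriv[OF that, of 1], of s] unfolding u_def u'_def by (simp add: algebra_simps)
  have upos: "u t > 0" if "t \<ge> T" for t
  proof (rule ccontr)
    assume "\<not> u t > 0"
    have "\<exists>x\<ge>T. x \<le> t \<and> u x = 0"
    proof (rule IVT2')
      show "u t \<le> 0" "T \<le> t" using \<open>\<not> u t > 0\<close> that by auto
      show "0 \<le> u T" using s(2) by (simp add: u_def)
      have "{T..t} \<subseteq> {0..}" using T(1) by auto
      then show "continuous_on {T..t} u"
        unfolding u_def[abs_def] by (intro continuous_on_mult continuous_on_const continuous_on_subset[OF continuous_on_Fsol[OF q]])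
    qed
    then show False using nz s(1) by (auto simp: u_def)
  qed
  have u'_anti: "u' y \<le> u' x" if "T \<le> x" "x \<le> y" for x y
  proof (rule DERIV_nonpos_imp_nonincreasing[OF that(2)])
    fix z assume z: "x \<le> z" "z \<le> y"
    have "- (z powr (q - 2) * u z) \<le> 0" using upos[of z] z that by simp
    with du'[of z] z that T(1) show "\<exists>w. DERIV u' z :> w \<and> w \<le> 0" by force
  qed
  have u'_nonneg: "u' x \<ge> 0" if x: "T \<le> x" for x
  proof (rule ccontr)
    assume neg: "\<not> u' x \<ge> 0"
    \<comment> \<open>the tangent at \<open>x\<close> meets the axis at \<open>y\<close>\<close>
    define y where "y = x + u x / (- u' x)"
    have y: "y > x" using divide_pos_pos[OF upos[OF x], of "- u' x"] neg by (simp add: y_def)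
    have "\<exists>z. z > x \<and> z < y \<and> u y - u x = (y - x) * u' z"
      by (rule MVT2[OF y]) (use x T du in auto)
    then obtain z where z: "x < z" "u y - u x = (y - x) * u' z" by blast
    have "(y - x) * u' z \<le> (y - x) * u' x" using u'_anti[OF x, of z] z y by (intro mult_left_mono) auto
    also have "\<dots> = - u x" using neg by (simp add: y_def)
    finally have "u y \<le> 0" using z by simp
    with upos[of y] y x show False by simp
  qed
  have u_mono: "u T \<le> u t" if "t \<ge> T" for t
  proof (rule DERIV_nonneg_imp_nondecreasing[OF that])
    fix x assume "T \<le> x"
    then show "\<exists>y. DERIV u x :> y \<and> y \<ge> 0" using du[of x] u'_nonneg[of x] T(1) by auto
  qed
  define m where "m = u T / (q - 1)"
  have m: "m > 0" using upos[of T] q by (simp add: m_def)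
  \<comment> \<open>integrates \<open>u'' \<le> - u T * t powr (q - 2)\<close>\<close>
  have dec: "u' t + m * t powr (q - 1) \<le> u' T + m * T powr (q - 1)" if "t \<ge> T" for t
  proof (rule DERIV_nonpos_imp_nonincreasing[OF that])
    fix z assume z: "T \<le> z" "z \<le> t"
    then have z0: "z > 0" using T by simp
    have "((\<lambda>t. t powr (q - 1)) has_real_derivative (q - 1) * z powr (q - 2)) (at z)"
      using has_real_derivative_powr[OF z0, of "q - 1"] by simp
    from DERIV_add[OF du'[OF z0] DERIV_cmult[OF this, of m]]
    have "((\<lambda>t. u' t + m * t powr (q - 1)) has_real_derivative z powr (q - 2) * (u T - u z)) (at z)"
      by (rule DERIV_cong) (use q in \<open>simp add: m_def algebra_simps diff_divide_distrib\<close>, simp add: field_simps)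
    moreover have "z powr (q - 2) * (u T - u z) \<le> 0" using u_mono[OF z(1)] by (simp add: mult_nonneg_nonpos)
    ultimately show "\<exists>w. ((\<lambda>t. u' t + m * t powr (q - 1)) has_real_derivative w) (at z) \<and> w \<le> 0" by blast
  qed
  \<comment> \<open>a value of \<open>t powr (q - 1)\<close> at which \<open>dec\<close> forces \<open>u\<close> to have a negative slope\<close>
  define C where "C = (u' T + m * T powr (q - 1)) / m + 1"
  have C: "C \<ge> T powr (q - 1)" using u'_nonneg[of T] m by (simp add: C_def field_simps)
  moreover have "T powr (q - 1) > 0" using T by simp
  ultimately have C0: "C > 0" by linarith
  define t where "t = C powr (1 / (q - 1))"
  have tq: "t powr (q - 1) = C" using q C0 by (simp add: t_def powr_powr)
  have "T \<le> t"
  proof (rule ccontr)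
    assume "\<not> T \<le> t"
    then have "t powr (q - 1) < T powr (q - 1)" using q by (intro powr_less_mono2) (auto simp: t_def)
    with C tq show False by simp
  qed
  from dec[OF this] u'_nonneg[OF this] have "m * C \<le> u' T + m * T powr (q - 1)" by (simp add: tq)
  moreover have "m * C = u' T + m * T powr (q - 1) + m"
    using m unfolding C_def distrib_left by simp
  ultimately show False using m by simp
qed

end

section \<open>Sums over the zeros of an entire function of small order\<close>

lemma divide_out_zero:
  fixes f :: "complex \<Rightarrow> complex"
  assumes "f holomorphic_on UNIV" "f a = 0" "a \<noteq> 0"
  obtains g where "g holomorphic_on UNIV" "\<And>z. f z = (1 - z / a) * g z"
proof -
  define h where "h = (\<lambda>z. if z = a then deriv f a else (f z - f a) / (z - a))"
  have "h holomorphic_on UNIV" unfolding h_def by (rule pole_lemma_open[OF assms(1)]) simp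
  then have "(\<lambda>z. - a * h z) holomorphic_on UNIV" by (intro holomorphic_intros)
  moreover have "f z = (1 - z / a) * (- a * h z)" for z
    using assms(2,3) by (auto simp: h_def field_simps)
  ultimately show ?thesis by (rule that)
qed

lemma divide_out_zeros:
  fixes f :: "complex \<Rightarrow> complex"
  assumes "finite Z" "f holomorphic_on UNIV" "\<And>a. a \<in> Z \<Longrightarrow> f a = 0" "0 \<notin> Z"
  shows "\<exists>g. g holomorphic_on UNIV \<and> (\<forall>z. f z = (\<Prod>a\<in>Z. 1 - z / a) * g z)"
  using assms
proof (induction Z)
  case empty then show ?case by auto
next
  case (insert a Z)
  then obtain g where g: "g holomorphic_on UNIV" "\<And>z. f z = (\<Prod>a\<in>Z. 1 - z / a) * g z" by auto
  have "(\<Prod>b\<in>Z. 1 - a / b) \<noteq> 0"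
    using insert by (auto simp: divide_eq_1_iff)
  moreover have "f a = 0" using insert.prems by simp
  ultimately have "g a = 0" using g(2)[of a] by simp
  moreover have "a \<noteq> 0" using insert.prems by auto
  ultimately obtain h where "h holomorphic_on UNIV" "\<And>z. g z = (1 - z / a) * h z"
    using divide_out_zero[OF g(1)] by metis
  then show ?case using g(2) insert.hyps by (intro exI[of _ h]) (auto simp: mult_ac)
qed

text \<open>The Borel--Caratheodory inequality for the first derivative: the Moebius map \<open>w
  / (2A - w)\<close> sends the half-plane \<open>Re w \<le> A\<close> into the unit disc, so the
  Schwarz lemma applies after rescaling.\<close>

lemma deriv_bound_of_Re_bound:
  fixes h :: "complex \<Rightarrow> complex"
  assumes h: "h holomorphic_on ball 0 r" and "h 0 = 0" "0 < r" "0 < A"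
    and le: "\<And>z. norm z < r \<Longrightarrow> Re (h z) \<le> A"
  shows "norm (deriv h 0) \<le> 2 * A / r"
proof -
  have ne: "2 * of_real A - h z \<noteq> 0" if "norm z < r" for z
  proof
    assume "2 * of_real A - h z = 0"
    then have "Re (h z) = 2 * A" by (simp add: complex_eq_iff)
    with le[OF that] \<open>0 < A\<close> show False by simp
  qed
  \<comment> \<open>the Moebius map, on the rescaled disc\<close>
  define k where "k z = h (of_real r * z) / (2 * of_real A - h (of_real r * z))" for z
  have rz: "norm (of_real r * z) < r" if "norm z < 1" for z :: complex
    using that \<open>0 < r\<close> by (simp add: norm_mult)
  have hol: "(\<lambda>z. h (of_real r * z)) holomorphic_on ball 0 1"
    by (rule holomorphic_on_compose_gen[unfolded o_def, OF _ h])
       (use rz in \<open>auto intro!: holomorphic_intros simp: dist_norm\<close>)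
  have holk: "k holomorphic_on ball 0 1"
    unfolding k_def using ne rz by (intro holomorphic_intros hol) (auto simp: dist_norm)
  have kle: "norm (k z) \<le> 1" if "norm z < 1" for z
  proof -
    let ?w = "h (of_real r * z)"
    have "(norm ?w)\<^sup>2 \<le> (norm (2 * of_real A - ?w))\<^sup>2"
      using le[OF rz[OF that]] \<open>0 < A\<close> mult_left_mono[of "Re ?w" A "4 * A"]
      by (simp add: cmod_power2) (simp add: power2_eq_square algebra_simps)
    then have "norm ?w \<le> norm (2 * of_real A - ?w)" by (rule power2_le_imp_le) simp
    then show ?thesis unfolding k_def using ne[OF rz[OF that]] by (simp add: norm_divide divide_le_eq_1)
  qed
  have k1: "norm (k z) < 1" if "norm z < 1" for z
  proof -
    have "norm (k z) \<noteq> 1"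
    proof
      assume one: "norm (k z) = 1"
      have "k constant_on ball 0 1"
        by (rule maximum_modulus_principle[OF holk, where U = "ball 0 1" and \<xi> = z])
           (use that kle one in auto)
      moreover have "k 0 = 0" by (simp add: k_def \<open>h 0 = 0\<close>)
      ultimately have "k z = 0" using that unfolding constant_on_def by (metis centre_in_ball dist_0_norm mem_ball zero_less_one)
      with one show False by simp
    qed
    with kle[OF that] show ?thesis by simp
  qed
  have "norm (deriv k 0) \<le> 1"
    by (rule Schwarz_Lemma(2)[OF holk _ k1, of 0]) (auto simp: k_def \<open>h 0 = 0\<close>)
  moreover have "deriv k 0 = of_real r * deriv h 0 / (2 * of_real A)"
  proof (rule DERIV_imp_deriv)
    have "(h has_field_derivative deriv h 0) (at (of_real r * (0::complex)))"
      using holomorphic_derivI[OF h, of 0] \<open>0 < r\<close> by simp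
    then have hd: "((\<lambda>z. h (of_real r * z)) has_field_derivative deriv h 0 * of_real r) (at 0)"
      by (rule DERIV_chain2[where g = "\<lambda>z. of_real r * z"]) (auto intro!: derivative_eq_intros)
    show "(k has_field_derivative of_real r * deriv h 0 / (2 * of_real A)) (at 0)"
      unfolding k_def using \<open>0 < A\<close>
      by (auto intro!: derivative_eq_intros hd simp: \<open>h 0 = 0\<close>)
  qed
  ultimately show ?thesis
    using \<open>0 < A\<close> \<open>0 < r\<close> by (simp add: norm_mult norm_divide field_simps)
qed

lemma has_field_derivative_linear_prod:
  assumes "finite Z" "0 \<notin> Z"
  shows "((\<lambda>z. \<Prod>a\<in>Z. 1 - z / a) has_field_derivative - (\<Sum>a\<in>Z. 1 / a)) (at (0::complex))"
  using assms
proof (induction Z)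
  case (insert a Z)
  have "((\<lambda>z. (1 - z / a) * (\<Prod>a\<in>Z. 1 - z / a)) has_field_derivative
      (1 - 0 / a) * (- (\<Sum>a\<in>Z. 1 / a)) + (- 1 / a) * (\<Prod>a\<in>Z. 1 - 0 / a)) (at 0)"
    using insert.prems by (intro DERIV_mult' insert.IH) (auto intro!: derivative_eq_intros)
  moreover have "(1 - 0 / a) * (- (\<Sum>a\<in>Z. 1 / a)) + (- 1 / a) * (\<Prod>a\<in>Z. 1 - 0 / a) = - (\<Sum>a\<in>insert a Z. 1 / a)"
    using insert.hyps by simp
  ultimately show ?case unfolding prod.insert[OF insert.hyps] by (simp only:)
qed simp

text \<open>The case of Hadamard's factorization that is needed, in quantitative form. Dividing
  \<open>f\<close> by the factors \<open>1 - z/a\<close> for the zeros of modulus at most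
  \<open>R\<close> leaves a function \<open>g\<close> without zeros in that disc, whose
  logarithmic derivative at 0 is the left-hand side. The factors have modulus at least 1 on the
  circle of radius \<open>2R\<close>, so \<open>g\<close> inherits the growth bound of
  \<open>f\<close>, and the logarithm of \<open>g\<close> has real part of order \<open>sqrt
  R\<close> only; the derivative bound above then gives order \<open>R^(-1/2)\<close>.\<close>

lemma sum_inverse_zeros_bound:
  fixes f :: "complex \<Rightarrow> complex"
  assumes hol: "f holomorphic_on UNIV" and f0: "f 0 = 1"
    and growth: "\<And>z. norm (f z) \<le> exp (C * sqrt (norm z))" and "0 < C"
    and simple: "\<And>z. f z = 0 \<Longrightarrow> deriv f z \<noteq> 0"
    and fin: "finite {z. f z = 0 \<and> norm z \<le> R}" and "0 < R"
  shows "norm (deriv f 0 + (\<Sum>a | f a = 0 \<and> norm a \<le> R. 1 / a)) \<le> 2 * C * sqrt (2 * R) / R"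
proof -
  let ?Z = "{z. f z = 0 \<and> norm z \<le> R}"
  define P where "P z = (\<Prod>a\<in>?Z. 1 - z / a)" for z
  have Z0: "0 \<notin> ?Z" using f0 by auto
  obtain g where g: "g holomorphic_on UNIV" "\<And>z. f z = P z * g z"
    using divide_out_zeros[OF fin hol _ Z0] unfolding P_def by auto
  have holP: "P holomorphic_on UNIV" unfolding P_def using Z0 by (intro holomorphic_intros) auto
  have dP: "(P has_field_derivative deriv P z) (at z)" "(g has_field_derivative deriv g z) (at z)" for z
    using holomorphic_derivI[OF holP open_UNIV] holomorphic_derivI[OF g(1) open_UNIV] by auto
  have df: "deriv f z = P z * deriv g z + deriv P z * g z" for z
  proof (rule DERIV_imp_deriv)
    have "f = (\<lambda>z. P z * g z)" using g(2) by auto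
    then show "(f has_field_derivative P z * deriv g z + deriv P z * g z) (at z)"
      by (simp only:) (intro DERIV_mult' dP)
  qed
  have gnz: "g z \<noteq> 0" if "norm z \<le> R" for z
  proof
    assume "g z = 0"
    then have "f z = 0" using g(2) by simp
    then have "P z = 0" using that fin unfolding P_def using Z0 by (auto simp: prod_zero_iff)
    with \<open>g z = 0\<close> have "deriv f z = 0" by (simp add: df)
    with simple[OF \<open>f z = 0\<close>] show False by simp
  qed
  let ?A = "C * sqrt (2 * R)"
  have gle: "norm (g z) \<le> exp ?A" if "norm z \<le> 2 * R" for z
  proof (rule maximum_modulus_frontier[where S = "cball 0 (2 * R)" and f = g and \<xi> = z])
    fix w :: complex assume "w \<in> frontier (cball 0 (2 * R))"
    then have w: "norm w = 2 * R" using \<open>0 < R\<close> by (simp add: frontier_cball)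
    have "1 \<le> norm (P w)"
      unfolding P_def prod_norm[symmetric]
    proof (rule prod_ge_1)
      fix a assume a: "a \<in> ?Z"
      then have "a \<noteq> 0" using Z0 by auto
      then have "2 \<le> norm (w / a)" using a w by (simp add: norm_divide field_simps)
      then show "1 \<le> norm (1 - w / a)" using norm_triangle_ineq2[of "w / a" 1] by (simp add: norm_minus_commute)
    qed
    then have "norm (g w) \<le> norm (P w) * norm (g w)" by (simp add: mult_le_cancel_right1)
    also have "\<dots> = norm (f w)" by (simp add: g(2) norm_mult)
    also have "\<dots> \<le> exp ?A" using growth[of w] w by simp
    finally show "norm (g w) \<le> exp ?A" .
  qed (use that g(1) in \<open>auto intro: holomorphic_on_imp_continuous_on holomorphic_on_subset\<close>)
  obtain h where h: "h holomorphic_on ball 0 R" "\<And>x. x \<in> ball 0 R \<Longrightarrow> exp (h x) = g x"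
    by (rule holomorphic_logarithm_exists[of "ball 0 R" g 0])
       (use gnz g(1) \<open>0 < R\<close> in \<open>auto intro: holomorphic_on_subset\<close>)
  have P0: "P 0 = 1" by (simp add: P_def)
  then have g0: "g 0 = 1" using g(2)[of 0] f0 by simp
  then have eh0: "exp (h 0) = 1" using h(2)[of 0] \<open>0 < R\<close> by simp
  have "norm (deriv (\<lambda>z. h z - h 0) 0) \<le> 2 * ?A / R"
  proof (rule deriv_bound_of_Re_bound)
    fix z :: complex assume z: "norm z < R"
    have "exp (Re (h z - h 0)) = norm (g z)"
      using h(2)[of z] z eh0 by (simp add: exp_diff flip: norm_exp_eq_Re)
    also have "\<dots> \<le> exp ?A" using z \<open>0 < R\<close> by (intro gle) auto
    finally show "Re (h z - h 0) \<le> ?A" by simp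
  qed (use h(1) \<open>0 < R\<close> \<open>0 < C\<close> in \<open>auto intro!: holomorphic_intros\<close>)
  moreover have hd: "(h has_field_derivative deriv h 0) (at 0)"
    using holomorphic_derivI[OF h(1) open_ball, of 0] \<open>0 < R\<close> by simp
  then have "deriv (\<lambda>z. h z - h 0) 0 = deriv h 0"
    by (intro DERIV_imp_deriv) (auto intro!: derivative_eq_intros)
  moreover have "deriv g 0 = deriv h 0"
  proof -
    have "((\<lambda>z. exp (h z)) has_field_derivative exp (h 0) * deriv h 0) (at 0)"
      by (rule DERIV_fun_exp[OF hd])
    then have "(g has_field_derivative exp (h 0) * deriv h 0) (at 0)"
      by (rule has_field_derivative_transform_within_open[of _ _ _ "ball 0 R"]) (use h(2) \<open>0 < R\<close> in auto)
    from DERIV_unique[OF this dP(2)] show ?thesis by (simp add: eh0)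
  qed
  moreover have "deriv f 0 = deriv g 0 - (\<Sum>a\<in>?Z. 1 / a)"
    using df[of 0] DERIV_imp_deriv[OF has_field_derivative_linear_prod[OF fin Z0]]
    by (simp add: P0 g0 P_def[abs_def])
  ultimately show ?thesis by (simp add: mult.assoc)
qed

section \<open>Bessel zeros and the sum of their inverse squares\<close>

text \<open>The counting function \<open>x \<mapsto> card {y \<in> B. y \<le> x}\<close> is
  strictly increasing on \<open>B\<close> and takes every positive value there, so the description
  of the \<open>k\<close>-th element by its count is a legitimate definition.\<close>

lemma locally_finite_enumeration:
  fixes B :: "real set"
  assumes fin: "\<And>x. finite {y \<in> B. y \<le> x}" and inf: "infinite B"
  defines "z \<equiv> \<lambda>k. THE x. x \<in> B \<and> card {y \<in> B. y \<le> x} = k"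
  shows "bij_betw z {1..} B" "\<And>i j. 1 \<le> i \<Longrightarrow> i < j \<Longrightarrow> z i < z j"
    "\<And>n. 1 \<le> n \<Longrightarrow> {y \<in> B. y \<le> z n} = z ` {1..n}"
proof -
  define N where "N x = card {y \<in> B. y \<le> x}" for x
  have mono: "N x < N y" if "x \<in> B" "y \<in> B" "x < y" for x y
  proof -
    have "y \<in> {z \<in> B. z \<le> y}" "y \<notin> {z \<in> B. z \<le> x}" "{z \<in> B. z \<le> x} \<subseteq> {z \<in> B. z \<le> y}"
      using that by auto
    then show ?thesis unfolding N_def by (intro psubset_card_mono[OF fin]) blast
  qed
  have inj: "inj_on N B"
    by (rule inj_onI) (metis mono less_irrefl linorder_neqE)
  have Npos: "1 \<le> N x" if "x \<in> B" for x
  proof -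
    have "card {x} \<le> N x" unfolding N_def by (rule card_mono[OF fin]) (use that in auto)
    then show ?thesis by simp
  qed
  have surj: "\<exists>x\<in>B. N x = k" if k: "1 \<le> k" for k
  proof -
    obtain A where A: "A \<subseteq> B" "finite A" "card A = k"
      using infinite_arbitrarily_large[OF inf] by blast
    then have "A \<noteq> {}" using k by auto
    define C where "C = {y \<in> B. y \<le> Max A}"
    have "finite C" unfolding C_def by (rule fin)
    have "A \<subseteq> C" using A by (auto simp: C_def)
    then have kC: "k \<le> card C" using card_mono[OF \<open>finite C\<close>] A by blast
    have le: "N x \<le> card C" if "x \<in> C" for x
      unfolding N_def by (rule card_mono[OF \<open>finite C\<close>]) (use that in \<open>auto simp: C_def\<close>)
    have "N ` C \<subseteq> {1..card C}" using le Npos by (auto simp: C_def)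
    moreover have "card (N ` C) = card C" 
      by (rule card_image[OF inj_on_subset[OF inj]]) (auto simp: C_def)
    ultimately have "N ` C = {1..card C}" by (intro card_subset_eq) auto
    then have "k \<in> N ` C" using kC k by auto
    then show ?thesis by (auto simp: C_def)
  qed
  have z: "z k \<in> B \<and> N (z k) = k" if k: "1 \<le> k" for k
    unfolding z_def N_def[symmetric]
  proof (rule theI')
    show "\<exists>!x. x \<in> B \<and> N x = k" using surj[OF k] inj by (auto simp: inj_on_def)
  qed
  have zN: "z (N x) = x" if "x \<in> B" for x
    using z[OF Npos[OF that]] inj that by (auto simp: inj_on_def)
  show "bij_betw z {1..} B"
    by (rule bij_betw_byWitness[where f' = N]) (use z zN Npos in auto)
  show less: "z i < z j" if "1 \<le> i" "i < j" for i j
    using z[of i] z[of j] that mono[of "z j" "z i"] by (metis le_trans less_imp_le less_asym linorder_neqE)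
  show "{y \<in> B. y \<le> z n} = z ` {1..n}" if n: "1 \<le> n" for n
  proof (intro set_eqI iffI)
    fix y assume y: "y \<in> {y \<in> B. y \<le> z n}"
    have "N y \<le> n"
      using z[OF n] y mono[of y "z n"] by (cases "y = z n") auto
    then show "y \<in> z ` {1..n}" using zN[of y] Npos[of y] y by (intro image_eqI[of _ _ "N y"]) auto
  next
    fix y assume "y \<in> z ` {1..n}"
    then obtain i where i: "1 \<le> i" "i \<le> n" "y = z i" by auto
    then show "y \<in> {y \<in> B. y \<le> z n}" using z[of i] less[of i n] by (cases "i = n") auto
  qed
qed

lemma Gamma_plus1_pos: "0 < x \<Longrightarrow> Gamma (x + 1) = x * Gamma (x :: real)"
  by (rule Gamma_plus1) (auto elim!: nonpos_Ints_cases)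

text \<open>These are the zeros of \<^const>\<open>Phi\<close> in increasing order, and the
  reciprocals of the eigenvalues.\<close>

definition inv_eig :: "real \<Rightarrow> nat \<Rightarrow> real" where
  "inv_eig q k = (q * bessel_zero (1 / q) k / 2)\<^sup>2"

context
  fixes q :: real
  assumes q: "1 < q"
begin

text \<open>Compares the coefficients of the Bessel series of index \<open>1/q\<close> with those
  of \<^const>\<open>Phi\<close>: both sides satisfy the same recursion in
  \<open>k\<close>.\<close>

lemma Gamma_ratio:
  "1 / (Gamma (1 / q + real k + 1) * Gamma (real k + 1)) = (q\<^sup>2) ^ k * bcoeff q k / Gamma (1 / q + 1)"
proof (induction k)
  case (Suc k)
  have p: "0 < 1 / q + real k + 1" "0 < real k + 1" using q by (simp_all add: add_pos_nonneg)
  have G: "Gamma (1 / q + real (Suc k) + 1) = (1 / q + real k + 1) * Gamma (1 / q + real k + 1)"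
    using Gamma_plus1_pos[OF p(1)] by (simp add: add_ac)
  have G2: "Gamma (real (Suc k) + 1) = (real k + 1) * Gamma (real k + 1)"
    using Gamma_plus1_pos[OF p(2)] by (simp add: add_ac)
  have "1 / (Gamma (1 / q + real (Suc k) + 1) * Gamma (real (Suc k) + 1))
      = 1 / (Gamma (1 / q + real k + 1) * Gamma (real k + 1)) / ((1 / q + real k + 1) * (real k + 1))"
    unfolding G G2 by (simp add: mult_ac)
  also have "\<dots> = (q\<^sup>2) ^ k * bcoeff q k / Gamma (1 / q + 1) / ((1 / q + real k + 1) * (real k + 1))"
    unfolding Suc ..
  also have "\<dots> = (q\<^sup>2) ^ k * (bcoeff q k / ((1 / q + real k + 1) * (real k + 1))) / Gamma (1 / q + 1)"
    by simp
  also have "bcoeff q k / ((1 / q + real k + 1) * (real k + 1)) = q\<^sup>2 * bcoeff q (Suc k)"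
  proof -
    have "real (Suc k) * q * (real (Suc k) * q + 1) = q\<^sup>2 * ((1 / q + real k + 1) * (real k + 1))"
      using q by (simp add: field_simps power2_eq_square)
    then show ?thesis unfolding bcoeff_Suc using q by simp
  qed
  also have "(q\<^sup>2) ^ k * (q\<^sup>2 * bcoeff q (Suc k)) / Gamma (1 / q + 1) = (q\<^sup>2) ^ Suc k * bcoeff q (Suc k) / Gamma (1 / q + 1)"
    by simp
  finally show ?case .
qed simp

lemma Gamma_ratio':
  "1 / (Gamma (1 / q + real k) * Gamma (real k + 1)) = (q\<^sup>2) ^ k * ((1 + real k * q) * bcoeff q k) / Gamma (1 / q)"
proof -
  have p: "0 < 1 / q + real k" "0 < 1 / q" using q by (simp_all add: add_pos_nonneg)
  have G: "Gamma (1 / q + real k + 1) = (1 / q + real k) * Gamma (1 / q + real k)"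
    by (rule Gamma_plus1_pos[OF p(1)])
  have G2: "Gamma (1 / q + 1) = 1 / q * Gamma (1 / q)"
    by (rule Gamma_plus1_pos[OF p(2)])
  have e: "1 / q + real k = (1 + real k * q) / q" using q by (simp add: field_simps)
  have "1 / (Gamma (1 / q + real k) * Gamma (real k + 1)) = (1 / q + real k) * (1 / (Gamma (1 / q + real k + 1) * Gamma (real k + 1)))"
    unfolding G using p by simp
  also have "\<dots> = (1 + real k * q) / q * ((q\<^sup>2) ^ k * bcoeff q k / (1 / q * Gamma (1 / q)))"
    unfolding Gamma_ratio G2 unfolding e ..
  also have "\<dots> = (q\<^sup>2) ^ k * ((1 + real k * q) * bcoeff q k) / Gamma (1 / q)"
    using q by simp
  finally show ?thesis .
qed

lemma bessel_J_eq_Phi: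
  "bessel_J (1 / q) x = (x / 2) powr (1 / q) / Gamma (1 / q + 1) * Phi q ((q * x / 2)\<^sup>2)"
proof -
  have "(- (x\<^sup>2 / 4)) ^ k / (Gamma (1 / q + real k + 1) * Gamma (real k + 1)) =
      1 / Gamma (1 / q + 1) * (of_real ((-1) ^ k * bcoeff q k) * ((q * x / 2)\<^sup>2) ^ k)" for k
  proof -
    have "(- (x\<^sup>2 / 4)) ^ k / (Gamma (1 / q + real k + 1) * Gamma (real k + 1)) =
        (- (x\<^sup>2 / 4)) ^ k * (1 / (Gamma (1 / q + real k + 1) * Gamma (real k + 1)))" by simp
    also have "\<dots> = 1 / Gamma (1 / q + 1) * (((-1) ^ k * bcoeff q k) * ((x\<^sup>2 / 4) ^ k * (q\<^sup>2) ^ k))"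
      unfolding Gamma_ratio power_minus[of "x\<^sup>2 / 4"] by simp
    also have "(x\<^sup>2 / 4) ^ k * (q\<^sup>2) ^ k = ((q * x / 2)\<^sup>2) ^ k"
      unfolding power_mult_distrib[symmetric] by (simp add: power2_eq_square mult_ac)
    finally show ?thesis by simp
  qed
  then show ?thesis
    unfolding bessel_J_def Phi_def by (simp only: suminf_mult[OF summable_Phi[OF q]]) simp
qed

lemma bessel_J_eq_Psi:
  "bessel_J (1 / q - 1) x = (x / 2) powr (1 / q - 1) / Gamma (1 / q) * Psi q ((q * x / 2)\<^sup>2)"
proof -
  have "(- (x\<^sup>2 / 4)) ^ k / (Gamma (1 / q - 1 + real k + 1) * Gamma (real k + 1)) =
      1 / Gamma (1 / q) * (of_real ((-1) ^ k * (1 + real k * q) * bcoeff q k) * ((q * x / 2)\<^sup>2) ^ k)" for k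
  proof -
    have "(- (x\<^sup>2 / 4)) ^ k / (Gamma (1 / q - 1 + real k + 1) * Gamma (real k + 1)) =
        (- (x\<^sup>2 / 4)) ^ k * (1 / (Gamma (1 / q + real k) * Gamma (real k + 1)))" by simp
    also have "\<dots> = 1 / Gamma (1 / q) * (((-1) ^ k * ((1 + real k * q) * bcoeff q k)) * ((x\<^sup>2 / 4) ^ k * (q\<^sup>2) ^ k))"
      unfolding Gamma_ratio' power_minus[of "x\<^sup>2 / 4"] by simp
    also have "(x\<^sup>2 / 4) ^ k * (q\<^sup>2) ^ k = ((q * x / 2)\<^sup>2) ^ k"
      unfolding power_mult_distrib[symmetric] by (simp add: power2_eq_square mult_ac)
    finally show ?thesis by (simp add: mult_ac)
  qed
  then show ?thesis
    unfolding bessel_J_def Psi_def by (simp only: suminf_mult[OF summable_Psi[OF q]]) simp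
qed

lemma bessel_J_zero_iff: "0 < x \<Longrightarrow> bessel_J (1 / q) x = 0 \<longleftrightarrow> Phi q ((q * x / 2)\<^sup>2) = 0"
proof -
  have "Gamma (1 / q + 1) > 0" using q by (intro Gamma_real_pos) (simp add: add_pos_pos)
  moreover assume "0 < x"
  ultimately show ?thesis unfolding bessel_J_eq_Phi by auto
qed

text \<open>The zeros of \<open>J\<^sub>\<nu>\<close> and of \<^const>\<open>Phi\<close>
  correspond under the increasing map \<open>x \<mapsto> (q x / 2)\<^sup>2\<close>. They are
  locally finite because \<^const>\<open>Phi\<close> is entire, and there are infinitely many; so
  the enumeration lemma applies.\<close>

lemma
  shows bessel_zero_pos: "\<And>k. 1 \<le> k \<Longrightarrow> 0 < bessel_zero (1 / q) k"
    and inv_eig_pos: "\<And>k. 1 \<le> k \<Longrightarrow> 0 < inv_eig q k"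
    and Phi_inv_eig: "\<And>k. 1 \<le> k \<Longrightarrow> Phi q (inv_eig q k) = 0"
    and inv_eig_mono: "\<And>i j. 1 \<le> i \<Longrightarrow> i < j \<Longrightarrow> inv_eig q i < inv_eig q j"
    and Phi_zero_imp_inv_eig: "\<And>c. Phi q c = 0 \<Longrightarrow> \<exists>k\<ge>1. c = inv_eig q k"
    and inv_eig_image: "\<And>n. 1 \<le> n \<Longrightarrow> {c. Phi q c = 0 \<and> c \<le> inv_eig q n} = inv_eig q ` {1..n}"
proof -
  define B where "B = {x. 0 < x \<and> bessel_J (1 / q) x = 0}"
  define s where "s x = (q * x / 2)\<^sup>2" for x
  have s_less: "s x < s y \<longleftrightarrow> x < y" if "0 < x" "0 < y" for x y
    unfolding s_def not_le[symmetric] using q that by (subst power_mono_iff) auto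
  have B_iff: "x \<in> B \<longleftrightarrow> 0 < x \<and> Phi q (s x) = 0" for x
    unfolding B_def s_def using bessel_J_zero_iff by auto
  have inB: "\<exists>x\<in>B. c = s x" if "Phi q c = 0" for c
  proof -
    have "0 < c" using Phi_nonpos_pos[OF q, of c] that by force
    then have "c = s (2 * sqrt c / q)" "0 < 2 * sqrt c / q" using q by (auto simp: s_def)
    with that show ?thesis using B_iff by (intro bexI[of _ "2 * sqrt c / q"]) auto
  qed
  have s_inj: "inj_on s B" 
    by (rule inj_onI) (metis B_iff s_less less_irrefl linorder_neqE)
  have fin: "finite {y \<in> B. y \<le> x}" for x
  proof -
    have "(\<lambda>x. complex_of_real (s x)) ` {y \<in> B. y \<le> x} \<subseteq> {c :: complex. Phi q c = 0 \<and> norm c \<le> s x}"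
    proof clarify
      fix y assume y: "y \<in> B" "y \<le> x"
      then have "s y \<le> s x" using s_less[of y x] B_iff by (cases "y = x") auto
      moreover have "0 \<le> s y" by (simp add: s_def)
      ultimately show "Phi q (complex_of_real (s y)) = 0 \<and> norm (complex_of_real (s y)) \<le> s x"
        using y B_iff[of y] by (simp add: Phi_of_real[OF q])
    qed
    then have "finite ((\<lambda>x. complex_of_real (s x)) ` {y \<in> B. y \<le> x})"
      by (rule finite_subset) (rule finite_Phi_zeros[OF q])
    then show ?thesis
      by (rule finite_imageD) (use s_inj in \<open>auto simp: inj_on_def\<close>)
  qed
  have inf: "infinite B"
  proof
    assume "finite B"
    then have "finite (s ` B)" by simp
    obtain c where c: "c > Max (insert 0 (s ` B))" "Phi q c = 0" using infinite_Phi_zeros[OF q] by blast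
    then obtain x where "x \<in> B" "c = s x" using inB by blast
    with c \<open>finite (s ` B)\<close> show False by auto
  qed
  have bz': "bessel_zero (1 / q) k = (THE x. x \<in> B \<and> card {y \<in> B. y \<le> x} = k)" for k
  proof -
    have "{y. 0 < y \<and> y \<le> x \<and> bessel_J (1 / q) y = 0} = {y \<in> B. y \<le> x}" for x by (auto simp: B_def)
    then show ?thesis
      unfolding bessel_zero_def by (simp add: B_def conj_ac)
  qed
  have bz: "bessel_zero (1 / q) = (\<lambda>k. THE x. x \<in> B \<and> card {y \<in> B. y \<le> x} = k)"
    using bz' by (rule ext)
  note E = locally_finite_enumeration[OF fin inf, folded bz bz']
  have zB: "bessel_zero (1 / q) k \<in> B" if "1 \<le> k" for k
    using E(1) that unfolding bij_betw_def by auto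
  have inv_eig_s: "inv_eig q k = s (bessel_zero (1 / q) k)" for k by (simp add: inv_eig_def s_def)
  show zp: "0 < bessel_zero (1 / q) k" if "1 \<le> k" for k using zB[OF that] B_iff by blast
  show "0 < inv_eig q k" if "1 \<le> k" for k unfolding inv_eig_def using zp[OF that] q by simp
  show Pcz: "Phi q (inv_eig q k) = 0" if "1 \<le> k" for k using zB[OF that] B_iff unfolding inv_eig_s by blast
  show "inv_eig q i < inv_eig q j" if "1 \<le> i" "i < j" for i j
    unfolding inv_eig_s using that E(2)[OF that] zp[of i] zp[of j] by (subst s_less) auto
  show ex: "\<exists>k\<ge>1. c = inv_eig q k" if "Phi q c = 0" for c
  proof -
    obtain x where "x \<in> B" "c = s x" using inB[OF \<open>Phi q c = 0\<close>] by blast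
    then have "x \<in> bessel_zero (1 / q) ` {1..}" using E(1) unfolding bij_betw_def by blast
    then show ?thesis using \<open>c = s x\<close> inv_eig_s by auto
  qed
  show "{c. Phi q c = 0 \<and> c \<le> inv_eig q n} = inv_eig q ` {1..n}" if n: "1 \<le> n" for n
  proof (intro set_eqI iffI)
    fix c assume c: "c \<in> {c. Phi q c = 0 \<and> c \<le> inv_eig q n}"
    then obtain x where x: "x \<in> B" "c = s x" using inB by blast
    then have "x \<le> bessel_zero (1 / q) n"
      using c s_less[of "bessel_zero (1 / q) n" x, OF zp[OF n]] B_iff[of x] by (auto simp: inv_eig_s not_le[symmetric])
    then have "x \<in> bessel_zero (1 / q) ` {1..n}" using E(3)[OF n] x by blast
    then show "c \<in> inv_eig q ` {1..n}" using x inv_eig_s by auto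
  next
    fix c assume "c \<in> inv_eig q ` {1..n}"
    then obtain i where i: "1 \<le> i" "i \<le> n" "c = inv_eig q i" by auto
    have "bessel_zero (1 / q) i \<in> {y \<in> B. y \<le> bessel_zero (1 / q) n}" using E(3)[OF n] i by auto
    then have "inv_eig q i \<le> inv_eig q n"
      using s_less[OF zp[OF n] zp[OF i(1)]] unfolding inv_eig_s by (auto simp: not_le[symmetric])
    then show "c \<in> {c. Phi q c = 0 \<and> c \<le> inv_eig q n}" using i Pcz[OF i(1)] by auto
  qed
qed

lemma inv_eig_tendsto: "filterlim (inv_eig q) at_top sequentially"
  unfolding filterlim_at_top
proof
  fix X :: real
  obtain c where "c > X" "Phi q c = 0" using infinite_Phi_zeros[OF q] by blast
  then obtain k where k: "k \<ge> 1" "inv_eig q k > X" using Phi_zero_imp_inv_eig by blast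
  show "\<forall>\<^sub>F n in sequentially. X \<le> inv_eig q n"
    using eventually_ge_at_top[of k]
  proof eventually_elim
    case (elim n)
    then show ?case using k inv_eig_mono[of k n] by (cases "n = k") auto
  qed
qed

text \<open>The bound on sums over zeros, taken with the radius \<open>R\<close> equal to the
  \<open>n\<close>-th zero, so that the zeros inside are exactly the first \<open>n\<close>. The
  limit is minus the derivative of \<^const>\<open>Phi\<close> at 0.\<close>

lemma sum_inverse_inv_eig: "(\<lambda>n. \<Sum>k=1..n. 1 / inv_eig q k) \<longlonglongrightarrow> bcoeff q 1"
proof -
  have bound: "\<bar>(\<Sum>k=1..n. 1 / inv_eig q k) - bcoeff q 1\<bar> \<le> 4 * sqrt 2 / sqrt (inv_eig q n)" if n: "1 \<le> n" for n
  proof -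
    let ?R = "inv_eig q n" and ?Z = "{a :: complex. Phi q a = 0 \<and> norm a \<le> inv_eig q n}"
    have R: "0 < ?R" by (rule inv_eig_pos[OF n])
    have Z: "?Z = complex_of_real ` inv_eig q ` {1..n}"
      unfolding inv_eig_image[OF n, symmetric]
    proof (intro set_eqI iffI)
      fix a assume a: "a \<in> ?Z"
      then obtain x where "0 < x" "a = of_real x" "Phi q x = 0" using Phi_complex_zero[OF q, of a] by blast
      then show "a \<in> complex_of_real ` {c. Phi q c = 0 \<and> c \<le> inv_eig q n}" using a by auto
    next
      fix a assume "a \<in> complex_of_real ` {c. Phi q c = 0 \<and> c \<le> inv_eig q n}"
      then obtain x where x: "a = of_real x" "Phi q x = 0" "x \<le> inv_eig q n" by auto
      then have "0 < x" using Phi_nonpos_pos[OF q, of x] by force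
      then show "a \<in> ?Z" using x by (simp add: Phi_of_real[OF q])
    qed
    have inj: "inj_on (inv_eig q) {1..n}"
      
    proof (rule inj_onI)
      fix i j assume "i \<in> {1..n}" "j \<in> {1..n}" "inv_eig q i = inv_eig q j"
      then show "i = j" using inv_eig_mono[of i j] inv_eig_mono[of j i] by (cases i j rule: linorder_cases) auto
    qed
    have "(\<Sum>a\<in>?Z. 1 / a) = complex_of_real (\<Sum>k=1..n. 1 / inv_eig q k)"
    proof -
      have "inj_on (\<lambda>k. complex_of_real (inv_eig q k)) {1..n}"
        by (rule inj_onI) (rule inj_onD[OF inj], simp_all)
      from sum.reindex[OF this, of "\<lambda>a. 1 / a"] show ?thesis
        unfolding Z image_image by (simp only: o_def of_real_sum of_real_divide of_real_1)
    qed
    moreover have "deriv (Phi q) (0::complex) = - of_real (bcoeff q 1)"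
      by (rule DERIV_imp_deriv[OF Phi_deriv_0[OF q]])
    moreover have "norm (deriv (Phi q) 0 + (\<Sum>a\<in>?Z. 1 / a)) \<le> 2 * 2 * sqrt (2 * ?R) / ?R"
    proof (rule sum_inverse_zeros_bound)
      fix z :: complex assume z: "Phi q z = 0"
      obtain D where "(Phi q has_field_derivative D) (at z)" using Phi_has_derivative[OF q] by blast
      with Phi_complex_simple_zero[OF q z this] show "deriv (Phi q) z \<noteq> 0" by (simp add: DERIV_imp_deriv)
    qed (rule holomorphic_Phi[OF q] Phi_0[OF q] norm_Phi_le[OF q] finite_Phi_zeros[OF q] R zero_less_numeral)+
    ultimately have "norm (of_real (- bcoeff q 1 + (\<Sum>k=1..n. 1 / inv_eig q k)) :: complex) \<le> 2 * 2 * sqrt (2 * ?R) / ?R"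
      by simp
    then have "\<bar>- bcoeff q 1 + (\<Sum>k=1..n. 1 / inv_eig q k)\<bar> \<le> 2 * 2 * sqrt (2 * ?R) / ?R"
      unfolding norm_of_real .
    also have "\<dots> = 4 * sqrt 2 / sqrt ?R"
      using R by (simp add: real_sqrt_mult field_simps)
    finally show ?thesis by (simp add: add.commute)
  qed
  have "(\<lambda>n. 4 * sqrt 2 / sqrt (inv_eig q n)) \<longlonglongrightarrow> 0"
    by (intro real_tendsto_divide_at_top[OF tendsto_const] filterlim_compose[OF sqrt_at_top inv_eig_tendsto])
  then have "(\<lambda>n. (\<Sum>k=1..n. 1 / inv_eig q k) - bcoeff q 1) \<longlonglongrightarrow> 0"
    by (rule Lim_null_comparison[rotated]) (use bound in \<open>auto intro: eventually_sequentiallyI[of 1]\<close>)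
  then show ?thesis by (simp add: LIM_zero_iff)
qed

end

section \<open>The Fredholm operator and its eigenspaces\<close>

lemma I01_continuous:
  fixes f :: "real \<Rightarrow> real"
  assumes "continuous_on {0..1} f"
  shows "integrable I01 f" "(f has_integral (LINT x|I01. f x)) {0..1}"
proof -
  have s: "set_integrable lborel {0..1} f" by (rule borel_integrable_atLeastAtMost'[OF assms])
  then show "integrable I01 f"
    unfolding set_integrable_def by (subst integrable_restrict_space) auto
  have "(LINT x|I01. f x) = (LINT x:{0..1}|lborel. f x)"
    unfolding set_lebesgue_integral_def by (subst integral_restrict_space) auto
  with set_borel_integral_eq_integral[OF s] show "(f has_integral (LINT x|I01. f x)) {0..1}"
    by (simp add: has_integral_integral)
qed

lemma I01_integral_eq:
  fixes f :: "real \<Rightarrow> real"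
  assumes "continuous_on {0..1} f" "(f has_integral y) {0..1}"
  shows "(LINT x|I01. f x) = y"
  using I01_continuous(2)[OF assms(1)] assms(2) by (rule has_integral_unique)

lemma I01_measurable: "continuous_on {0..1} f \<Longrightarrow> f \<in> borel_measurable I01" for f :: "real \<Rightarrow> real"
  using I01_continuous(1) by blast

lemma space_I01 [simp]: "space I01 = {0..1}" by (simp add: space_restrict_space)

lemma prob_space_I01: "prob_space I01"
  by (rule prob_spaceI) (simp add: emeasure_restrict_space)

lemma has_integral_interior:
  fixes f :: "real \<Rightarrow> real"
  assumes "a \<le> b" "continuous_on {a..b} F" "\<And>x. a < x \<Longrightarrow> x < b \<Longrightarrow> (F has_real_derivative f x) (at x)"
  shows "(f has_integral (F b - F a)) {a..b}"
  by (rule fundamental_theorem_of_calculus_interior[OF assms(1,2)])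
     (use assms(3) in \<open>auto simp: has_real_derivative_iff_has_vector_derivative\<close>)

lemma DERIV_zero_const_01:
  fixes f :: "real \<Rightarrow> real"
  assumes "continuous_on {0..1} f" "\<And>x. 0 < x \<Longrightarrow> x < 1 \<Longrightarrow> (f has_real_derivative 0) (at x)" "t \<in> {0..1}"
  shows "f t = f 1"
proof -
  have "(( \<lambda>_. 0) has_integral (f 1 - f t)) {t..1}"
    by (rule has_integral_interior) (use assms in \<open>auto intro: continuous_on_subset\<close>)
  then have "f 1 - f t = 0" by (rule has_integral_unique) simp
  then show ?thesis by simp
qed

text \<open>The covariance of the process, evaluated. It is the sum of a constant, of functions of
  one variable each, and of a function of \<open>max s t\<close>.\<close>

definition Kq :: "real \<Rightarrow> real \<Rightarrow> real \<Rightarrow> real" where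
  "Kq q s t = 1 / (q + 1) - 2 / q + 1 / (q - 1) + (s powr q + t powr q) / q - max s t powr (q - 1) / (q - 1)"

lemma Kq_commute: "Kq q s t = Kq q t s"
  by (simp add: Kq_def max.commute add.commute)

lemma continuous_on_powr_01:
  "0 < a \<Longrightarrow> A \<subseteq> {0..} \<Longrightarrow> continuous_on A (\<lambda>t. t powr a :: real)"
  by (intro continuous_on_powr' continuous_intros) auto

lemma L2_imp_integrable: "h \<in> L2 \<Longrightarrow> integrable I01 h"
proof -
  assume h: "h \<in> L2"
  interpret prob_space I01 by (rule prob_space_I01)
  show ?thesis by (rule square_integrable_imp_integrable) (use h in \<open>simp_all add: L2_def\<close>)
qed

context
  fixes q :: real
  assumes q: "1 < q"
begin

lemma continuous_on_Kq: "continuous_on ({0..1} \<times> {0..1}) (\<lambda>(s, t). Kq q s t)"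
proof -
  let ?S = "{0..1} \<times> {0..1} :: (real \<times> real) set"
  have p: "continuous_on ?S (\<lambda>x. g x powr a)" if "continuous_on ?S g" "g ` ?S \<subseteq> {0..}" "0 < a" for g :: "real \<times> real \<Rightarrow> real" and a
    by (rule continuous_on_compose2[OF continuous_on_powr_01[OF that(3) subset_refl] that(1,2)])
  note fs = continuous_on_fst[OF continuous_on_id[of ?S]] continuous_on_snd[OF continuous_on_id[of ?S]]
  have m: "continuous_on ?S (\<lambda>x. max (fst x) (snd x))"
    by (rule continuous_on_max[OF fs])
  have "0 < q" "0 < q - 1" using q by simp_all
  then have "continuous_on ?S (\<lambda>x. fst x powr q)"
    by (intro p[OF fs(1)]) auto
  moreover have "continuous_on ?S (\<lambda>x. snd x powr q)"
    using \<open>0 < q\<close> by (intro p[OF fs(2)]) auto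
  moreover have "continuous_on ?S (\<lambda>x. max (fst x) (snd x) powr (q - 1))"
    using \<open>0 < q - 1\<close> by (intro p[OF m]) (auto simp: max_def)
  ultimately show ?thesis
    unfolding Kq_def case_prod_beta using q
    by (intro continuous_on_add continuous_on_diff continuous_on_divide continuous_on_const) auto
qed

lemma continuous_on_Kq1: "t \<in> {0..1} \<Longrightarrow> continuous_on {0..1} (\<lambda>s. Kq q s t)"
  by (rule continuous_on_compose2[OF continuous_on_Kq, where f = "\<lambda>s. (s, t)", simplified]) (auto intro!: continuous_intros)

lemma continuous_on_Kq2: "s \<in> {0..1} \<Longrightarrow> continuous_on {0..1} (Kq q s)"
  using continuous_on_Kq1[of s] by (subst Kq_commute[abs_def]) simp

lemma Kq_bounded: obtains B where "\<And>s t. s \<in> {0..1} \<Longrightarrow> t \<in> {0..1} \<Longrightarrow> \<bar>Kq q s t\<bar> \<le> B"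
proof -
  have "compact ((\<lambda>(s, t). Kq q s t) ` ({0..1} \<times> {0..1}))"
    by (rule compact_continuous_image[OF continuous_on_Kq compact_Times[OF compact_Icc compact_Icc]])
  from compact_imp_bounded[OF this]
  obtain B where B: "\<forall>x\<in>(\<lambda>(s, t). Kq q s t) ` ({0..1} \<times> {0..1}). norm x \<le> B"
    unfolding bounded_iff by (elim exE)
  have "\<bar>Kq q s t\<bar> \<le> B" if "s \<in> {0..1}" "t \<in> {0..1}" for s t
  proof -
    have "(\<lambda>(s, t). Kq q s t) (s, t) \<in> (\<lambda>(s, t). Kq q s t) ` ({0..1} \<times> {0..1})"
      by (rule imageI) (use that in simp)
    from bspec[OF B this] show ?thesis by simp
  qed
  then show ?thesis by (rule that)
qed

lemma fredholm_Kq_continuous: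
  fixes h :: "real \<Rightarrow> real"
  assumes h: "integrable I01 h"
  shows "continuous_on {0..1} (fredholm (Kq q) h)"
  unfolding continuous_on_sequentially
proof (intro ballI allI impI)
  fix u :: "nat \<Rightarrow> real" and t assume t: "t \<in> {0..1}" and u: "(\<forall>n. u n \<in> {0..1}) \<and> u \<longlonglongrightarrow> t"
  obtain B where B: "\<And>s t. s \<in> {0..1} \<Longrightarrow> t \<in> {0..1} \<Longrightarrow> \<bar>Kq q s t\<bar> \<le> B" using Kq_bounded by blast
  have hm: "h \<in> borel_measurable I01" using h by (rule borel_measurable_integrable)
  show "(fredholm (Kq q) h \<circ> u) \<longlonglongrightarrow> fredholm (Kq q) h t"
    unfolding o_def fredholm_def
  proof (rule integral_dominated_convergence[where w = "\<lambda>s. B * \<bar>h s\<bar>"])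
    show "integrable I01 (\<lambda>s. B * \<bar>h s\<bar>)" using h by auto
    show "AE s in I01. (\<lambda>n. Kq q s (u n) * h s) \<longlonglongrightarrow> Kq q s t * h s"
    proof (rule AE_I2)
      fix s assume "s \<in> space I01"
      then have s: "s \<in> {0..1}" by simp
      have "(\<lambda>n. Kq q s (u n)) \<longlonglongrightarrow> Kq q s t"
        using continuous_on_Kq2[OF s] t u unfolding continuous_on_sequentially by (auto simp: o_def)
      then show "(\<lambda>n. Kq q s (u n) * h s) \<longlonglongrightarrow> Kq q s t * h s" by (intro tendsto_intros)
    qed
    show "AE s in I01. norm (Kq q s (u n) * h s) \<le> B * \<bar>h s\<bar>" for n
      by (rule AE_I2) (use B u in \<open>auto simp: abs_mult intro!: mult_right_mono\<close>)
    show "(\<lambda>s. Kq q s t * h s) \<in> borel_measurable I01"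
      by (intro borel_measurable_times I01_measurable continuous_on_Kq1 t hm)
    show "(\<lambda>s. Kq q s (u n) * h s) \<in> borel_measurable I01" for n
      by (intro borel_measurable_times I01_measurable continuous_on_Kq1 hm) (use u in auto)
  qed
qed

lemma fredholm_Kq_has_integral:
  assumes h: "continuous_on {0..1} h" and t: "t \<in> {0..1}"
  shows "((\<lambda>s. Kq q s t * h s) has_integral fredholm (Kq q) h t) {0..1}"
  unfolding fredholm_def using t by (intro I01_continuous(2) continuous_intros h continuous_on_Kq1)

text \<open>Splitting the integral at \<open>s = t\<close> isolates the dependence on
  \<open>t\<close> in integrals up to \<open>t\<close>, which can be differentiated.\<close>

lemma fredholm_Kq_formula:
  fixes h :: "real \<Rightarrow> real"
  assumes h: "continuous_on {0..1} h" and t: "t \<in> {0..1}"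
  defines "H \<equiv> \<lambda>t. integral {0..t} h" and "G \<equiv> \<lambda>t. integral {0..t} (\<lambda>s. s powr (q - 1) * h s)"
    and "C \<equiv> \<lambda>t. integral {0..t} (\<lambda>s. s powr q * h s)"
  shows "fredholm (Kq q) h t = (1 / (q + 1) - 2 / q + 1 / (q - 1) + t powr q / q) * H 1 + C 1 / q
    - (t powr (q - 1) * H t + G 1 - G t) / (q - 1)"
proof -
  let ?k = "1 / (q + 1) - 2 / q + 1 / (q - 1) + t powr q / q"
  have split: "(f has_integral integral {0..t} f) {0..t}" 
    "(f has_integral (integral {0..1} f - integral {0..t} f)) {t..1}"
    if f: "continuous_on {0..1} f" for f :: "real \<Rightarrow> real"
  proof -
    have "f integrable_on {0..t}" "f integrable_on {t..1}" "f integrable_on {0..1}"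
      using t f by (auto intro!: integrable_continuous_real elim: continuous_on_subset)
    moreover from Henstock_Kurzweil_Integration.integral_combine[OF _ _ this(3), of t] t
    have "integral {0..t} f + integral {t..1} f = integral {0..1} f" by auto
    ultimately show "(f has_integral integral {0..t} f) {0..t}" 
      "(f has_integral (integral {0..1} f - integral {0..t} f)) {t..1}"
      by (auto simp: has_integral_iff)
  qed
  have c: "continuous_on {0..1} (\<lambda>s. s powr q * h s)" "continuous_on {0..1} (\<lambda>s. s powr (q - 1) * h s)"
    using q by (auto intro!: continuous_intros h continuous_on_powr_01)
  note s = split[OF h] split[OF c(1)] split[OF c(2)]
  have "((\<lambda>s. (?k - t powr (q - 1) / (q - 1)) * h s + 1 / q * (s powr q * h s))
    has_integral ((?k - t powr (q - 1) / (q - 1)) * H t + 1 / q * C t)) {0..t}"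
    unfolding H_def C_def G_def by (intro has_integral_add has_integral_mult_right s)
  then have 1: "((\<lambda>s. Kq q s t * h s) has_integral ((?k - t powr (q - 1) / (q - 1)) * H t + 1 / q * C t)) {0..t}"
    by (rule has_integral_eq[rotated]) (auto simp: Kq_def max_def algebra_simps add_divide_distrib)
  have "((\<lambda>s. ?k * h s + 1 / q * (s powr q * h s) - 1 / (q - 1) * (s powr (q - 1) * h s))
    has_integral (?k * (H 1 - H t) + 1 / q * (C 1 - C t) - 1 / (q - 1) * (G 1 - G t))) {t..1}"
    unfolding H_def C_def G_def by (intro has_integral_add has_integral_diff has_integral_mult_right s)
  then have 2: "((\<lambda>s. Kq q s t * h s) has_integral (?k * (H 1 - H t) + 1 / q * (C 1 - C t) - 1 / (q - 1) * (G 1 - G t))) {t..1}"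
    by (rule has_integral_eq[rotated]) (auto simp: Kq_def max_def algebra_simps add_divide_distrib)
  from has_integral_combine[OF _ _ 1 2] t
  have "((\<lambda>s. Kq q s t * h s) has_integral (((?k - t powr (q - 1) / (q - 1)) * H t + 1 / q * C t)
     + (?k * (H 1 - H t) + 1 / q * (C 1 - C t) - 1 / (q - 1) * (G 1 - G t)))) {0..1}" by auto
  from has_integral_unique[OF fredholm_Kq_has_integral[OF h t] this]
  show ?thesis by (simp add: algebra_simps add_divide_distrib diff_divide_distrib)
qed

text \<open>The derivative contains no value of \<open>h\<close> itself, only its primitive; this
  converts the integral equation into a second-order differential equation.\<close>

lemma fredholm_Kq_deriv:
  assumes h: "continuous_on {0..1} h" and t: "0 < t" "t < 1"
  shows "(fredholm (Kq q) h has_real_derivative t powr (q - 2) * (t * integral {0..1} h - integral {0..t} h)) (at t)"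
proof -
  let ?H = "\<lambda>t. integral {0..t} h" and ?G = "\<lambda>t. integral {0..t} (\<lambda>s. s powr (q - 1) * h s)"
  define \<kappa> where "\<kappa> = 1 / (q + 1) - 2 / q + 1 / (q - 1)"
  let ?f = "\<lambda>t. (\<kappa> + t powr q / q) * ?H 1 + integral {0..1} (\<lambda>s. s powr q * h s) / q
    - (t powr (q - 1) * ?H t + ?G 1 - ?G t) / (q - 1)"
  have dint: "((\<lambda>t. integral {0..t} f) has_real_derivative f t) (at t)"
    if "continuous_on {0..1} f" for f :: "real \<Rightarrow> real"
    using integral_has_real_derivative[OF that, of t] t at_within_Icc_at[of 0 t 1] by auto
  have c: "continuous_on {0..1} (\<lambda>s. s powr (q - 1) * h s)"
    using q by (auto intro!: continuous_intros h continuous_on_powr_01)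
  have p: "((\<lambda>t. t powr (q - 1)) has_real_derivative (q - 1) * t powr (q - 2)) (at t)"
    "((\<lambda>t. t powr q) has_real_derivative q * t powr (q - 1)) (at t)"
    using has_real_derivative_powr[OF t(1), of "q - 1"] has_real_derivative_powr[OF t(1), of q] by auto
  have e: "t powr (q - 1) = t powr (q - 2) * t"
    using t powr_add[of t 1 "q - 2"] by simp
  have "(?f has_real_derivative (0 + q * t powr (q - 1) / q) * ?H 1 + 0
     - ((t powr (q - 1) * h t + ((q - 1) * t powr (q - 2)) * ?H t) + 0 - t powr (q - 1) * h t) / (q - 1)) (at t)"
    by (intro DERIV_diff DERIV_add DERIV_cdivide DERIV_cmult_right DERIV_const DERIV_mult' dint[OF h] dint[OF c] p)
  moreover have "(0 + q * t powr (q - 1) / q) * ?H 1 + 0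
     - ((t powr (q - 1) * h t + ((q - 1) * t powr (q - 2)) * ?H t) + 0 - t powr (q - 1) * h t) / (q - 1)
     = t powr (q - 2) * (t * ?H 1 - ?H t)"
    using q unfolding e by (simp add: right_diff_distrib mult_ac)
  ultimately have "(?f has_real_derivative t powr (q - 2) * (t * ?H 1 - ?H t)) (at t)" by (simp only:)
  then show ?thesis
    by (rule has_field_derivative_transform_within_open[of _ _ _ "{0<..<1}"])
       (use t fredholm_Kq_formula[OF h] in \<open>auto simp: \<kappa>_def\<close>)
qed

lemma fredholm_Kq_1:
  assumes h: "continuous_on {0..1} h"
  shows "fredholm (Kq q) h 1 = (1 / (q + 1) - 1 / q) * integral {0..1} h + integral {0..1} (\<lambda>s. s powr q * h s) / q"
  using fredholm_Kq_formula[OF h, of 1] by (simp add: algebra_simps)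

text \<open>The process has time average 0, so its covariance integrates to 0 in each
  variable.\<close>

lemma fredholm_Kq_const:
  assumes t: "t \<in> {0..1}" shows "fredholm (Kq q) (\<lambda>_. m) t = 0"
proof -
  have c: "continuous_on {0..1} (\<lambda>_::real. m)" by simp
  have "fredholm (Kq q) (\<lambda>_. m) t = fredholm (Kq q) (\<lambda>_. m) 1"
  proof (rule DERIV_zero_const_01[OF _ _ t])
    show "continuous_on {0..1} (fredholm (Kq q) (\<lambda>_. m))"
      by (intro fredholm_Kq_continuous I01_continuous(1) c)
    fix x :: real assume "0 < x" "x < 1"
    then show "(fredholm (Kq q) (\<lambda>_. m) has_real_derivative 0) (at x)"
      using fredholm_Kq_deriv[OF c, of x] by simp
  qed
  also have "\<dots> = 0"
  proof -
    have "((\<lambda>s. s powr q * m) has_integral (1 powr (q + 1) / (q + 1) * m - 0 powr (q + 1) / (q + 1) * m)) {0..1}"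
    proof (rule has_integral_interior)
      show "continuous_on {0..1} (\<lambda>x. x powr (q + 1) / (q + 1) * m)"
        using q by (auto intro!: continuous_intros continuous_on_powr_01)
      fix x :: real assume "0 < x"
      then show "((\<lambda>x. x powr (q + 1) / (q + 1) * m) has_real_derivative x powr q * m) (at x)"
        using q by (auto intro!: derivative_eq_intros)
    qed simp
    then have I: "integral {0..1} (\<lambda>s. s powr q * m) = 1 powr (q + 1) / (q + 1) * m - 0 powr (q + 1) / (q + 1) * m"
      by (rule integral_unique)
    show ?thesis unfolding fredholm_Kq_1[OF c] I using q by (simp add: field_simps)
  qed
  finally show ?thesis .
qed

lemma integral_Gsol: "t \<in> {0..1} \<Longrightarrow> integral {0..t} (Gsol q c) = Fsol q (c::real) t"
proof -
  assume t: "t \<in> {0..1}"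
  have "(Gsol q c has_integral (Fsol q c t - Fsol q c 0)) {0..t}"
    by (rule has_integral_interior)
       (use t Fsol_real_deriv[OF q] in \<open>auto intro: continuous_on_subset[OF continuous_on_Fsol_01[OF q]]\<close>)
  then show ?thesis by (simp add: integral_unique Fsol_0[OF q])
qed

text \<open>Both sides have the same derivative and agree at \<open>t = 1\<close>, where the
  kernel has no \<open>max\<close> term left.\<close>

lemma fredholm_Kq_Gsol:
  fixes c :: real
  assumes c: "Phi q c = 0" "c \<noteq> 0" and t: "t \<in> {0..1}"
  shows "fredholm (Kq q) (Gsol q c) t = Gsol q c t / c"
proof -
  note G = continuous_on_Gsol_01[OF q, where c = c]
  have "fredholm (Kq q) (Gsol q c) t - Gsol q c t / c = fredholm (Kq q) (Gsol q c) 1 - Gsol q c 1 / c"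
  proof (rule DERIV_zero_const_01[OF _ _ t])
    show "continuous_on {0..1} (\<lambda>t. fredholm (Kq q) (Gsol q c) t - Gsol q c t / c)"
      using c by (intro continuous_on_diff continuous_on_divide continuous_on_const fredholm_Kq_continuous I01_continuous(1) G) auto
    fix x :: real assume x: "0 < x" "x < 1"
    have "((\<lambda>t. fredholm (Kq q) (Gsol q c) t - Gsol q c t / c) has_real_derivative
       x powr (q - 2) * (x * integral {0..1} (Gsol q c) - integral {0..x} (Gsol q c)) - (- c * x powr (q - 2) * Fsol q c x) / c) (at x)"
      by (intro DERIV_diff DERIV_cdivide fredholm_Kq_deriv[OF G] Gsol_real_deriv[OF q] x)
    then show "((\<lambda>t. fredholm (Kq q) (Gsol q c) t - Gsol q c t / c) has_real_derivative 0) (at x)"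
      using x c by (simp add: integral_Gsol Fsol_1[OF q])
  qed
  also have "fredholm (Kq q) (Gsol q c) 1 = Gsol q c 1 / c"
  proof -
    let ?P = "\<lambda>s. s powr q * Fsol q c s + q * (s * Gsol q c s - Fsol q c s) / c"
    have "((\<lambda>s. s powr q * Gsol q c s) has_integral (?P 1 - ?P 0)) {0..1}"
    proof (rule has_integral_interior)
      show "continuous_on {0..1} ?P"
        using q c by (auto intro!: continuous_intros continuous_on_powr_01 G continuous_on_Fsol_01[OF q])
      fix x :: real assume x: "0 < x"
      have p: "((\<lambda>t. t powr q) has_real_derivative q * x powr (q - 1)) (at x)"
        using has_real_derivative_powr[OF x, of q] by auto
      have e: "x powr (q - 1) = x powr (q - 2) * x"
        using x powr_add[of x 1 "q - 2"] by simp
      show "(?P has_real_derivative x powr q * Gsol q c x) (at x)"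
        using x c by (auto intro!: derivative_eq_intros p Fsol_real_deriv[OF q x] Gsol_real_deriv[OF q x] simp: e algebra_simps)
    qed simp
    then have "integral {0..1} (\<lambda>s. s powr q * Gsol q c s) = q * Gsol q c 1 / c"
      using c by (simp add: integral_unique Fsol_0[OF q] Fsol_1[OF q])
    then show ?thesis using q c by (simp add: fredholm_Kq_1[OF G] integral_Gsol Fsol_1[OF q])
  qed
  finally show ?thesis by simp
qed

lemma fredholm_Kq_linear:
  assumes "continuous_on {0..1} f" "continuous_on {0..1} g" "t \<in> {0..1}"
  shows "fredholm (Kq q) (\<lambda>s. f s + k * g s) t = fredholm (Kq q) f t + k * fredholm (Kq q) g t"
proof -
  have "((\<lambda>s. Kq q s t * f s + k * (Kq q s t * g s)) has_integral (fredholm (Kq q) f t + k * fredholm (Kq q) g t)) {0..1}"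
    by (intro has_integral_add has_integral_mult_right fredholm_Kq_has_integral assms)
  then have "((\<lambda>s. Kq q s t * (f s + k * g s)) has_integral (fredholm (Kq q) f t + k * fredholm (Kq q) g t)) {0..1}"
    by (simp add: algebra_simps)
  moreover have "continuous_on {0..1} (\<lambda>s. f s + k * g s)" by (intro continuous_intros assms)
  ultimately show ?thesis using fredholm_Kq_has_integral[of "\<lambda>s. f s + k * g s" t] assms(3) has_integral_unique by blast
qed

text \<open>Gronwall's argument for \<open>D\<^sup>2 + E\<^sup>2\<close>. The coefficient
  \<open>t^(q-2)\<close> may be unbounded at 0, but it is integrable there, so the integrating
  factor \<open>w\<close> is continuous up to 0.\<close>

lemma singular_ode_unique:
  fixes D E :: "real \<Rightarrow> real"
  assumes cont: "continuous_on {0..1} D" "continuous_on {0..1} E" and init: "D 0 = 0" "E 0 = 0"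
    and dD: "\<And>t. 0 < t \<Longrightarrow> t < 1 \<Longrightarrow> (D has_real_derivative E t) (at t)"
    and dE: "\<And>t. 0 < t \<Longrightarrow> t < 1 \<Longrightarrow> (E has_real_derivative - c * t powr (q - 2) * D t) (at t)"
    and t: "t \<in> {0..1}"
  shows "D t = 0" "E t = 0"
proof -
  \<comment> \<open>a primitive of \<open>1 + |c| t^(q-2)\<close> in the exponent dominates the growth rate of \<open>D\<^sup>2 + E\<^sup>2\<close>\<close>
  define w where "w t = exp (- t - \<bar>c\<bar> * t powr (q - 1) / (q - 1))" for t
  define V where "V t = ((D t)\<^sup>2 + (E t)\<^sup>2) * w t" for t
  have "V t \<le> V 0"
  proof (rule DERIV_nonpos_imp_decreasing_open[where f = V])
    show "0 \<le> t" using t by simp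
    have "continuous_on {0..1} V" unfolding V_def w_def
      using q by (intro continuous_intros cont continuous_on_powr_01) auto
    then show "continuous_on {0..t} V" by (rule continuous_on_subset) (use t in auto)
    fix x assume "0 < x" "x < t"
    then have x: "0 < x" "x < 1" using t by auto
    let ?p = "x powr (q - 2)"
    have p: "((\<lambda>t. t powr (q - 1)) has_real_derivative (q - 1) * ?p) (at x)"
      using has_real_derivative_powr[OF x(1), of "q - 1"] by auto
    have dw: "(w has_real_derivative w x * (- 1 - \<bar>c\<bar> * ?p)) (at x)"
      unfolding w_def[abs_def] using x q by (auto intro!: derivative_eq_intros p)
    have "(V has_real_derivative ((2 * D x * E x + 2 * E x * (- c * ?p * D x)) * w x
        + ((D x)\<^sup>2 + (E x)\<^sup>2) * (w x * (- 1 - \<bar>c\<bar> * ?p)))) (at x)"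
      unfolding V_def[abs_def] by (auto intro!: derivative_eq_intros dD[OF x] dE[OF x] dw)
    moreover have "((2 * D x * E x + 2 * E x * (- c * ?p * D x)) * w x
        + ((D x)\<^sup>2 + (E x)\<^sup>2) * (w x * (- 1 - \<bar>c\<bar> * ?p))) \<le> 0"
    proof -
      have DE: "\<bar>2 * D x * E x\<bar> \<le> (D x)\<^sup>2 + (E x)\<^sup>2"
        using sum_squares_bound[of "D x" "E x"] sum_squares_bound[of "D x" "- E x"] by (auto simp: abs_le_iff)
      have "(1 - c * ?p) * (2 * D x * E x) \<le> \<bar>1 - c * ?p\<bar> * \<bar>2 * D x * E x\<bar>"
        by (metis abs_ge_self abs_mult)
      also have "\<dots> \<le> (1 + \<bar>c\<bar> * ?p) * ((D x)\<^sup>2 + (E x)\<^sup>2)"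
      proof (rule mult_mono)
        have "\<bar>1 - c * ?p\<bar> \<le> \<bar>1\<bar> + \<bar>c * ?p\<bar>" by (rule abs_triangle_ineq4)
        then show "\<bar>1 - c * ?p\<bar> \<le> 1 + \<bar>c\<bar> * ?p" by (simp add: abs_mult)
      qed (use DE in auto)
      finally have "w x * ((1 - c * ?p) * (2 * D x * E x) - (1 + \<bar>c\<bar> * ?p) * ((D x)\<^sup>2 + (E x)\<^sup>2)) \<le> 0"
        by (intro mult_nonneg_nonpos) (auto simp: w_def)
      then show ?thesis by (simp add: algebra_simps)
    qed
    ultimately show "\<exists>y. (V has_real_derivative y) (at x) \<and> y \<le> 0" by blast
  qed
  also have "V 0 = 0" by (simp add: V_def init)
  finally have "(D t)\<^sup>2 + (E t)\<^sup>2 \<le> 0"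
    unfolding V_def w_def by (simp add: mult_le_0_iff)
  then show "D t = 0" "E t = 0"
    by (simp_all add: sum_power2_le_zero_iff)
qed

text \<open>The primitive of \<open>h\<close>, minus its linear part, satisfies the differential
  equation of \<^const>\<open>Fsol\<close> with value 0 at 0; by uniqueness it is a multiple
  \<open>k F\<close>, so \<open>h = m + k F'\<close>. It also vanishes at 1, so \<open>k \<Phi>(c)
  = 0\<close>. Applying the operator once more removes the constant \<open>m\<close>.\<close>

lemma continuous_eigenfunction:
  assumes h: "continuous_on {0..1} h" and mu: "\<mu> \<noteq> 0"
    and eig: "\<And>t. t \<in> {0..1} \<Longrightarrow> fredholm (Kq q) h t = \<mu> * h t"
  shows "\<exists>k. (\<forall>t\<in>{0..1}. h t = k * Gsol q (1 / \<mu>) t) \<and> (k = 0 \<or> Phi q (1 / \<mu>) = 0)"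
proof -
  let ?c = "1 / \<mu>"
  define H where "H t = integral {0..t} h" for t
  define m where "m = H 1"
  define k where "k = h 0 - m"
  define D where "D t = H t - t * m - k * Fsol q ?c t" for t
  define E where "E t = h t - m - k * Gsol q ?c t" for t
  have H: "continuous_on {0..1} H" unfolding H_def
    by (intro indefinite_integral_continuous_1 integrable_continuous_real h)
  have dH: "(H has_real_derivative h t) (at t)" if "0 < t" "t < 1" for t
    unfolding H_def[abs_def] using integral_has_real_derivative[OF h, of t] that at_within_Icc_at[of 0 t 1] by auto
  have dh: "(h has_real_derivative ?c * (t powr (q - 2) * (t * m - H t))) (at t)" if t: "0 < t" "t < 1" for t
  proof -
    have "((\<lambda>t. ?c * fredholm (Kq q) h t) has_real_derivative ?c * (t powr (q - 2) * (t * m - H t))) (at t)"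
      unfolding m_def H_def by (intro DERIV_cmult fredholm_Kq_deriv h t)
    then show ?thesis
      by (rule has_field_derivative_transform_within_open[of _ _ _ "{0<..<1}"])
         (use t mu eig in auto)
  qed
  have zero: "D t = 0" "E t = 0" if t: "t \<in> {0..1}" for t
  proof -
    have D': "(D has_real_derivative E t) (at t)" if "0 < t" "t < 1" for t
      unfolding D_def[abs_def] E_def using that
      by (auto intro!: derivative_eq_intros dH Fsol_real_deriv[OF q])
    have E': "(E has_real_derivative - ?c * t powr (q - 2) * D t) (at t)" if "0 < t" "t < 1" for t
      unfolding E_def[abs_def] D_def using that
      by (auto intro!: derivative_eq_intros dh Gsol_real_deriv[OF q] simp: algebra_simps)
    have c: "continuous_on {0..1} D" "continuous_on {0..1} E"
      unfolding D_def E_def by (intro continuous_intros H h continuous_on_Fsol_01[OF q] continuous_on_Gsol_01[OF q])+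
    have i: "D 0 = 0" "E 0 = 0" by (simp_all add: D_def E_def H_def k_def Fsol_0[OF q] Gsol_0[OF q])
    show "D t = 0" "E t = 0" using singular_ode_unique[OF c i D' E' t] by auto
  qed
  have heq: "h t = m + k * Gsol q ?c t" if "t \<in> {0..1}" for t using zero(2)[OF that] by (simp add: E_def)
  have "D 1 = 0" by (rule zero) simp
  then have kP: "k * Phi q ?c = 0" by (simp add: D_def m_def Fsol_1[OF q])
  have Th: "\<mu> * h t = k * fredholm (Kq q) (Gsol q ?c) t" if t: "t \<in> {0..1}" for t
  proof -
    have "\<mu> * h t = fredholm (Kq q) h t" using eig[OF t] by simp
    also have "\<dots> = fredholm (Kq q) (\<lambda>t. m + k * Gsol q ?c t) t"
      unfolding fredholm_def by (intro Bochner_Integration.integral_cong) (use heq in auto)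
    also have "\<dots> = k * fredholm (Kq q) (Gsol q ?c) t"
      by (subst fredholm_Kq_linear) (use t in \<open>auto intro!: continuous_on_Gsol_01[OF q] simp: fredholm_Kq_const\<close>)
    finally show ?thesis .
  qed
  have "h t = k * Gsol q ?c t" if t: "t \<in> {0..1}" for t
  proof (cases "k = 0")
    case True then show ?thesis using Th[OF t] mu by simp
  next
    case False
    then have "Phi q ?c = 0" using kP by simp
    from fredholm_Kq_Gsol[OF this _ t] mu Th[OF t] show ?thesis by simp
  qed
  then show ?thesis using kP by auto
qed

text \<open>The operator maps square-integrable functions to continuous ones, so an eigenfunction
  for \<open>\<mu> \<noteq> 0\<close> has a continuous representative.\<close>

lemma eigenspace_Kq:
  assumes h: "h \<in> eigenspace (Kq q) \<mu>" and mu: "\<mu> \<noteq> 0"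
  shows "\<exists>k. (AE t in I01. h t = k * Gsol q (1 / \<mu>) t) \<and> (k = 0 \<or> Phi q (1 / \<mu>) = 0)"
proof -
  have hL: "h \<in> L2" and ae: "AE t in I01. fredholm (Kq q) h t = \<mu> * h t"
    using h by (auto simp: eigenspace_def)
  define g where "g t = fredholm (Kq q) h t / \<mu>" for t
  have g: "continuous_on {0..1} g"
    unfolding g_def using mu
    by (intro continuous_on_divide continuous_on_const fredholm_Kq_continuous L2_imp_integrable hL) auto
  have hg: "AE t in I01. h t = g t" using ae by eventually_elim (use mu in \<open>simp add: g_def\<close>)
  have "fredholm (Kq q) g t = \<mu> * g t" if t: "t \<in> {0..1}" for t
  proof -
    have "fredholm (Kq q) g t = fredholm (Kq q) h t"
      unfolding fredholm_def
    proof (rule integral_cong_AE)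
      show "AE s in I01. Kq q s t * g s = Kq q s t * h s" using hg by eventually_elim simp
      have "h \<in> borel_measurable I01" using hL by (simp add: L2_def)
      then show "(\<lambda>s. Kq q s t * h s) \<in> borel_measurable I01"
        by (intro borel_measurable_times[OF I01_measurable[OF continuous_on_Kq1[OF t]]])
      show "(\<lambda>s. Kq q s t * g s) \<in> borel_measurable I01"
        by (intro borel_measurable_times I01_measurable continuous_on_Kq1 t g)
    qed
    then show ?thesis unfolding g_def using mu by simp
  qed
  from continuous_eigenfunction[OF g mu this] obtain k where
    k: "\<forall>t\<in>{0..1}. g t = k * Gsol q (1 / \<mu>) t" "k = 0 \<or> Phi q (1 / \<mu>) = 0" by blast
  have "AE t in I01. t \<in> {0..1}" by (rule AE_I2) simp
  with hg have "AE t in I01. h t = k * Gsol q (1 / \<mu>) t" by eventually_elim (use k in auto)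
  with k show ?thesis by blast
qed

end

section \<open>A factorization of the covariance kernel\<close>

lemma bessel_inequality_orthogonal:
  fixes f :: "nat \<Rightarrow> 'a \<Rightarrow> real"
  assumes A: "finite A" and n: "\<And>k. k \<in> A \<Longrightarrow> 0 < n k"
    and gg: "integrable M (\<lambda>x. g x * g x)"
    and gf: "\<And>k. k \<in> A \<Longrightarrow> integrable M (\<lambda>x. g x * f k x)"
    and ff: "\<And>j k. j \<in> A \<Longrightarrow> k \<in> A \<Longrightarrow> integrable M (\<lambda>x. f j x * f k x)"
    and orth: "\<And>j k. j \<in> A \<Longrightarrow> k \<in> A \<Longrightarrow> (LINT x|M. f j x * f k x) = (if j = k then n k else 0)"
  shows "(\<Sum>k\<in>A. (LINT x|M. g x * f k x)\<^sup>2 / n k) \<le> (LINT x|M. g x * g x)"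
proof -
  \<comment> \<open>the Fourier coefficients, which minimize the distance to the span\<close>
  define b where "b k = (LINT x|M. g x * f k x) / n k" for k
  have e: "(g x - (\<Sum>k\<in>A. b k * f k x))\<^sup>2 =
     g x * g x - 2 * (\<Sum>k\<in>A. b k * (g x * f k x)) + (\<Sum>j\<in>A. \<Sum>k\<in>A. b j * b k * (f j x * f k x))" for x
    by (simp add: power2_eq_square algebra_simps sum_product sum_distrib_left sum_distrib_right)
  have "0 \<le> (LINT x|M. (g x - (\<Sum>k\<in>A. b k * f k x))\<^sup>2)" by simp
  also have "\<dots> = (LINT x|M. g x * g x) - 2 * (\<Sum>k\<in>A. b k * (LINT x|M. g x * f k x))
     + (\<Sum>j\<in>A. \<Sum>k\<in>A. b j * b k * (LINT x|M. f j x * f k x))"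
    unfolding e using gg gf ff by simp
  also have "(\<Sum>j\<in>A. \<Sum>k\<in>A. b j * b k * (LINT x|M. f j x * f k x)) = (\<Sum>j\<in>A. \<Sum>k\<in>A. if j = k then b j * b j * n j else 0)"
    by (intro sum.cong refl) (auto simp: orth)
  also have "\<dots> = (\<Sum>j\<in>A. b j * b j * n j)" using A by simp
  also have "(\<Sum>j\<in>A. b j * b j * n j) = (\<Sum>k\<in>A. b k * (LINT x|M. g x * f k x))"
    by (intro sum.cong refl) (use n in \<open>force simp: b_def\<close>)
  also have "(\<Sum>k\<in>A. b k * (LINT x|M. g x * f k x)) = (\<Sum>k\<in>A. (LINT x|M. g x * f k x)\<^sup>2 / n k)"
    by (intro sum.cong refl) (simp add: b_def power2_eq_square)
  finally show ?thesis by simp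
qed

lemma I01_cutoff:
  fixes f :: "real \<Rightarrow> real"
  assumes f: "continuous_on {0..1} f" and x: "x \<in> {0..1}" and I: "(f has_integral y) {0..x}"
  shows "integrable I01 (\<lambda>v. of_bool (v \<le> x) * f v)" "(LINT v|I01. of_bool (v \<le> x) * f v) = y"
proof -
  have s: "set_integrable lborel {0..x} f"
    by (rule borel_integrable_atLeastAtMost') (use f x in \<open>auto intro: continuous_on_subset\<close>)
  have e: "indicator {0..1} v *\<^sub>R (of_bool (v \<le> x) * f v) = indicator {0..x} v *\<^sub>R f v" for v
    using x by (auto simp: indicator_def)
  show "integrable I01 (\<lambda>v. of_bool (v \<le> x) * f v)"
    by (subst integrable_restrict_space, simp) (use s in \<open>simp only: e set_integrable_def\<close>)
  have "(LINT v|I01. of_bool (v \<le> x) * f v) = (LINT v:{0..x}|lborel. f v)"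
    unfolding set_lebesgue_integral_def by (subst integral_restrict_space, simp) (simp only: e)
  also have "\<dots> = y" using set_borel_integral_eq_integral(2)[OF s] I by (simp add: integral_unique)
  finally show "(LINT v|I01. of_bool (v \<le> x) * f v) = y" .
qed

text \<open>In the variable \<open>v = x^(q-1)\<close> the weight \<open>x^(q-2)\<close>
  disappears up to a constant, and the solutions \<^const>\<open>Fsol\<close> become orthogonal
  for Lebesgue measure.\<close>

definition dual_fun :: "real \<Rightarrow> real \<Rightarrow> real \<Rightarrow> real" where
  "dual_fun q c v = Fsol q c (v powr (1 / (q - 1)))"

text \<open>The step function \<open>1[v \<le> t^(q-1)]\<close> minus its average over
  \<open>t\<close>. Formally, the centered process at time \<open>t\<close> is the Wiener integral
  of this function, up to the factor \<open>(q-1)^(-1/2)\<close>.\<close>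

definition cstep :: "real \<Rightarrow> real \<Rightarrow> real \<Rightarrow> real" where
  "cstep q t v = of_bool (v \<le> t powr (q - 1)) - (1 - v powr (1 / (q - 1)))"

context
  fixes q :: real
  assumes q: "1 < q"
begin

lemma powr_inverse_q1: "0 \<le> t \<Longrightarrow> (t powr (q - 1)) powr (1 / (q - 1)) = t"
  using q by (simp add: powr_powr)

lemma powr_q1_01: "t \<in> {0..1} \<Longrightarrow> t powr (q - 1) \<in> {0..1}"
  using q by (auto simp: powr_le1)

lemma root_01: "v \<in> {0..1} \<Longrightarrow> v powr (1 / (q - 1)) \<in> {0..1}"
  using q by (auto simp: powr_le1)

text \<open>The fundamental theorem of calculus for the weight \<open>x^(q-2)\<close>, after the
  substitution \<open>v = x^(q-1)\<close>. The substitution makes every integrand bounded, even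
  where the weight is singular.\<close>

lemma weighted_has_integral:
  fixes g G :: "real \<Rightarrow> real"
  assumes G: "continuous_on {0..1} G" and t: "t \<in> {0..1}"
    and d: "\<And>x. 0 < x \<Longrightarrow> x < 1 \<Longrightarrow> (G has_real_derivative x powr (q - 2) * g x) (at x)"
  shows "((\<lambda>v. g (v powr (1 / (q - 1)))) has_integral (q - 1) * (G t - G 0)) {0..t powr (q - 1)}"
proof -
  let ?r = "1 / (q - 1)" and ?T = "t powr (q - 1)"
  let ?F = "\<lambda>v. (q - 1) * G (v powr ?r)"
  have T: "?T \<in> {0..1}" by (rule powr_q1_01[OF t])
  have "((\<lambda>v. g (v powr ?r)) has_integral (?F ?T - ?F 0)) {0..?T}"
  proof (rule has_integral_interior)
    have "continuous_on {0..?T} (\<lambda>v. v powr ?r)" using q by (intro continuous_on_powr_01) auto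
    moreover have "(\<lambda>v. v powr ?r) ` {0..?T} \<subseteq> {0..1}" using root_01 T by fastforce
    ultimately show "continuous_on {0..?T} ?F"
      by (intro continuous_on_mult continuous_on_const continuous_on_compose2[OF G])
    fix v assume v: "0 < v" "v < ?T"
    then have y: "0 < v powr ?r" "v powr ?r < 1"
      using q T powr_less_mono2[of ?r v 1] by auto
    have dr: "((\<lambda>v. v powr ?r) has_real_derivative ?r * v powr (?r - 1)) (at v)"
      by (rule has_real_derivative_powr[OF v(1)])
    have "(?F has_real_derivative (q - 1) * ((v powr ?r) powr (q - 2) * g (v powr ?r) * (?r * v powr (?r - 1)))) (at v)"
      by (intro DERIV_cmult DERIV_chain2[OF d[OF y] dr])
    moreover have "(v powr ?r) powr (q - 2) * v powr (?r - 1) = 1"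
    proof -
      have "?r * (q - 2) + (?r - 1) = 0" using q by (simp add: field_simps)
      then show ?thesis using v by (simp add: powr_powr flip: powr_add)
    qed
    then have "(q - 1) * ((v powr ?r) powr (q - 2) * g (v powr ?r) * (?r * v powr (?r - 1))) = g (v powr ?r)"
      using q by (simp add: mult_ac)
    ultimately show "(?F has_real_derivative g (v powr ?r)) (at v)" by (simp only:)
  qed simp
  then show ?thesis using t q powr_inverse_q1[of t] by (simp add: right_diff_distrib)
qed

lemma continuous_on_root:
  fixes g :: "real \<Rightarrow> real"
  assumes "continuous_on {0..1} g"
  shows "continuous_on {0..1} (\<lambda>v. g (v powr (1 / (q - 1))))"
proof -
  have "continuous_on {0..1} (\<lambda>v. v powr (1 / (q - 1)))" using q by (intro continuous_on_powr_01) auto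
  moreover have "(\<lambda>v. v powr (1 / (q - 1))) ` {0..1} \<subseteq> {0..1}" using root_01 by blast
  ultimately show ?thesis by (rule continuous_on_compose2[OF assms])
qed

lemma weighted_cutoff:
  fixes g G :: "real \<Rightarrow> real"
  assumes G: "continuous_on {0..1} G" and g: "continuous_on {0..1} g" and t: "t \<in> {0..1}"
    and d: "\<And>x. 0 < x \<Longrightarrow> x < 1 \<Longrightarrow> (G has_real_derivative x powr (q - 2) * g x) (at x)"
  shows "integrable I01 (\<lambda>v. of_bool (v \<le> t powr (q - 1)) * g (v powr (1 / (q - 1))))"
    "(LINT v|I01. of_bool (v \<le> t powr (q - 1)) * g (v powr (1 / (q - 1)))) = (q - 1) * (G t - G 0)"
  using I01_cutoff[OF continuous_on_root[OF g] powr_q1_01[OF t] weighted_has_integral[OF G t d]] by auto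

lemma weighted_full:
  fixes g G :: "real \<Rightarrow> real"
  assumes G: "continuous_on {0..1} G" and g: "continuous_on {0..1} g"
    and d: "\<And>x. 0 < x \<Longrightarrow> x < 1 \<Longrightarrow> (G has_real_derivative x powr (q - 2) * g x) (at x)"
  shows "integrable I01 (\<lambda>v. g (v powr (1 / (q - 1))))"
    "(LINT v|I01. g (v powr (1 / (q - 1)))) = (q - 1) * (G 1 - G 0)"
proof -
  show "integrable I01 (\<lambda>v. g (v powr (1 / (q - 1))))"
    by (rule I01_continuous(1)[OF continuous_on_root[OF g]])
  have "(LINT v|I01. g (v powr (1 / (q - 1)))) = (LINT v|I01. of_bool (v \<le> 1 powr (q - 1)) * g (v powr (1 / (q - 1))))"
    by (intro Bochner_Integration.integral_cong) auto
  then show "(LINT v|I01. g (v powr (1 / (q - 1)))) = (q - 1) * (G 1 - G 0)"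
    using weighted_cutoff(2)[OF G g, of 1] d by simp
qed

lemma powr_antideriv:
  assumes "0 < x"
  shows "((\<lambda>x. x powr (q - 1) / (q - 1)) has_real_derivative x powr (q - 2)) (at x)"
    "((\<lambda>x. x powr q / q) has_real_derivative x powr (q - 2) * x) (at x)"
    "((\<lambda>x. x powr (q + 1) / (q + 1)) has_real_derivative x powr (q - 2) * (x * x)) (at x)"
proof -
  have e: "x powr (q - 1) = x powr (q - 2) * x" "x powr q = x powr (q - 1) * x"
    using assms powr_add[of x 1 "q - 2"] powr_add[of x 1 "q - 1"] by simp_all
  show "((\<lambda>x. x powr (q - 1) / (q - 1)) has_real_derivative x powr (q - 2)) (at x)"
    using DERIV_cdivide[OF has_real_derivative_powr[OF assms, of "q - 1"], of "q - 1"] q by simp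
  show "((\<lambda>x. x powr q / q) has_real_derivative x powr (q - 2) * x) (at x)"
    using DERIV_cdivide[OF has_real_derivative_powr[OF assms, of q], of q] q e by simp
  show "((\<lambda>x. x powr (q + 1) / (q + 1)) has_real_derivative x powr (q - 2) * (x * x)) (at x)"
    using DERIV_cdivide[OF has_real_derivative_powr[OF assms, of "q + 1"], of "q + 1"] q e by (simp add: mult_ac)
qed

lemma continuous_powr_antideriv:
  "continuous_on {0..1} (\<lambda>x. x powr (q - 1) / (q - 1))" "continuous_on {0..1} (\<lambda>x. x powr q / q)"
  "continuous_on {0..1} (\<lambda>x. x powr (q + 1) / (q + 1))"
  using q by (auto intro!: continuous_on_divide continuous_on_const continuous_on_powr_01)

lemma cstep_inner:
  assumes s: "s \<in> {0..1}" and t: "t \<in> {0..1}"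
  shows "integrable I01 (\<lambda>v. cstep q s v * cstep q t v)" "(LINT v|I01. cstep q s v * cstep q t v) = (q - 1) * Kq q s t"
proof -
  let ?a = "q - 1" and ?y = "\<lambda>v. v powr (1 / (q - 1))"
  have e: "cstep q s v * cstep q t v = of_bool (v \<le> min s t powr ?a) * 1 - of_bool (v \<le> s powr ?a) * (1 - ?y v)
     - of_bool (v \<le> t powr ?a) * (1 - ?y v) + (1 - ?y v) * (1 - ?y v)" for v
  proof -
    have "min s t powr ?a = min (s powr ?a) (t powr ?a)"
      using s t q powr_mono2[of ?a s t] powr_mono2[of ?a t s] by (auto simp: min_def)
    then show ?thesis unfolding cstep_def by (auto simp: algebra_simps)
  qed
  note cp = continuous_powr_antideriv
  have d2: "((\<lambda>x. x powr ?a / ?a - x powr q / q) has_real_derivative x powr (q - 2) * (1 - x)) (at x)"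
    if "0 < x" for x
    using DERIV_diff[OF powr_antideriv(1,2)[OF that]] by (simp add: algebra_simps)
  have d3: "((\<lambda>x. x powr ?a / ?a - 2 * (x powr q / q) + x powr (q + 1) / (q + 1)) has_real_derivative x powr (q - 2) * ((1 - x) * (1 - x))) (at x)"
    if "0 < x" for x
    using DERIV_add[OF DERIV_diff[OF powr_antideriv(1)[OF that] DERIV_cmult[OF powr_antideriv(2)[OF that], of 2]] powr_antideriv(3)[OF that]]
    by (simp add: algebra_simps)
  have m: "min s t \<in> {0..1}" using s t by auto
  have c1: "continuous_on {0..1} (\<lambda>x. 1 - x :: real)" "continuous_on {0..1} (\<lambda>x. (1 - x) * (1 - x) :: real)"
    "continuous_on {0..1} (\<lambda>x::real. 1 :: real)"
    by (intro continuous_intros)+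
  note i1 = weighted_cutoff[of _ "\<lambda>_. 1", OF cp(1) c1(3) m, simplified, OF powr_antideriv(1)]
  have c2: "continuous_on {0..1} (\<lambda>x. x powr ?a / ?a - x powr q / q)" by (intro continuous_on_diff cp)
  have c3: "continuous_on {0..1} (\<lambda>x. x powr ?a / ?a - 2 * (x powr q / q) + x powr (q + 1) / (q + 1))"
    by (intro continuous_on_diff continuous_on_add continuous_on_mult continuous_on_const cp)
  note i2 = weighted_cutoff[of _ "\<lambda>x. 1 - x", OF c2 c1(1) s d2] 
  note i3 = weighted_cutoff[of _ "\<lambda>x. 1 - x", OF c2 c1(1) t d2] 
  note i4 = weighted_full[of _ "\<lambda>x. (1 - x) * (1 - x)", OF c3 c1(2) d3]
  show "integrable I01 (\<lambda>v. cstep q s v * cstep q t v)"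
    unfolding e using i1(1) i2(1) i3(1) i4(1) by simp
  have "(LINT v|I01. cstep q s v * cstep q t v) = ?a * (min s t powr ?a / ?a) - ?a * (s powr ?a / ?a - s powr q / q)
     - ?a * (t powr ?a / ?a - t powr q / q) + ?a * (1 / ?a - 2 / q + 1 / (q + 1))"
    unfolding e using i1 i2 i3 i4 by simp
  also have "min s t powr ?a = s powr ?a + t powr ?a - max s t powr ?a" by (auto simp: min_def max_def)
  finally show "(LINT v|I01. cstep q s v * cstep q t v) = ?a * Kq q s t"
    unfolding Kq_def by (simp add: algebra_simps add_divide_distrib diff_divide_distrib)
qed

text \<open>Lagrange's identity.\<close>

lemma wronskian_deriv:
  assumes x: "0 < x"
  shows "((\<lambda>x. Fsol q c x * Gsol q d x - Gsol q c x * Fsol q d x) has_real_derivative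
    (c - d) * (x powr (q - 2) * (Fsol q c x * Fsol q d x))) (at x)"
  by (auto intro!: derivative_eq_intros Fsol_real_deriv[OF q x] Gsol_real_deriv[OF q x] simp: algebra_simps)

lemma dual_fun_inner_0:
  assumes "Phi q c = 0" "Phi q d = 0" "c \<noteq> d"
  shows "(LINT v|I01. dual_fun q c v * dual_fun q d v) = 0"
proof -
  let ?G = "\<lambda>x. (Fsol q c x * Gsol q d x - Gsol q c x * Fsol q d x) / (c - d)"
  note cc = continuous_on_Fsol_01[OF q] continuous_on_Gsol_01[OF q]
  have "(LINT v|I01. dual_fun q c v * dual_fun q d v) = (q - 1) * (?G 1 - ?G 0)"
    unfolding dual_fun_def
  proof (rule weighted_full(2))
    show "continuous_on {0..1} ?G" using assms
      by (intro continuous_on_diff continuous_on_mult continuous_on_divide continuous_on_const cc) auto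
    show "continuous_on {0..1} (\<lambda>x. Fsol q c x * Fsol q d x)" by (intro continuous_on_mult cc)
    fix x :: real assume x: "0 < x"
    show "(?G has_real_derivative x powr (q - 2) * (Fsol q c x * Fsol q d x)) (at x)"
      using DERIV_cdivide[OF wronskian_deriv[OF x, of c d], of "c - d"] assms by simp
  qed
  then show ?thesis using assms by (simp add: Fsol_0[OF q] Fsol_1[OF q])
qed

lemma dual_fun_inner_self:
  assumes "Phi q c = 0" "0 < c"
  shows "(LINT v|I01. dual_fun q c v * dual_fun q c v) = (q - 1) * (Psi q c)\<^sup>2 / (c * q)"
proof -
  let ?G = "\<lambda>x. pohozaev q c x / (c * q)"
  have "(LINT v|I01. dual_fun q c v * dual_fun q c v) = (q - 1) * (?G 1 - ?G 0)"
    unfolding dual_fun_def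
  proof (rule weighted_full(2))
    show "continuous_on {0..1} ?G" using assms q
      by (intro continuous_on_divide continuous_on_const continuous_on_pohozaev[OF q]) auto
    show "continuous_on {0..1} (\<lambda>x. Fsol q c x * Fsol q c x)" by (intro continuous_on_mult continuous_on_Fsol_01[OF q])
    fix x :: real assume x: "0 < x"
    show "(?G has_real_derivative x powr (q - 2) * (Fsol q c x * Fsol q c x)) (at x)"
      using DERIV_cdivide[OF pohozaev_deriv[OF q x, of c], of "c * q"] assms q by (simp add: power2_eq_square)
  qed
  then show ?thesis using assms by (simp add: pohozaev_0[OF q] pohozaev_1[OF q])
qed

lemma dual_fun_integrable: "integrable I01 (\<lambda>v. dual_fun q c v * dual_fun q d v)"
  unfolding dual_fun_def
  by (intro I01_continuous(1) continuous_on_mult continuous_on_root continuous_on_Fsol_01[OF q])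

lemma cstep_dual_fun:
  assumes t: "t \<in> {0..1}" and c: "Phi q c = 0" "c \<noteq> 0"
  shows "integrable I01 (\<lambda>v. cstep q t v * dual_fun q c v)" "(LINT v|I01. cstep q t v * dual_fun q c v) = - (q - 1) * Gsol q c t / c"
proof -
  note cc = continuous_on_Fsol_01[OF q] continuous_on_Gsol_01[OF q]
  let ?r = "\<lambda>v. v powr (1 / (q - 1))"
  have e: "cstep q t v * dual_fun q c v = of_bool (v \<le> t powr (q - 1)) * Fsol q c (?r v) - (Fsol q c (?r v) - ?r v * Fsol q c (?r v))" for v
    by (simp add: cstep_def dual_fun_def algebra_simps)
  let ?G1 = "\<lambda>x. - Gsol q c x / c"
  let ?G2 = "\<lambda>x. - Gsol q c x / c + (x * Gsol q c x - Fsol q c x) / c"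
  have c1: "continuous_on {0..1} ?G1" "continuous_on {0..1} ?G2" "continuous_on {0..1} (\<lambda>x. Fsol q c x - x * Fsol q c x)"
    using c by (intro continuous_on_add continuous_on_diff continuous_on_minus continuous_on_mult continuous_on_divide continuous_on_const continuous_on_id cc; simp)+
  have d1: "(?G1 has_real_derivative x powr (q - 2) * Fsol q c x) (at x)" if "0 < x" "x < 1" for x
    using DERIV_cdivide[OF DERIV_minus[OF Gsol_real_deriv[OF q that(1), of c]], of c] c by simp
  have d2: "(?G2 has_real_derivative x powr (q - 2) * (Fsol q c x - x * Fsol q c x)) (at x)" if x: "0 < x" "x < 1" for x
    using c by (auto intro!: derivative_eq_intros Fsol_real_deriv[OF q x(1)] Gsol_real_deriv[OF q x(1)] simp: field_simps)
  note i1 = weighted_cutoff[OF c1(1) cc(1) t d1]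
  note i2 = weighted_full[OF c1(2) c1(3) d2]
  show "integrable I01 (\<lambda>v. cstep q t v * dual_fun q c v)" unfolding e by (intro Bochner_Integration.integrable_diff i1(1) i2(1))
  have "(LINT v|I01. cstep q t v * dual_fun q c v) = (q - 1) * (?G1 t - ?G1 0) - (q - 1) * (?G2 1 - ?G2 0)"
  proof -
    have 1: "(LINT v|I01. of_bool (v \<le> t powr (q - 1)) * Fsol q c (?r v)) = (q - 1) * (?G1 t - ?G1 0)"
      by (rule i1(2))
    have 2: "(LINT v|I01. Fsol q c (?r v) - ?r v * Fsol q c (?r v)) = (q - 1) * (?G2 1 - ?G2 0)"
      by (rule i2(2))
    show ?thesis unfolding e by (subst Bochner_Integration.integral_diff[OF i1(1) i2(1)]) (simp_all only: 1 2)
  qed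
  also have "\<dots> = - (q - 1) * Gsol q c t / c"
    using c by (simp add: Fsol_0[OF q] Fsol_1[OF q] Gsol_0[OF q] field_simps)
  finally show "(LINT v|I01. cstep q t v * dual_fun q c v) = - (q - 1) * Gsol q c t / c" .
qed

lemma Gsol_inner_0:
  assumes "Phi q c = 0" "Phi q d = 0" "c \<noteq> (d::real)"
  shows "(LINT v|I01. Gsol q c v * Gsol q d v) = 0"
proof -
  note cc = continuous_on_Fsol_01[OF q] continuous_on_Gsol_01[OF q]
  let ?P = "\<lambda>x. Fsol q c x * Gsol q d x + d * ((Fsol q c x * Gsol q d x - Gsol q c x * Fsol q d x) / (c - d))"
  have "((\<lambda>v. Gsol q c v * Gsol q d v) has_integral (?P 1 - ?P 0)) {0..1}"
  proof (rule has_integral_interior)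
    show "continuous_on {0..1} ?P" using assms
      by (intro continuous_on_add continuous_on_diff continuous_on_mult continuous_on_divide continuous_on_const cc) auto
    fix x :: real assume x: "0 < x"
    show "(?P has_real_derivative Gsol q c x * Gsol q d x) (at x)"
      using DERIV_add[OF DERIV_mult'[OF Fsol_real_deriv[OF q x, of c] Gsol_real_deriv[OF q x, of d]]
          DERIV_cmult[OF DERIV_cdivide[OF wronskian_deriv[OF x, of c d], of "c - d"], of d]] assms
      by (simp add: mult_ac)
  qed simp
  from I01_integral_eq[OF _ this] show ?thesis
    using assms by (simp add: Fsol_0[OF q] Fsol_1[OF q] continuous_on_mult cc)
qed

lemma Gsol_inner_self:
  assumes "Phi q c = 0"
  shows "(LINT v|I01. Gsol q c v * Gsol q c v) = (Psi q c)\<^sup>2 / (q::real)"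
proof -
  note cc = continuous_on_Fsol_01[OF q] continuous_on_Gsol_01[OF q]
  let ?P = "\<lambda>x. Fsol q c x * Gsol q c x + pohozaev q c x / q"
  have "((\<lambda>v. Gsol q c v * Gsol q c v) has_integral (?P 1 - ?P 0)) {0..1}"
  proof (rule has_integral_interior)
    show "continuous_on {0..1} ?P" using q
      by (intro continuous_on_add continuous_on_mult continuous_on_divide continuous_on_const cc continuous_on_pohozaev[OF q]) auto
    fix x :: real assume x: "0 < x"
    show "(?P has_real_derivative Gsol q c x * Gsol q c x) (at x)"
      using q by (auto intro!: derivative_eq_intros Fsol_real_deriv[OF q x] Gsol_real_deriv[OF q x] pohozaev_deriv[OF q x] simp: power2_eq_square)
  qed simp
  from I01_integral_eq[OF _ this] show ?thesis
    using assms by (simp add: Fsol_0[OF q] Fsol_1[OF q] pohozaev_0[OF q] pohozaev_1[OF q] continuous_on_mult cc)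
qed

end

section \<open>The Mercer expansion\<close>

text \<open>The normalized eigenfunction multiplied by the square root of its eigenvalue; see
  \<open>scaled_e_eq\<close> below.\<close>

definition scaled_e :: "real \<Rightarrow> nat \<Rightarrow> real \<Rightarrow> real" where
  "scaled_e q k t = sqrt (q / inv_eig q k) * Gsol q (inv_eig q k) t / Psi q (inv_eig q k)"

definition mercer_rem :: "real \<Rightarrow> nat \<Rightarrow> real \<Rightarrow> real" where
  "mercer_rem q n t = Kq q t t - (\<Sum>k=1..n. (scaled_e q k t)\<^sup>2)"

context
  fixes q :: real
  assumes q: "1 < q"
begin

lemma continuous_on_scaled_e: "1 \<le> k \<Longrightarrow> continuous_on {0..1} (scaled_e q k)"
  unfolding scaled_e_def using Psi_ne_0[OF q inv_eig_pos[OF q] Phi_inv_eig[OF q], of k]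
  by (intro continuous_on_divide continuous_on_mult continuous_on_const continuous_on_Gsol_01[OF q]) auto

lemma inv_eig_inj: "1 \<le> j \<Longrightarrow> 1 \<le> k \<Longrightarrow> inv_eig q j = inv_eig q k \<longleftrightarrow> j = k"
  using inv_eig_mono[OF q, of j k] inv_eig_mono[OF q, of k j] by (cases j k rule: linorder_cases) auto

text \<open>Bessel's inequality for \<open>\<alpha> g\<^sub>s + \<beta> g\<^sub>t\<close>, where
  \<open>g\<close> is \<^const>\<open>cstep\<close>. In other words, the kernel minus a partial
  sum of its Mercer series is positive semidefinite.\<close>

lemma scaled_e_psd:
  assumes s: "s \<in> {0..1}" and t: "t \<in> {0..1}"
  shows "(\<Sum>k=1..n. (\<alpha> * scaled_e q k s + \<beta> * scaled_e q k t)\<^sup>2) \<le> \<alpha>\<^sup>2 * Kq q s s + 2 * \<alpha> * \<beta> * Kq q s t + \<beta>\<^sup>2 * Kq q t t"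
proof -
  let ?g = "\<lambda>v. \<alpha> * cstep q s v + \<beta> * cstep q t v" and ?f = "\<lambda>k. dual_fun q (inv_eig q k)"
  let ?n = "\<lambda>k. (q - 1) * (Psi q (inv_eig q k))\<^sup>2 / (inv_eig q k * q)"
  have c: "Phi q (inv_eig q k) = 0" "0 < inv_eig q k" "inv_eig q k \<noteq> 0" "Psi q (inv_eig q k) \<noteq> 0" if "k \<in> {1..n}" for k
    using Phi_inv_eig[OF q, of k] inv_eig_pos[OF q, of k] Psi_ne_0[OF q, of "inv_eig q k"] that by auto
  have gg: "?g v * ?g v = \<alpha>\<^sup>2 * (cstep q s v * cstep q s v) + 2 * \<alpha> * \<beta> * (cstep q s v * cstep q t v) + \<beta>\<^sup>2 * (cstep q t v * cstep q t v)" for v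
    by (simp add: power2_eq_square algebra_simps)
  have gf: "?g v * ?f k v = \<alpha> * (cstep q s v * ?f k v) + \<beta> * (cstep q t v * ?f k v)" for v k
    by (simp add: algebra_simps)
  note I = cstep_inner[OF q]
  have Igf: "(LINT v|I01. ?g v * ?f k v) = - (q - 1) * (\<alpha> * Gsol q (inv_eig q k) s + \<beta> * Gsol q (inv_eig q k) t) / inv_eig q k"
    "integrable I01 (\<lambda>v. ?g v * ?f k v)" if "k \<in> {1..n}" for k
  proof -
    note gs = cstep_dual_fun[OF q s c(1,3)[OF that]] and gt = cstep_dual_fun[OF q t c(1,3)[OF that]]
    show "integrable I01 (\<lambda>v. ?g v * ?f k v)" unfolding gf using gs(1) gt(1) by simp
    have "(LINT v|I01. ?g v * ?f k v) = \<alpha> * (LINT v|I01. cstep q s v * ?f k v) + \<beta> * (LINT v|I01. cstep q t v * ?f k v)"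
      unfolding gf using gs(1) gt(1) by simp
    then show "(LINT v|I01. ?g v * ?f k v) = - (q - 1) * (\<alpha> * Gsol q (inv_eig q k) s + \<beta> * Gsol q (inv_eig q k) t) / inv_eig q k"
      unfolding gs(2) gt(2) by (simp add: algebra_simps add_divide_distrib diff_divide_distrib)
  qed
  have "(\<Sum>k=1..n. (LINT v|I01. ?g v * ?f k v)\<^sup>2 / ?n k) \<le> (LINT v|I01. ?g v * ?g v)"
  proof (rule bessel_inequality_orthogonal)
    show "0 < ?n k" if "k \<in> {1..n}" for k using c[OF that] q by simp
    show "integrable I01 (\<lambda>v. ?g v * ?g v)" unfolding gg using I(1) s t by simp
    show "(LINT v|I01. ?f j v * ?f k v) = (if j = k then ?n k else 0)" if "j \<in> {1..n}" "k \<in> {1..n}" for j k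
      using dual_fun_inner_self[OF q c(1,2)[OF that(2)]] dual_fun_inner_0[OF q c(1)[OF that(1)] c(1)[OF that(2)]] inv_eig_inj[of j k] that
      by auto
  qed (use Igf(2) dual_fun_integrable[OF q] in auto)
  also have "(LINT v|I01. ?g v * ?g v) = (q - 1) * (\<alpha>\<^sup>2 * Kq q s s + 2 * \<alpha> * \<beta> * Kq q s t + \<beta>\<^sup>2 * Kq q t t)"
  proof -
    have "(LINT v|I01. ?g v * ?g v) = \<alpha>\<^sup>2 * (LINT v|I01. cstep q s v * cstep q s v)
        + 2 * \<alpha> * \<beta> * (LINT v|I01. cstep q s v * cstep q t v) + \<beta>\<^sup>2 * (LINT v|I01. cstep q t v * cstep q t v)"
      unfolding gg using I(1)[OF s s] I(1)[OF s t] I(1)[OF t t] by simp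
    then show ?thesis unfolding I(2)[OF s s] I(2)[OF s t] I(2)[OF t t] by (simp add: algebra_simps)
  qed
  also have "(\<Sum>k=1..n. (LINT v|I01. ?g v * ?f k v)\<^sup>2 / ?n k) = (q - 1) * (\<Sum>k=1..n. (\<alpha> * scaled_e q k s + \<beta> * scaled_e q k t)\<^sup>2)"
    unfolding sum_distrib_left
  proof (rule sum.cong[OF refl])
    fix k assume k: "k \<in> {1..n}"
    let ?c = "inv_eig q k" and ?P = "Psi q (inv_eig q k)" and ?L = "\<alpha> * Gsol q (inv_eig q k) s + \<beta> * Gsol q (inv_eig q k) t"
    have "\<alpha> * scaled_e q k s + \<beta> * scaled_e q k t = sqrt (q / ?c) * ?L / ?P"
      unfolding scaled_e_def by (simp add: algebra_simps add_divide_distrib)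
    then have "(\<alpha> * scaled_e q k s + \<beta> * scaled_e q k t)\<^sup>2 = (q / ?c) * ?L\<^sup>2 / ?P\<^sup>2"
      using q c(2)[OF k] by (simp only: power_divide power_mult_distrib) simp
    moreover have "(- (q - 1) * L / c)\<^sup>2 / ((q - 1) * P\<^sup>2 / (c * q)) = (q - 1) * ((q / c) * L\<^sup>2 / P\<^sup>2)"
      if "c \<noteq> 0" "P \<noteq> 0" for L c P
      using that q by (simp add: power2_eq_square divide_simps) (simp add: algebra_simps)
    from this[OF c(3,4)[OF k], of ?L]
    have "(LINT v|I01. ?g v * ?f k v)\<^sup>2 / ?n k = (q - 1) * ((q / ?c) * ?L\<^sup>2 / ?P\<^sup>2)"
      unfolding Igf(1)[OF k] .
    ultimately show "(LINT v|I01. ?g v * ?f k v)\<^sup>2 / ?n k = (q - 1) * (\<alpha> * scaled_e q k s + \<beta> * scaled_e q k t)\<^sup>2"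
      by (simp only:)
  qed
  finally show ?thesis using q by simp
qed

lemma mercer_rem_nonneg: "t \<in> {0..1} \<Longrightarrow> 0 \<le> mercer_rem q n t"
  using scaled_e_psd[of t t 1 0 n] by (simp add: mercer_rem_def)

text \<open>For a positive semidefinite kernel \<open>R\<close> one has \<open>R(t,t) \<le> 2
  R(s,s) + 2 (R(t,t) - 2 R(s,t) + R(s,s))\<close>. For the remainder kernel the last bracket is at
  most the same expression for the full covariance, which is the variance of an increment.\<close>

lemma mercer_rem_le:
  assumes s: "s \<in> {0..1}" and t: "t \<in> {0..1}"
  shows "mercer_rem q n t \<le> 2 * mercer_rem q n s + 2 * \<bar>t powr (q - 1) - s powr (q - 1)\<bar> / (q - 1)"
proof -
  have "(\<Sum>k=1..n. (1 * scaled_e q k t + (-2) * scaled_e q k s)\<^sup>2) = (\<Sum>k=1..n. (scaled_e q k t)\<^sup>2) - 4 * (\<Sum>k=1..n. scaled_e q k t * scaled_e q k s) + 4 * (\<Sum>k=1..n. (scaled_e q k s)\<^sup>2)"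
    by (simp add: power2_eq_square algebra_simps sum.distrib sum_subtractf sum_distrib_left)
  moreover have "0 \<le> (\<Sum>k=1..n. (scaled_e q k t - scaled_e q k s)\<^sup>2)" by (intro sum_nonneg) simp
  moreover have "(\<Sum>k=1..n. (scaled_e q k t - scaled_e q k s)\<^sup>2) = (\<Sum>k=1..n. (scaled_e q k t)\<^sup>2) - 2 * (\<Sum>k=1..n. scaled_e q k t * scaled_e q k s) + (\<Sum>k=1..n. (scaled_e q k s)\<^sup>2)"
    by (simp add: power2_eq_square algebra_simps sum.distrib sum_subtractf sum_distrib_left)
  moreover have "Kq q t t - 2 * Kq q t s + Kq q s s = \<bar>t powr (q - 1) - s powr (q - 1)\<bar> / (q - 1)"
  proof -
    have m: "max t s powr (q - 1) = max (t powr (q - 1)) (s powr (q - 1))"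
      using s t q powr_mono2[of "q - 1" s t] powr_mono2[of "q - 1" t s] by (auto simp: max_def)
    have ab: "\<bar>a - b\<bar> = 2 * max a b - a - b" for a b :: real by (simp add: max_def)
    show ?thesis unfolding ab m[symmetric] Kq_def by (simp add: diff_divide_distrib add_divide_distrib)
  qed
  ultimately show ?thesis using scaled_e_psd[OF t s, of 1 "-2" n] by (simp add: mercer_rem_def)
qed

lemma continuous_on_Kq_diag: "continuous_on {0..1} (\<lambda>t. Kq q t t)"
  by (rule continuous_on_compose2[OF continuous_on_Kq[OF q], of _ "\<lambda>t. (t, t)", simplified])
     (auto intro!: continuous_on_Pair continuous_on_id)

lemma continuous_on_mercer_rem: "continuous_on {0..1} (mercer_rem q n)"
  unfolding mercer_rem_def
  by (intro continuous_on_diff continuous_on_sum continuous_on_power continuous_on_scaled_e continuous_on_Kq_diag) auto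

lemma scaled_e_sq_integral: "1 \<le> k \<Longrightarrow> (LINT t|I01. (scaled_e q k t)\<^sup>2) = 1 / inv_eig q k"
proof -
  assume k: "1 \<le> k"
  have c: "Phi q (inv_eig q k) = 0" "0 < inv_eig q k" "Psi q (inv_eig q k) \<noteq> 0"
    using Phi_inv_eig[OF q, of k] inv_eig_pos[OF q, of k] Psi_ne_0[OF q, of "inv_eig q k"] k by auto
  have "(scaled_e q k t)\<^sup>2 = q / inv_eig q k / (Psi q (inv_eig q k))\<^sup>2 * (Gsol q (inv_eig q k) t * Gsol q (inv_eig q k) t)" for t
    unfolding scaled_e_def using c(2) q by (simp add: power_divide power_mult_distrib) (simp add: power2_eq_square)
  then show ?thesis using c q by (simp add: Gsol_inner_self[OF q c(1)])
qed

text \<open>This value is \<open>1 / (q (q + 1))\<close>, which is also minus the derivative of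
  \<^const>\<open>Phi\<close> at 0; the coincidence with \<open>sum_inverse_inv_eig\<close> is the
  completeness of the eigenfunctions.\<close>

lemma Kq_trace: "(LINT t|I01. Kq q t t) = bcoeff q 1"
proof -
  let ?P = "\<lambda>t. (1 / (q + 1) - 2 / q + 1 / (q - 1)) * t + 2 / q * (t powr (q + 1) / (q + 1)) - 1 / (q - 1) * (t powr q / q)"
  have "((\<lambda>t. Kq q t t) has_integral (?P 1 - ?P 0)) {0..1}"
  proof (rule has_integral_interior)
    show "continuous_on {0..1} ?P"
      by (intro continuous_on_add continuous_on_diff continuous_on_mult continuous_on_const continuous_on_id continuous_powr_antideriv[OF q])
    fix t :: real assume t: "0 < t"
    have d: "((\<lambda>t. t powr (q + 1) / (q + 1)) has_real_derivative t powr q) (at t)"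
      "((\<lambda>t. t powr q / q) has_real_derivative t powr (q - 1)) (at t)"
      using DERIV_cdivide[OF has_real_derivative_powr[OF t, of "q + 1"], of "q + 1"]
        DERIV_cdivide[OF has_real_derivative_powr[OF t, of q], of q] q by simp_all
    from DERIV_diff[OF DERIV_add[OF DERIV_cmult[OF DERIV_ident] DERIV_cmult[OF d(1)]] DERIV_cmult[OF d(2)],
      of "1 / (q + 1) - 2 / q + 1 / (q - 1)" "2 / q" "1 / (q - 1)"]
    show "(?P has_real_derivative Kq q t t) (at t)" by (simp add: Kq_def)
  qed simp
  then have "(LINT t|I01. Kq q t t) = ?P 1 - ?P 0" by (rule I01_integral_eq[OF continuous_on_Kq_diag])
  also have "\<dots> = bcoeff q 1" 
  proof -
    have e: "1 / (q + 1) - 2 / q + 1 / (q - 1) + 2 / q * (1 / (q + 1)) - 1 / (q - 1) * (1 / q) = 1 / (q * (q + 1))"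
      using q by (simp add: divide_simps) (simp add: algebra_simps)
    then show ?thesis by (simp add: bcoeff_def)
  qed
  finally show ?thesis .
qed

lemma mercer_rem_integral_tendsto: "(\<lambda>n. LINT t|I01. mercer_rem q n t) \<longlonglongrightarrow> 0"
proof -
  have "(LINT t|I01. mercer_rem q n t) = bcoeff q 1 - (\<Sum>k=1..n. 1 / inv_eig q k)" for n
  proof -
    have K: "integrable I01 (\<lambda>t. Kq q t t)" by (rule I01_continuous(1)[OF continuous_on_Kq_diag])
    have A: "integrable I01 (\<lambda>t. (scaled_e q k t)\<^sup>2)" if "k \<in> {1..n}" for k
      using that by (intro I01_continuous(1) continuous_on_power continuous_on_scaled_e) auto
    have "(LINT t|I01. mercer_rem q n t) = (LINT t|I01. Kq q t t) - (\<Sum>k=1..n. LINT t|I01. (scaled_e q k t)\<^sup>2)"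
      unfolding mercer_rem_def using K A
      by (subst Bochner_Integration.integral_diff) (auto intro!: Bochner_Integration.integral_sum)
    also have "(\<Sum>k=1..n. LINT t|I01. (scaled_e q k t)\<^sup>2) = (\<Sum>k=1..n. 1 / inv_eig q k)"
      by (intro sum.cong refl scaled_e_sq_integral) simp
    finally show ?thesis by (simp add: Kq_trace)
  qed
  then show ?thesis using tendsto_diff[OF tendsto_const sum_inverse_inv_eig[OF q], of "bcoeff q 1"] by simp
qed

text \<open>The previous comparison bounds the remainder at \<open>t\<close> by its mean over a
  window of length \<open>\<delta>\<close> that contains \<open>t\<close>, up to the modulus of
  continuity of \<open>t^(q-1)\<close>; the mean tends to 0.\<close>

lemma mercer_rem_uniform_tendsto:
  assumes "0 < \<epsilon>"
  shows "\<exists>n0. \<forall>n\<ge>n0. \<forall>t\<in>{0..1}. mercer_rem q n t \<le> \<epsilon>"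
proof -
  let ?\<omega> = "\<epsilon> * (q - 1) / 4"
  have "uniformly_continuous_on {0..1} (\<lambda>t. t powr (q - 1))"
    by (intro compact_uniformly_continuous continuous_on_powr_q1[OF q] compact_Icc)
  moreover have "0 < ?\<omega>" using assms q by simp
  ultimately obtain d where d: "0 < d" "\<And>s t. s \<in> {0..1} \<Longrightarrow> t \<in> {0..1} \<Longrightarrow> dist s t < d \<Longrightarrow> dist (s powr (q - 1)) (t powr (q - 1)) < ?\<omega>"
    unfolding uniformly_continuous_on_def by blast
  define \<delta> where "\<delta> = min (d / 2) (1 / 2)"
  have \<delta>: "0 < \<delta>" "\<delta> < d" "\<delta> \<le> 1 / 2" using d by (auto simp: \<delta>_def)
  have "\<forall>\<^sub>F n in sequentially. (LINT t|I01. mercer_rem q n t) < \<epsilon> * \<delta> / 4"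
    by (rule order_tendstoD(2)[OF mercer_rem_integral_tendsto]) (use assms \<delta> in simp)
  then obtain n0 where n0: "\<And>n. n \<ge> n0 \<Longrightarrow> (LINT t|I01. mercer_rem q n t) < \<epsilon> * \<delta> / 4"
    unfolding eventually_sequentially by blast
  have "mercer_rem q n t \<le> \<epsilon>" if n: "n \<ge> n0" and t: "t \<in> {0..1}" for n t
  proof -
    \<comment> \<open>the window \<open>{l..l + \<delta>}\<close> lies to the right or to the left of \<open>t\<close>, so as to stay inside \<open>{0..1}\<close>\<close>
    define l where "l = (if t \<le> 1 / 2 then t else t - \<delta>)"
    have l: "{l..l + \<delta>} \<subseteq> {0..1}" "\<And>s. s \<in> {l..l + \<delta>} \<Longrightarrow> dist t s < d"
      using t \<delta> by (auto simp: l_def dist_real_def split: if_splits)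
    have cR: "continuous_on {l..l + \<delta>} (mercer_rem q n)" by (rule continuous_on_subset[OF continuous_on_mercer_rem l(1)])
    have "((\<lambda>s. mercer_rem q n t - \<epsilon> / 2) has_integral \<delta> * (mercer_rem q n t - \<epsilon> / 2)) {l..l + \<delta>}"
      using has_integral_const_real[of "mercer_rem q n t - \<epsilon> / 2" l "l + \<delta>"] \<delta> by simp
    moreover have "((\<lambda>s. 2 * mercer_rem q n s) has_integral 2 * integral {l..l + \<delta>} (mercer_rem q n)) {l..l + \<delta>}"
      by (intro has_integral_mult_right integrable_integral integrable_continuous_real cR)
    moreover have "mercer_rem q n t - \<epsilon> / 2 \<le> 2 * mercer_rem q n s" if s: "s \<in> {l..l + \<delta>}" for s
    proof -
      have "\<bar>t powr (q - 1) - s powr (q - 1)\<bar> \<le> ?\<omega>"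
        using d(2)[of t s] l(1) l(2)[OF s] s t by (auto simp: dist_real_def)
      then have "2 * \<bar>t powr (q - 1) - s powr (q - 1)\<bar> / (q - 1) \<le> \<epsilon> / 2" using q by (simp add: field_simps)
      with mercer_rem_le[of s t n] s l(1) t show ?thesis by force
    qed
    ultimately have "\<delta> * (mercer_rem q n t - \<epsilon> / 2) \<le> 2 * integral {l..l + \<delta>} (mercer_rem q n)"
      by (rule has_integral_le)
    also have "integral {l..l + \<delta>} (mercer_rem q n) \<le> integral {0..1} (mercer_rem q n)"
      by (rule integral_subset_le[OF l(1)])
         (use mercer_rem_nonneg in \<open>auto intro!: integrable_continuous_real cR continuous_on_mercer_rem\<close>)
    also have "integral {0..1} (mercer_rem q n) = (LINT t|I01. mercer_rem q n t)"
      by (rule integral_unique[OF I01_continuous(2)[OF continuous_on_mercer_rem]])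
    also have "2 * (LINT t|I01. mercer_rem q n t) \<le> \<delta> * (\<epsilon> / 2)" using n0[OF n] by (simp add: mult.commute)
    finally have "\<delta> * (mercer_rem q n t - \<epsilon> / 2) \<le> \<delta> * (\<epsilon> / 2)" by simp
    then show ?thesis using \<delta> by simp
  qed
  then show ?thesis by blast
qed

text \<open>Polarization: semidefiniteness bounds the off-diagonal remainder by the diagonal
  ones.\<close>

lemma scaled_e_product_sum:
  assumes s: "s \<in> {0..1}" and t: "t \<in> {0..1}"
  shows "(\<lambda>n. \<Sum>k=1..n. scaled_e q k s * scaled_e q k t) \<longlonglongrightarrow> Kq q s t"
proof -
  have R: "(\<lambda>n. mercer_rem q n t) \<longlonglongrightarrow> 0" if t: "t \<in> {0..1}" for t
  proof (rule LIMSEQ_I)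
    fix r :: real assume r: "0 < r"
    obtain n0 where n0: "\<forall>n\<ge>n0. \<forall>t\<in>{0..1}. mercer_rem q n t \<le> r / 2" using mercer_rem_uniform_tendsto[of "r / 2"] r by auto
    show "\<exists>no. \<forall>n\<ge>no. norm (mercer_rem q n t - 0) < r"
    proof (intro exI allI impI)
      fix n assume "n0 \<le> n"
      then have "mercer_rem q n t \<le> r / 2" using n0 t by blast
      then show "norm (mercer_rem q n t - 0) < r" using mercer_rem_nonneg[OF t, of n] r by simp
    qed
  qed
  have "\<bar>(\<Sum>k=1..n. scaled_e q k s * scaled_e q k t) - Kq q s t\<bar> \<le> mercer_rem q n s + mercer_rem q n t" for n
  proof -
    have "(\<Sum>k=1..n. (1 * scaled_e q k s + 1 * scaled_e q k t)\<^sup>2) = (\<Sum>k=1..n. (scaled_e q k s)\<^sup>2) + 2 * (\<Sum>k=1..n. scaled_e q k s * scaled_e q k t) + (\<Sum>k=1..n. (scaled_e q k t)\<^sup>2)"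
      "(\<Sum>k=1..n. (1 * scaled_e q k s + (-1) * scaled_e q k t)\<^sup>2) = (\<Sum>k=1..n. (scaled_e q k s)\<^sup>2) - 2 * (\<Sum>k=1..n. scaled_e q k s * scaled_e q k t) + (\<Sum>k=1..n. (scaled_e q k t)\<^sup>2)"
      by (simp_all add: power2_eq_square algebra_simps sum.distrib sum_subtractf sum_distrib_left)
    then show ?thesis
      using scaled_e_psd[OF s t, of 1 1 n] scaled_e_psd[OF s t, of 1 "-1" n] mercer_rem_nonneg[OF s, of n] mercer_rem_nonneg[OF t, of n]
      unfolding mercer_rem_def abs_le_iff by (simp add: power2_eq_square)
  qed
  moreover have lim: "(\<lambda>n. mercer_rem q n s + mercer_rem q n t) \<longlonglongrightarrow> 0" using tendsto_add[OF R[OF s] R[OF t]] by simp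
  ultimately have "(\<lambda>n. (\<Sum>k=1..n. scaled_e q k s * scaled_e q k t) - Kq q s t) \<longlonglongrightarrow> 0"
    by (intro Lim_null_comparison[OF _ lim]) simp
  then show ?thesis by (simp add: LIM_zero_iff)
qed

text \<open>The power of \<open>t\<close> in front of the formula cancels the singular power of
  the Bessel function of index \<open>\<nu> - 1\<close>; what remains extends continuously to
  \<open>t = 0\<close>.\<close>

lemma KL_eigenfun_formula_eq:
  assumes k: "1 \<le> k" and t: "0 < t"
  shows "KL_eigenfun_formula (1 / q) k t = sqrt q * Gsol q (inv_eig q k) t / Psi q (inv_eig q k)"
proof -
  let ?z = "bessel_zero (1 / q) k"
  have z: "0 < ?z" by (rule bessel_zero_pos[OF q k])
  have z_sq: "(q * ?z / 2)\<^sup>2 = inv_eig q k" by (simp add: inv_eig_def)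
  have e1: "(q * (?z * t powr (q / 2)) / 2)\<^sup>2 = inv_eig q k * t powr q"
  proof -
    have "(t powr (q / 2))\<^sup>2 = t powr q" using t by (simp add: power2_eq_square flip: powr_add)
    then show ?thesis unfolding z_sq[symmetric] by (simp add: power_mult_distrib power_divide)
  qed
  have e2: "(?z * t powr (q / 2) / 2) powr (1 / q - 1) = (?z / 2) powr (1 / q - 1) * t powr (1 / 2 - q / 2)"
  proof -
    have "(?z * t powr (q / 2) / 2) powr (1 / q - 1) = (?z / 2 * t powr (q / 2)) powr (1 / q - 1)" by simp
    also have "\<dots> = (?z / 2) powr (1 / q - 1) * (t powr (q / 2)) powr (1 / q - 1)"
      using z by (subst powr_mult) auto
    also have "(t powr (q / 2)) powr (1 / q - 1) = t powr (1 / 2 - q / 2)"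
      using q by (simp add: powr_powr right_diff_distrib)
    finally show ?thesis .
  qed
  have J1: "bessel_J (1 / q - 1) (?z * t powr (q / 2)) = (?z / 2) powr (1 / q - 1) * t powr (1 / 2 - q / 2) / Gamma (1 / q) * Gsol q (inv_eig q k) t"
    unfolding bessel_J_eq_Psi[OF q] e1 e2 Gsol_def by simp
  have J2: "bessel_J (1 / q - 1) ?z = (?z / 2) powr (1 / q - 1) / Gamma (1 / q) * Psi q (inv_eig q k)"
    unfolding bessel_J_eq_Psi[OF q] z_sq ..
  have G: "Gamma (1 / q) > 0" using q by (intro Gamma_real_pos) simp
  have tt: "t powr (q / 2 - 1 / 2) * t powr (1 / 2 - q / 2) = 1" using t by (simp flip: powr_add)
  have i: "1 / (2 * (1 / q)) = q / 2" using q by simp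
  have "KL_eigenfun_formula (1 / q) k t = (t powr (q / 2 - 1 / 2) * t powr (1 / 2 - q / 2)) *
      (Gsol q (inv_eig q k) t / (sqrt (1 / q) * Psi q (inv_eig q k)))"
    unfolding KL_eigenfun_formula_def i J1 J2 using z G by simp
  then show ?thesis unfolding tt using q by (simp add: real_sqrt_divide)
qed

lemma KL_eigenfun_eq:
  assumes k: "1 \<le> k" and t: "0 \<le> t"
  shows "KL_eigenfun (1 / q) k t = sqrt q * Gsol q (inv_eig q k) t / Psi q (inv_eig q k)"
proof (cases "t = 0")
  case False
  then show ?thesis using t KL_eigenfun_formula_eq[OF k, of t] by (simp add: KL_eigenfun_def)
next
  case True
  have P: "Psi q (inv_eig q k) \<noteq> 0" using Psi_ne_0[OF q inv_eig_pos[OF q k] Phi_inv_eig[OF q k]] .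
  have "(Gsol q (inv_eig q k) \<longlongrightarrow> Gsol q (inv_eig q k) 0) (at 0 within {0..})"
    using continuous_on_Gsol[OF q, of "inv_eig q k"] unfolding continuous_on_def by auto
  then have "(Gsol q (inv_eig q k) \<longlongrightarrow> Gsol q (inv_eig q k) 0) (at_right 0)"
    by (rule tendsto_within_subset) auto
  then have "((\<lambda>t. sqrt q * Gsol q (inv_eig q k) t / Psi q (inv_eig q k)) \<longlongrightarrow> sqrt q * Gsol q (inv_eig q k) 0 / Psi q (inv_eig q k)) (at_right 0)"
    by (intro tendsto_divide tendsto_mult tendsto_const P)
  moreover have "\<forall>\<^sub>F t in at_right 0. sqrt q * Gsol q (inv_eig q k) t / Psi q (inv_eig q k) = KL_eigenfun_formula (1 / q) k t"
    using eventually_at_right_less[of "0::real"] by eventually_elim (simp add: KL_eigenfun_formula_eq[OF k])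
  ultimately have "(KL_eigenfun_formula (1 / q) k \<longlongrightarrow> sqrt q * Gsol q (inv_eig q k) 0 / Psi q (inv_eig q k)) (at_right 0)"
    by (rule Lim_transform_eventually)
  then show ?thesis using True by (simp add: KL_eigenfun_def tendsto_Lim)
qed

lemma KL_eigenvalue_eq: "KL_eigenvalue (1 / q) k = 1 / inv_eig q k"
  by (simp add: KL_eigenvalue_def inv_eig_def power2_eq_square field_simps)

lemma scaled_e_eq: "1 \<le> k \<Longrightarrow> 0 \<le> t \<Longrightarrow> sqrt (KL_eigenvalue (1 / q) k) * KL_eigenfun (1 / q) k t = scaled_e q k t"
  using q by (simp add: KL_eigenfun_eq KL_eigenvalue_eq scaled_e_def real_sqrt_divide)

end

section \<open>Characteristic functions determine the law of a process\<close>

lemma char_eq_cis: "char M t = (LINT x|M. cis (t * x))"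
  by (simp add: char_def cis_conv_exp)

lemma measurable_cis [measurable]: "cis \<in> borel_measurable borel"
  by (intro borel_measurable_continuous_onI continuous_intros)

lemma (in finite_measure) integrable_weight_cis:
  fixes w S :: "'a \<Rightarrow> real"
  assumes [measurable]: "w \<in> borel_measurable M" "S \<in> borel_measurable M"
    and w: "\<And>x. x \<in> space M \<Longrightarrow> 0 \<le> w x \<and> w x \<le> B"
  shows "integrable M (\<lambda>x. w x *\<^sub>R cis (S x))"
  by (rule integrable_const_bound[where B = B]) (use w in \<open>auto intro!: AE_I2\<close>)

text \<open>Levy's uniqueness theorem for finite instead of probability measures, here the image
  measures of a density.\<close>

lemma weighted_char_unique:
  fixes M :: "'a measure" and N :: "'b measure" and w X :: "'a \<Rightarrow> real" and w' X' :: "'b \<Rightarrow> real"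
  assumes M: "finite_measure M" and N: "finite_measure N"
    and [measurable]: "w \<in> borel_measurable M" "X \<in> borel_measurable M" "w' \<in> borel_measurable N" "X' \<in> borel_measurable N"
    and w: "\<And>x. x \<in> space M \<Longrightarrow> 0 \<le> w x \<and> w x \<le> B" and w': "\<And>x. x \<in> space N \<Longrightarrow> 0 \<le> w' x \<and> w' x \<le> B"
    and eq: "\<And>u. (LINT x|M. w x *\<^sub>R cis (u * X x)) = (LINT x|N. w' x *\<^sub>R cis (u * X' x))"
    and [measurable]: "A \<in> sets borel"
  shows "(LINT x|M. w x * indicator A (X x)) = (LINT x|N. w' x * indicator A (X' x))"
proof -
  interpret M: finite_measure M by fact
  interpret N: finite_measure N by fact
  define m where "m = (LINT x|M. w x)"
  have iw: "integrable M w" by (rule M.integrable_const_bound[where B = B]) (use w in \<open>auto intro!: AE_I2\<close>)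
  have iw': "integrable N w'" by (rule N.integrable_const_bound[where B = B]) (use w' in \<open>auto intro!: AE_I2\<close>)
  have m': "(LINT x|N. w' x) = m"
  proof -
    have "complex_of_real m = complex_of_real (LINT x|N. w' x)"
      using eq[of 0] unfolding m_def by (simp add: scaleR_conv_of_real)
    then show ?thesis by (simp only: of_real_eq_iff)
  qed
  have m0: "0 \<le> m" unfolding m_def by (rule integral_nonneg_AE) (use w in \<open>auto intro!: AE_I2\<close>)
  show ?thesis
  proof (cases "m = 0")
    case True
    have "AE x in M. w x = 0"
      using integral_nonneg_eq_0_iff_AE[OF iw] w True by (auto simp: m_def intro!: AE_I2)
    then have "(LINT x|M. w x * indicator A (X x)) = (LINT x|M. 0)"
      by (intro integral_cong_AE) auto
    moreover have "AE x in N. w' x = 0"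
      using integral_nonneg_eq_0_iff_AE[OF iw'] w' True m' by (auto intro!: AE_I2)
    then have "(LINT x|N. w' x * indicator A (X' x)) = (LINT x|N. 0)"
      by (intro integral_cong_AE) auto
    ultimately show ?thesis by simp
  next
    case False
    then have m: "0 < m" using m0 by simp
    have D: "real_distribution (distr (density K (\<lambda>x. ennreal (v x / m))) borel Z) \<and>
        (\<forall>u. char (distr (density K (\<lambda>x. ennreal (v x / m))) borel Z) u = (LINT x|K. v x *\<^sub>R cis (u * Z x)) /\<^sub>R m) \<and>
        measure (distr (density K (\<lambda>x. ennreal (v x / m))) borel Z) A = (LINT x|K. v x * indicator A (Z x)) / m"
      if [measurable]: "v \<in> borel_measurable K" "Z \<in> borel_measurable K" and iv: "integrable K v"
        and v: "\<And>x. x \<in> space K \<Longrightarrow> 0 \<le> v x" and vm: "(LINT x|K. v x) = m" for K :: "'c measure" and v Z :: "'c \<Rightarrow> real"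
    proof -
      let ?D = "density K (\<lambda>x. ennreal (v x / m))"
      have nn: "AE x in K. 0 \<le> v x / m" using v m by (auto intro!: AE_I2)
      have "emeasure ?D (space ?D) = (\<integral>\<^sup>+x. ennreal (v x / m) \<partial>K)"
        by (subst emeasure_density) (auto intro!: nn_integral_cong)
      also have "\<dots> = ennreal (LINT x|K. v x / m)"
        by (rule nn_integral_eq_integral[OF _ nn]) (use iv in simp)
      also have "\<dots> = 1" using vm m by simp
      finally interpret D: prob_space ?D by (rule prob_spaceI)
      have Z: "Z \<in> borel_measurable ?D" by simp
      have "char (distr ?D borel Z) u = (LINT x|K. v x *\<^sub>R cis (u * Z x)) /\<^sub>R m" for u
      proof -
        have "char (distr ?D borel Z) u = (LINT x|?D. cis (u * Z x))"
          unfolding char_eq_cis by (rule integral_distr) auto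
        also have "\<dots> = (LINT x|K. (v x / m) *\<^sub>R cis (u * Z x))"
          by (rule integral_density) (use nn in auto)
        also have "\<dots> = (LINT x|K. of_real (inverse m) * (v x *\<^sub>R cis (u * Z x)))"
          by (intro Bochner_Integration.integral_cong) (auto simp: scaleR_conv_of_real field_simps)
        also have "\<dots> = of_real (inverse m) * (LINT x|K. v x *\<^sub>R cis (u * Z x))"
          by (rule integral_mult_right_zero)
        finally show ?thesis by (simp only: scaleR_conv_of_real)
      qed
      moreover have "measure (distr ?D borel Z) A = (LINT x|K. v x * indicator A (Z x)) / m"
      proof -
        have "measure (distr ?D borel Z) A = (LINT x|distr ?D borel Z. indicator A x)" by simp
        also have "\<dots> = (LINT x|?D. indicator A (Z x))" by (rule integral_distr) auto
        also have "\<dots> = (LINT x|K. (v x / m) *\<^sub>R indicator A (Z x))"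
          by (rule integral_density) (use nn in auto)
        also have "\<dots> = (LINT x|K. v x * indicator A (Z x)) / m" by simp
        finally show ?thesis .
      qed
      ultimately show ?thesis using D.real_distribution_distr[OF Z] by blast
    qed
    note 1 = D[of w M X, OF _ _ iw _ m_def[symmetric]] and 2 = D[of w' N X', OF _ _ iw' _ m']
    have "distr (density M (\<lambda>x. ennreal (w x / m))) borel X = distr (density N (\<lambda>x. ennreal (w' x / m))) borel X'"
      by (rule Levy_uniqueness) (use 1 2 w w' eq in auto)
    then have "(LINT x|M. w x * indicator A (X x)) / m = (LINT x|N. w' x * indicator A (X' x)) / m"
      using 1 2 w w' by force
    then show ?thesis using m by simp
  qed
qed

lemma cis_integral_Re:
  assumes "integrable M (\<lambda>x. w x *\<^sub>R cis (S x))"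
  shows "(LINT x|M. w x * cos (S x)) = Re (LINT x|M. w x *\<^sub>R cis (S x))"
    "(LINT x|M. w x * sin (S x)) = Im (LINT x|M. w x *\<^sub>R cis (S x))"
    "integrable M (\<lambda>x. w x * cos (S x))" "integrable M (\<lambda>x. w x * sin (S x))"
  using integral_bounded_linear[OF bounded_linear_Re assms] integral_bounded_linear[OF bounded_linear_Im assms]
    integrable_bounded_linear[OF bounded_linear_Re assms] integrable_bounded_linear[OF bounded_linear_Im assms]
  by simp_all

text \<open>Induction on the number of variables. For a linear combination \<open>S\<close> of the
  remaining variables, \<open>w (1 + cos (S + \<theta>))\<close> is again a bounded nonnegative
  weight, and its transforms in the single variable \<open>X\<^sub>j\<close> are combinations of
  the given joint transforms. The one-dimensional statement thus inserts the indicator of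
  \<open>X\<^sub>j \<in> A\<^sub>j\<close> into the integrals of \<open>w cos S\<close> and
  \<open>w sin S\<close>, and the new weight satisfies the hypothesis for the remaining
  variables.\<close>

lemma joint_char_unique:
  fixes M :: "'a measure" and N :: "'b measure" and X :: "'i \<Rightarrow> 'a \<Rightarrow> real" and X' :: "'i \<Rightarrow> 'b \<Rightarrow> real"
  assumes M: "finite_measure M" and N: "finite_measure N" and "finite J"
    and "\<And>j. j \<in> J \<Longrightarrow> X j \<in> borel_measurable M" "\<And>j. j \<in> J \<Longrightarrow> X' j \<in> borel_measurable N"
    and "w \<in> borel_measurable M" "w' \<in> borel_measurable N"
    and "\<And>x. x \<in> space M \<Longrightarrow> 0 \<le> w x \<and> w x \<le> (1::real)" "\<And>x. x \<in> space N \<Longrightarrow> 0 \<le> w' x \<and> w' x \<le> (1::real)"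
    and "\<And>c. (LINT x|M. w x *\<^sub>R cis (\<Sum>j\<in>J. c j * X j x)) = (LINT x|N. w' x *\<^sub>R cis (\<Sum>j\<in>J. c j * X' j x))"
    and "\<And>j. j \<in> J \<Longrightarrow> A j \<in> sets borel"
  shows "(LINT x|M. w x * (\<Prod>j\<in>J. indicator (A j) (X j x))) = (LINT x|N. w' x * (\<Prod>j\<in>J. indicator (A j) (X' j x)))"
  using assms(3-)
proof (induction J arbitrary: w w')
  case empty
  have "complex_of_real (LINT x|M. w x) = complex_of_real (LINT x|N. w' x)"
    using empty.prems(7)[of "\<lambda>_. 0"] by (simp add: scaleR_conv_of_real)
  then show ?case by (simp only: prod.empty mult_1_right of_real_eq_iff)
next
  case (insert j J w w')
  interpret M: finite_measure M by fact
  interpret N: finite_measure N by fact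
  have [measurable]: "X j \<in> borel_measurable M" "X' j \<in> borel_measurable N" "A j \<in> sets borel"
    "w \<in> borel_measurable M" "w' \<in> borel_measurable N"
    "\<And>i. i \<in> J \<Longrightarrow> X i \<in> borel_measurable M" "\<And>i. i \<in> J \<Longrightarrow> X' i \<in> borel_measurable N"
    using insert.prems by auto
  note w = insert.prems(5) and w' = insert.prems(6)
  define v where "v x = w x * indicator (A j) (X j x)" for x
  define v' where "v' x = w' x * indicator (A j) (X' j x)" for x
  have [measurable]: "v \<in> borel_measurable M" "v' \<in> borel_measurable N" unfolding v_def v'_def by measurable
  have v: "0 \<le> v x \<and> v x \<le> 1" if "x \<in> space M" for x using w[OF that] by (auto simp: v_def indicator_def)
  have v': "0 \<le> v' x \<and> v' x \<le> 1" if "x \<in> space N" for x using w'[OF that] by (auto simp: v'_def indicator_def)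
  have "(LINT x|M. v x *\<^sub>R cis (\<Sum>i\<in>J. c i * X i x)) = (LINT x|N. v' x *\<^sub>R cis (\<Sum>i\<in>J. c i * X' i x))" for c
  proof -
    define S where "S x = (\<Sum>i\<in>J. c i * X i x)" for x
    define S' where "S' x = (\<Sum>i\<in>J. c i * X' i x)" for x
    have [measurable]: "S \<in> borel_measurable M" "S' \<in> borel_measurable N" unfolding S_def S'_def by measurable
    have eq: "(LINT x|M. w x *\<^sub>R cis (u * X j x + a * S x)) = (LINT x|N. w' x *\<^sub>R cis (u * X' j x + a * S' x))" for u a
    proof -
      have s: "(\<Sum>i\<in>insert j J. (if i = j then u else a * c i) * Z i) = u * Z j + a * (\<Sum>i\<in>J. c i * Z i)" for Z :: "'i \<Rightarrow> real"
      proof -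
        have "(\<Sum>i\<in>J. (if i = j then u else a * c i) * Z i) = (\<Sum>i\<in>J. a * (c i * Z i))"
          using insert.hyps by (intro sum.cong refl) auto
        then show ?thesis using insert.hyps by (simp add: sum_distrib_left)
      qed
      show ?thesis using insert.prems(7)[of "\<lambda>i. if i = j then u else a * c i"] unfolding s S_def S'_def .
    qed
    have int: "integrable M (\<lambda>x. w x *\<^sub>R cis (u * X j x + a * S x))" "integrable N (\<lambda>x. w' x *\<^sub>R cis (u * X' j x + a * S' x))" for u a
      using M.integrable_weight_cis[of w "\<lambda>x. u * X j x + a * S x" 1] N.integrable_weight_cis[of w' "\<lambda>x. u * X' j x + a * S' x" 1] w w' by auto
    have key: "(LINT x|M. (w x * (1 + cos (S x + \<theta>))) * indicator (A j) (X j x)) = (LINT x|N. (w' x * (1 + cos (S' x + \<theta>))) * indicator (A j) (X' j x))" for \<theta>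
    proof (rule weighted_char_unique[OF M N, where B = 2])
      have b: "0 \<le> a * (1 + cos t) \<and> a * (1 + cos t) \<le> 2" if "0 \<le> a \<and> a \<le> 1" for a t :: real
      proof -
        have "0 \<le> 1 + cos t" using cos_ge_minus_one[of t] by linarith
        moreover from this have "a * (1 + cos t) \<le> 1 * 2" using that by (intro mult_mono) auto
        ultimately show ?thesis using that by simp
      qed
      show "0 \<le> w x * (1 + cos (S x + \<theta>)) \<and> w x * (1 + cos (S x + \<theta>)) \<le> 2" if "x \<in> space M" for x
        by (rule b) (use w[OF that] in simp)
      show "0 \<le> w' x * (1 + cos (S' x + \<theta>)) \<and> w' x * (1 + cos (S' x + \<theta>)) \<le> 2" if "x \<in> space N" for x
        by (rule b) (use w'[OF that] in simp)
      have e: "(a * (1 + cos (s + \<theta>))) *\<^sub>R cis (u * z) =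
         a *\<^sub>R cis (u * z + 0 * s) + (cis \<theta> / 2) * (a *\<^sub>R cis (u * z + 1 * s)) + (cis (- \<theta>) / 2) * (a *\<^sub>R cis (u * z + (-1) * s))" for a s u z :: real
      proof -
        have complex_cos: "complex_of_real (cos t) = (cis t + cis (- t)) / 2" for t
          by (simp add: complex_eq_iff)
        have "complex_of_real (cos (s + \<theta>)) = (cis (s + \<theta>) + cis (- (s + \<theta>))) / 2"
          using complex_cos[of "s + \<theta>"] .
        also have "cis (s + \<theta>) = cis \<theta> * cis s" by (simp add: cis_mult add.commute)
        also have "cis (- (s + \<theta>)) = cis (- \<theta>) * cis (- s)" by (simp only: cis_mult minus_add_distrib add.commute)
        finally have c: "complex_of_real (cos (s + \<theta>)) = (cis \<theta> * cis s + cis (- \<theta>) * cis (- s)) / 2" .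
        have p: "cis (u * z + 1 * s) = cis (u * z) * cis s" "cis (u * z + (-1) * s) = cis (u * z) * cis (- s)"
          by (simp_all add: cis_mult)
        show ?thesis unfolding p using c by (simp add: scaleR_conv_of_real algebra_simps add_divide_distrib)
      qed
      have lin3: "(LINT x|K. f x + a * g x + b * h x) = (LINT x|K. f x) + a * (LINT x|K. g x) + b * (LINT x|K. h x)"
        if "integrable K f" "integrable K g" "integrable K h" for K :: "'k measure" and f g h :: "'k \<Rightarrow> complex" and a b
        using that by simp
      show "(LINT x|M. (w x * (1 + cos (S x + \<theta>))) *\<^sub>R cis (u * X j x)) = (LINT x|N. (w' x * (1 + cos (S' x + \<theta>))) *\<^sub>R cis (u * X' j x))" for u
        unfolding e lin3[OF int(1) int(1) int(1)] lin3[OF int(2) int(2) int(2)] eq ..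
    qed measurable
    have base: "(LINT x|M. w x * indicator (A j) (X j x)) = (LINT x|N. w' x * indicator (A j) (X' j x))"
      by (rule weighted_char_unique[OF M N, where B = 1]) (use w w' eq[of _ 0] in auto)
    have iv: "integrable M v" "integrable N v'"
      using v v' by (auto intro!: M.integrable_const_bound[where B = 1] N.integrable_const_bound[where B = 1] AE_I2)
    have ic: "integrable M (\<lambda>x. v x * cos (S x + \<theta>))" "integrable N (\<lambda>x. v' x * cos (S' x + \<theta>))" for \<theta>
      using cis_integral_Re(3)[OF M.integrable_weight_cis[of v "\<lambda>x. S x + \<theta>" 1]]
        cis_integral_Re(3)[OF N.integrable_weight_cis[of v' "\<lambda>x. S' x + \<theta>" 1]] v v' by auto
    have c: "(LINT x|M. v x * cos (S x + \<theta>)) = (LINT x|N. v' x * cos (S' x + \<theta>))" for \<theta>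
    proof -
      have "(LINT x|M. v x + v x * cos (S x + \<theta>)) = (LINT x|N. v' x + v' x * cos (S' x + \<theta>))"
        using key[of \<theta>] unfolding v_def v'_def by (simp add: algebra_simps)
      moreover have "(LINT x|M. v x) = (LINT x|N. v' x)" using base unfolding v_def v'_def .
      ultimately show ?thesis using iv ic by simp
    qed
    note R = cis_integral_Re(1,2)[OF M.integrable_weight_cis[of v S 1]] cis_integral_Re(1,2)[OF N.integrable_weight_cis[of v' S' 1]]
    have "(LINT x|M. v x *\<^sub>R cis (S x)) = (LINT x|N. v' x *\<^sub>R cis (S' x))"
    proof (rule complex_eqI)
      show "Re (LINT x|M. v x *\<^sub>R cis (S x)) = Re (LINT x|N. v' x *\<^sub>R cis (S' x))"
        using R c[of 0] v v' by simp
      \<comment> \<open>the shift by a quarter period turns the result for cosines into one for sines\<close>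
      have "cos (s - pi / 2) = sin s" for s :: real by (simp add: cos_diff)
      then show "Im (LINT x|M. v x *\<^sub>R cis (S x)) = Im (LINT x|N. v' x *\<^sub>R cis (S' x))"
        using R c[of "- (pi / 2)"] v v' by simp
    qed
    then show ?thesis unfolding S_def S'_def .
  qed
  then have "(LINT x|M. v x * (\<Prod>i\<in>J. indicator (A i) (X i x))) = (LINT x|N. v' x * (\<Prod>i\<in>J. indicator (A i) (X' i x)))"
    using insert.prems v v' by (intro insert.IH) auto
  then show ?case using insert.hyps unfolding v_def v'_def by (simp add: mult.assoc)
qed

text \<open>Cylinder sets determine a law on the product space, and their probabilities are
  integrals of products of indicators.\<close>

lemma equal_in_law_of_char:
  fixes M :: "'a measure" and N :: "'b measure"
  assumes M: "prob_space M" and N: "prob_space N"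
    and X: "\<And>t. t \<in> T \<Longrightarrow> X t \<in> borel_measurable M" and Y: "\<And>t. t \<in> T \<Longrightarrow> Y t \<in> borel_measurable N"
    and eq: "\<And>J c. finite J \<Longrightarrow> J \<subseteq> T \<Longrightarrow> (LINT x|M. cis (\<Sum>t\<in>J. c t * X t x)) = (LINT x|N. cis (\<Sum>t\<in>J. c t * Y t x))"
  shows "equal_in_law T M X N Y"
proof -
  interpret M: prob_space M by fact
  interpret N: prob_space N by fact
  let ?P = "\<Pi>\<^sub>M t\<in>T. (borel :: real measure)"
  have mX: "(\<lambda>\<omega>. \<lambda>t\<in>T. X t \<omega>) \<in> measurable M ?P" by (rule measurable_restrict) (rule X)
  have mY: "(\<lambda>\<omega>. \<lambda>t\<in>T. Y t \<omega>) \<in> measurable N ?P" by (rule measurable_restrict) (rule Y)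
  have "distr M ?P (\<lambda>\<omega>. \<lambda>t\<in>T. X t \<omega>) = distr N ?P (\<lambda>\<omega>. \<lambda>t\<in>T. Y t \<omega>)"
  proof (rule measure_eqI_PiM_infinite)
    fix A :: "real \<Rightarrow> real set" and J assume J: "finite J" "J \<subseteq> T" and A: "\<And>i. i \<in> J \<Longrightarrow> A i \<in> sets borel"
    let ?E = "prod_emb T (\<lambda>_. borel) J (Pi\<^sub>E J A)"
    have E: "?E \<in> sets ?P" using J A by (intro sets_PiM_I) auto
    have val: "emeasure (distr K ?P (\<lambda>\<omega>. \<lambda>t\<in>T. Z t \<omega>)) ?E = ennreal (LINT x|K. 1 * (\<Prod>j\<in>J. indicator (A j) (Z j x)))"
      if K: "prob_space K" and Z: "\<And>t. t \<in> T \<Longrightarrow> Z t \<in> borel_measurable K" for K :: "'c measure" and Z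
    proof -
      interpret K: prob_space K by fact
      have mZ: "(\<lambda>\<omega>. \<lambda>t\<in>T. Z t \<omega>) \<in> measurable K ?P" by (rule measurable_restrict) (rule Z)
      let ?S = "{x \<in> space K. \<forall>j\<in>J. Z j x \<in> A j}"
      have S: "(\<lambda>\<omega>. \<lambda>t\<in>T. Z t \<omega>) -` ?E \<inter> space K = ?S"
        using J by (auto simp: prod_emb_def PiE_def extensional_def Pi_def space_PiM)
      have "?S \<in> sets K" using measurable_sets[OF mZ E] unfolding S .
      have "emeasure (distr K ?P (\<lambda>\<omega>. \<lambda>t\<in>T. Z t \<omega>)) ?E = emeasure K ?S"
        by (simp add: emeasure_distr[OF mZ E] S)
      also have "\<dots> = ennreal (LINT x|K. indicator ?S x)"
        using \<open>?S \<in> sets K\<close> by (simp add: K.emeasure_eq_measure)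
      also have "(LINT x|K. indicator ?S x) = (LINT x|K. 1 * (\<Prod>j\<in>J. indicator (A j) (Z j x)) :: real)"
      proof (rule Bochner_Integration.integral_cong[OF refl])
        fix x assume "x \<in> space K"
        then show "(indicator ?S x :: real) = 1 * (\<Prod>j\<in>J. indicator (A j) (Z j x))"
          using J(1) by (auto simp: indicator_def)
      qed
      finally show ?thesis .
    qed
    have "(LINT x|M. 1 * (\<Prod>j\<in>J. indicator (A j) (X j x)) :: real) = (LINT x|N. 1 * (\<Prod>j\<in>J. indicator (A j) (Y j x)))"
      by (rule joint_char_unique) (use M.finite_measure_axioms N.finite_measure_axioms J X Y A eq[OF J] in auto)
    then show "emeasure (distr M ?P (\<lambda>\<omega>. \<lambda>t\<in>T. X t \<omega>)) ?E = emeasure (distr N ?P (\<lambda>\<omega>. \<lambda>t\<in>T. Y t \<omega>)) ?E"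
      using val[OF M X] val[OF N Y] by simp
  next
    interpret D: prob_space "distr M ?P (\<lambda>\<omega>. \<lambda>t\<in>T. X t \<omega>)" by (rule M.prob_space_distr[OF mX])
    show "finite_measure (distr M ?P (\<lambda>\<omega>. \<lambda>t\<in>T. X t \<omega>))" by (rule D.finite_measure_axioms)
  qed auto
  then show ?thesis unfolding equal_in_law_def using X Y by blast
qed

section \<open>Linear functionals of the Wiener process\<close>

lemma (in prob_space) integral_cis_normal:
  assumes X: "distributed M lborel X (\<lambda>x. ennreal (normal_density 0 \<sigma> x))" and \<sigma>: "0 < \<sigma>"
  shows "(LINT x|M. cis (u * X x)) = of_real (exp (- (u * \<sigma>)\<^sup>2 / 2))"
proof -
  have Z: "distributed M lborel (\<lambda>x. X x / \<sigma>) std_normal_density"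
    using normal_standard_normal_convert[OF \<sigma>, of X 0] X by simp
  have mZ: "(\<lambda>x. X x / \<sigma>) \<in> measurable M lborel" by (rule distributed_measurable[OF Z])
  have "(LINT x|M. cis (u * X x)) = (LINT x|M. cis ((u * \<sigma>) * (X x / \<sigma>)))" using \<sigma> by simp
  also have "\<dots> = (LINT y|distr M lborel (\<lambda>x. X x / \<sigma>). cis ((u * \<sigma>) * y))"
    by (rule integral_distr[OF mZ, symmetric]) auto
  also have "\<dots> = char std_normal_distribution (u * \<sigma>)"
    unfolding distributed_distr_eq_density[OF Z] char_eq_cis ..
  finally show ?thesis unfolding char_std_normal_distribution .
qed

text \<open>Stated for a variance that may vanish, since linear combinations of a Gaussian process
  may be degenerate.\<close>

lemma gaussian_of_char:
  assumes M: "prob_space M" and Z[measurable]: "Z \<in> borel_measurable M" and V: "0 \<le> V"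
    and ch: "\<And>u. (LINT x|M. cis (u * Z x)) = of_real (exp (- (u\<^sup>2 * V) / 2))"
  shows "distr M borel Z = (if sqrt V = 0 then return borel 0 else density lborel (\<lambda>x. ennreal (normal_density 0 (sqrt V) x)))"
    "integrable M (\<lambda>x. (Z x)\<^sup>2)" "(LINT x|M. (Z x)\<^sup>2) = V"
proof -
  interpret prob_space M by fact
  have cZ: "char (distr M borel Z) u = of_real (exp (- (u\<^sup>2 * V) / 2))" for u
    unfolding char_eq_cis by (subst integral_distr) (use ch in auto)
  show d: "distr M borel Z = (if sqrt V = 0 then return borel 0 else density lborel (\<lambda>x. ennreal (normal_density 0 (sqrt V) x)))"
  proof (cases "V = 0")
    case True
    interpret R: prob_space "return borel (0::real)" by (rule prob_space_return) simp
    have "distr M borel Z = return borel 0"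
    proof (rule Levy_uniqueness)
      show "real_distribution (return borel (0::real))" by unfold_locales simp
      show "char (distr M borel Z) = char (return borel 0)"
      proof (rule ext)
        fix u
        have "char (return borel (0::real)) u = 1" unfolding char_eq_cis by (simp add: integral_return)
        then show "char (distr M borel Z) u = char (return borel 0) u" by (simp add: cZ True)
      qed
    qed simp
    then show ?thesis using True by simp
  next
    case False
    let ?D = "density lborel (\<lambda>x. ennreal (normal_density 0 (sqrt V) x))"
    have s: "0 < sqrt V" using V False by simp
    interpret D: prob_space ?D by (rule prob_space_normal_density[OF s])
    have dd: "distributed ?D lborel (\<lambda>x. x) (\<lambda>x. ennreal (normal_density 0 (sqrt V) x))"
      unfolding distributed_def by (auto intro: distr_id2)
    have "distr M borel Z = ?D"
    proof (rule Levy_uniqueness)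
      show "real_distribution ?D" by unfold_locales simp
      show "char (distr M borel Z) = char ?D"
      proof (rule ext)
        fix u
        have "char ?D u = of_real (exp (- (u * sqrt V)\<^sup>2 / 2))"
          unfolding char_eq_cis using D.integral_cis_normal[OF dd s, of u] .
        then show "char (distr M borel Z) u = char ?D u" using V by (simp add: cZ power_mult_distrib)
      qed
    qed simp
    then show ?thesis using False by simp
  qed
  have "integrable (distr M borel Z) (\<lambda>x. x\<^sup>2) \<and> (LINT x|distr M borel Z. x\<^sup>2) = V"
  proof (cases "V = 0")
    case True
    interpret R: prob_space "return borel (0::real)" by (rule prob_space_return) simp
    have "integrable (return borel (0::real)) (\<lambda>x. x\<^sup>2)"
      by (rule R.integrable_const_bound[of _ 0]) (auto simp: AE_return)
    then show ?thesis unfolding d using True by (simp add: integral_return)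
  next
    case False
    then have s: "0 < sqrt V" using V by simp
    have "has_bochner_integral lborel (\<lambda>x. normal_density 0 (sqrt V) x *\<^sub>R x\<^sup>2) V"
      using normal_moment_even[OF s, of 0 1] V by simp
    then have "has_bochner_integral (density lborel (\<lambda>x. ennreal (normal_density 0 (sqrt V) x))) (\<lambda>x. x\<^sup>2) V"
      by (intro has_bochner_integral_density) auto
    then show ?thesis unfolding d using s by (simp add: has_bochner_integral_iff)
  qed
  then show "integrable M (\<lambda>x. (Z x)\<^sup>2)" "(LINT x|M. (Z x)\<^sup>2) = V"
    by (simp_all add: integrable_distr_eq integral_distr)
qed

text \<open>Expresses the values of the Wiener process through independent increments and, with
  the same coefficients, indicators of nested intervals through those of disjoint ones. That the
  two coincide is what identifies the variance below.\<close>

lemma sum_by_parts: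
  fixes e x :: "nat \<Rightarrow> real"
  shows "(\<Sum>i=1..n. e i * x i) = (\<Sum>j<n. (\<Sum>i=Suc j..n. e i) * (x (Suc j) - x j)) + (\<Sum>i=1..n. e i) * x 0"
proof (induction n)
  case (Suc n)
  have "(\<Sum>j<Suc n. (\<Sum>i=Suc j..Suc n. e i) * (x (Suc j) - x j))
      = (\<Sum>j<Suc n. (\<Sum>i=Suc j..n. e i) * (x (Suc j) - x j)) + e (Suc n) * (\<Sum>j<Suc n. x (Suc j) - x j)"
    unfolding sum_distrib_left sum.distrib[symmetric]
    by (intro sum.cong refl) (simp add: algebra_simps)
  also have "(\<Sum>j<Suc n. x (Suc j) - x j) = x (Suc n) - x 0" by (rule sum_lessThan_telescope)
  finally show ?case using Suc by (simp add: algebra_simps)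
qed simp

text \<open>The characteristic function of a linear combination of Wiener values; the variance is
  in the form that Wiener's isometry would give, the squared norm of the corresponding combination
  of indicators \<open>1[v \<le> t]\<close>.\<close>

lemma wiener_cis_grid:
  fixes t e :: "nat \<Rightarrow> real"
  assumes W: "wiener_process M W" and t: "mono t" "t 0 = 0" "\<And>i. t i \<le> 1"
  shows "(LINT x|M. cis (\<Sum>i=1..n. e i * W (t i) x)) =
    of_real (exp (- (LINT v|I01. (\<Sum>i=1..n. e i * of_bool (v \<le> t i))\<^sup>2) / 2))"
proof -
  have tnn: "0 \<le> t i" for i using monoD[OF t(1), of 0 i] t(2) by simp
  from W have P: "prob_space M" and Wm: "\<And>t. 0 \<le> t \<Longrightarrow> W t \<in> borel_measurable M"
    and W0: "AE \<omega> in M. W 0 \<omega> = 0"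
    and ind: "prob_space.indep_vars M (\<lambda>_. borel) (\<lambda>i \<omega>. W (t (Suc i)) \<omega> - W (t i) \<omega>) {..<n}"
    and dist: "\<And>s t. 0 \<le> s \<Longrightarrow> s < t \<Longrightarrow> distributed M lborel (\<lambda>\<omega>. W t \<omega> - W s \<omega>) (\<lambda>x. ennreal (normal_density 0 (sqrt (t - s)) x))"
    unfolding wiener_process_def using t by auto
  interpret prob_space M by (rule P)
  \<comment> \<open>the coefficient of the \<open>j\<close>-th increment after summation by parts\<close>
  define D where "D j = (\<Sum>i=Suc j..n. e i)" for j
  define \<Delta> where "\<Delta> j \<omega> = W (t (Suc j)) \<omega> - W (t j) \<omega>" for j \<omega>
  have [measurable]: "W (t i) \<in> borel_measurable M" for i by (rule Wm[OF tnn])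
  have [measurable]: "\<Delta> j \<in> borel_measurable M" for j unfolding \<Delta>_def by measurable
  have [measurable]: "W 0 \<in> borel_measurable M" by (rule Wm) simp
  have ch1: "char (distr M borel (\<lambda>\<omega>. D j * \<Delta> j \<omega>)) 1 = of_real (exp (- ((D j)\<^sup>2 * (t (Suc j) - t j)) / 2))" for j
  proof -
    have c: "char (distr M borel (\<lambda>\<omega>. D j * \<Delta> j \<omega>)) 1 = (LINT \<omega>|M. cis (D j * \<Delta> j \<omega>))"
      unfolding char_eq_cis by (subst integral_distr) auto
    show ?thesis
    proof (cases "t j = t (Suc j)")
      case True
      then show ?thesis unfolding c by (simp add: \<Delta>_def prob_space)
    next
      case False
      then have l: "t j < t (Suc j)" using monoD[OF t(1), of j "Suc j"] by simp
      from integral_cis_normal[OF dist[OF tnn l], of "D j"] l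
      show ?thesis unfolding c unfolding \<Delta>_def by (simp add: power_mult_distrib)
    qed
  qed
  have "(LINT x|M. cis (\<Sum>i=1..n. e i * W (t i) x)) = (LINT x|M. cis (\<Sum>j<n. D j * \<Delta> j x))"
  proof (rule integral_cong_AE)
    show "AE x in M. cis (\<Sum>i=1..n. e i * W (t i) x) = cis (\<Sum>j<n. D j * \<Delta> j x)"
      using W0
    proof eventually_elim
      case (elim x)
      have "(\<Sum>i=1..n. e i * W (t i) x) = (\<Sum>j<n. D j * \<Delta> j x)"
        unfolding sum_by_parts[of e "\<lambda>i. W (t i) x" n] D_def \<Delta>_def using elim t(2) by simp
      then show ?case by (simp only:)
    qed
  qed auto
  also have "\<dots> = char (distr M borel (\<lambda>\<omega>. \<Sum>j<n. D j * \<Delta> j \<omega>)) 1"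
    unfolding char_eq_cis by (subst integral_distr) auto
  also have "\<dots> = (\<Prod>j<n. char (distr M borel (\<lambda>\<omega>. D j * \<Delta> j \<omega>)) 1)"
  proof (rule char_distr_sum)
    show "indep_vars (\<lambda>_. borel) (\<lambda>j \<omega>. D j * \<Delta> j \<omega>) {..<n}"
      unfolding \<Delta>_def by (rule indep_vars_compose2[OF ind, where Y = "\<lambda>j x. D j * x"]) auto
  qed
  also have "\<dots> = of_real (exp (- (\<Sum>j<n. (D j)\<^sup>2 * (t (Suc j) - t j)) / 2))"
  proof -
    have "(\<Sum>j<n. - ((D j)\<^sup>2 * (t (Suc j) - t j)) / 2) = - (\<Sum>j<n. (D j)\<^sup>2 * (t (Suc j) - t j)) / 2"
      by (simp add: sum_negf sum_divide_distrib)
    from arg_cong[OF this, of exp] show ?thesis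
      unfolding ch1 of_real_prod[symmetric] by (simp only: exp_sum finite_lessThan)
  qed
  also have "(\<Sum>j<n. (D j)\<^sup>2 * (t (Suc j) - t j)) = (LINT v|I01. (\<Sum>i=1..n. e i * of_bool (v \<le> t i))\<^sup>2)"
  proof -
    define b where "b j v = (of_bool (v \<le> t (Suc j)) - of_bool (v \<le> t j) :: real)" for j v
    have ob: "integrable I01 (\<lambda>v. of_bool (v \<le> t i) :: real)" "(LINT v|I01. of_bool (v \<le> t i) :: real) = t i" for i
    proof -
      have "((\<lambda>_. 1 :: real) has_integral t i) {0..t i}" using has_integral_const_real[of "1::real" 0 "t i"] tnn[of i] by simp
      from I01_cutoff[OF continuous_on_const _ this] tnn[of i] t(3)[of i]
      show "integrable I01 (\<lambda>v. of_bool (v \<le> t i) :: real)" "(LINT v|I01. of_bool (v \<le> t i) :: real) = t i" by simp_all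
    qed
    have ib: "integrable I01 (b j)" "(LINT v|I01. b j v) = t (Suc j) - t j" for j
      unfolding b_def using ob by simp_all
    have bb: "b j v * b k v = (if j = k then b j v else 0)" for j k v
    proof -
      have m: "v \<le> t l" if "v \<le> t i" "i \<le> l" for i l using monoD[OF t(1) that(2)] that(1) by linarith
      show ?thesis
      proof (cases j k rule: linorder_cases)
        case less
        then show ?thesis using m[of j "Suc j"] m[of k "Suc k"] m[of "Suc j" k] by (auto simp: b_def)
      next
        case equal
        then show ?thesis using m[of j "Suc j"] by (auto simp: b_def)
      next
        case greater
        then show ?thesis using m[of j "Suc j"] m[of k "Suc k"] m[of "Suc k" j] by (auto simp: b_def)
      qed
    qed
    have sq: "(\<Sum>j<n. D j * b j v)\<^sup>2 = (\<Sum>j<n. (D j)\<^sup>2 * b j v)" for v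
    proof -
      have "(\<Sum>j<n. D j * b j v)\<^sup>2 = (\<Sum>j<n. \<Sum>k<n. D j * D k * (b j v * b k v))"
        unfolding power2_eq_square sum_product by (intro sum.cong refl) (simp add: mult_ac)
      also have "\<dots> = (\<Sum>j<n. \<Sum>k<n. if j = k then D j * D j * b j v else 0)"
        unfolding bb by (intro sum.cong refl) auto
      also have "\<dots> = (\<Sum>j<n. (D j)\<^sup>2 * b j v)" by (simp add: power2_eq_square)
      finally show ?thesis .
    qed
    have "AE v in I01. (\<Sum>i=1..n. e i * of_bool (v \<le> t i))\<^sup>2 = (\<Sum>j<n. (D j)\<^sup>2 * b j v)"
    proof -
      have "AE v in lborel. v \<noteq> (0::real)" by (rule AE_lborel_singleton)
      then have "AE v in I01. v \<noteq> 0" by (subst AE_restrict_space_iff) auto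
      moreover have "AE v in I01. v \<in> {0..1}" by (rule AE_I2) simp
      ultimately show ?thesis
      proof eventually_elim
        case (elim v)
        have "(\<Sum>i=1..n. e i * of_bool (v \<le> t i)) = (\<Sum>j<n. D j * b j v)"
          unfolding sum_by_parts[of e "\<lambda>i. of_bool (v \<le> t i)" n] D_def b_def using elim t(2) by simp
        then show ?case unfolding sq[symmetric] by (simp only:)
      qed
    qed
    then have "(LINT v|I01. (\<Sum>i=1..n. e i * of_bool (v \<le> t i))\<^sup>2) = (LINT v|I01. (\<Sum>j<n. (D j)\<^sup>2 * b j v))"
    proof (rule integral_cong_AE[rotated 2])
      have [measurable]: "(\<lambda>v. of_bool (v \<le> t i) :: real) \<in> borel_measurable I01" for i
        using ob(1) by (rule borel_measurable_integrable)
      show "(\<lambda>v. (\<Sum>i=1..n. e i * of_bool (v \<le> t i))\<^sup>2) \<in> borel_measurable I01" by measurable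
      have [measurable]: "b j \<in> borel_measurable I01" for j
        using ib(1) by (rule borel_measurable_integrable)
      show "(\<lambda>v. (\<Sum>j<n. (D j)\<^sup>2 * b j v)) \<in> borel_measurable I01" by measurable
    qed
    also have "\<dots> = (\<Sum>j<n. (D j)\<^sup>2 * (t (Suc j) - t j))" using ib by simp
    finally show ?thesis by simp
  qed
  finally show ?thesis .
qed

lemma wiener_cis_finite:
  assumes W: "wiener_process M W" and S: "finite S" "S \<subseteq> {0..1}"
  shows "(LINT x|M. cis (\<Sum>s\<in>S. d s * W s x)) = of_real (exp (- (LINT v|I01. (\<Sum>s\<in>S. d s * of_bool (v \<le> s))\<^sup>2) / 2))"
proof (cases "S = {}")
  case True
  interpret prob_space M using W by (simp add: wiener_process_def)
  show ?thesis using True by (simp add: prob_space)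
next
  case False
  define xs where "xs = sorted_list_of_set S"
  have xs: "set xs = S" "sorted xs" "distinct xs" "length xs = card S" using S by (auto simp: xs_def)
  have n: "0 < card S" using S False by (simp add: card_gt_0_iff)
  \<comment> \<open>the points of \<open>S\<close> in increasing order, preceded by 0; the index is clamped because the sequence has to be monotone on all natural numbers\<close>
  define t where "t i = (if i = 0 then 0 else xs ! (min i (card S) - 1))" for i
  have tS: "t i \<in> S" if "i \<noteq> 0" for i
    using that n nth_mem[of "min i (card S) - 1" xs] by (simp add: t_def xs)
  have t01: "t i \<in> {0..1}" for i
    using tS[of i] S by (cases "i = 0") (auto simp: t_def)
  have "mono t"
  proof (rule monoI)
    fix i j :: nat assume ij: "i \<le> j"
    show "t i \<le> t j"
    proof (cases "i = 0")
      case True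
      then show ?thesis using t01[of j] by (simp add: t_def)
    next
      case False
      have "min i (card S) - 1 \<le> min j (card S) - 1" "min j (card S) - 1 < length xs" using ij n xs(4) by auto
      then have "xs ! (min i (card S) - 1) \<le> xs ! (min j (card S) - 1)" by (rule sorted_nth_mono[OF xs(2)])
      then show ?thesis using False ij by (simp add: t_def)
    qed
  qed
  have bij: "bij_betw t {1..card S} S"
  proof -
    have "bij_betw (\<lambda>i. xs ! (i - 1)) {1..card S} S"
    proof (rule bij_betw_trans[of "\<lambda>i. i - 1" _ "{..<length xs}" "(!) xs", unfolded o_def])
      show "bij_betw (\<lambda>i. i - 1) {1..card S} {..<length xs}"
        by (rule bij_betw_byWitness[where f' = Suc]) (auto simp: xs(4))
      show "bij_betw ((!) xs) {..<length xs} S" by (rule bij_betw_nth) (use xs in auto)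
    qed
    moreover have "xs ! (i - 1) = t i" if "i \<in> {1..card S}" for i using that by (simp add: t_def min_def)
    ultimately show ?thesis by (subst bij_betw_cong[of _ t "\<lambda>i. xs ! (i - 1)"]) auto
  qed
  have re: "(\<Sum>s\<in>S. d s * f s) = (\<Sum>i=1..card S. d (t i) * f (t i))" for f :: "real \<Rightarrow> real"
    by (rule sum.reindex_bij_betw[OF bij, symmetric])
  show ?thesis unfolding re
    by (rule wiener_cis_grid[OF W \<open>mono t\<close>]) (use t01 in \<open>auto simp: t_def\<close>)
qed

text \<open>Times may repeat here, which is convenient when two families of times are
  merged.\<close>

lemma wiener_cis:
  assumes W: "wiener_process M W" and I: "finite I" and \<tau>: "\<And>i. i \<in> I \<Longrightarrow> \<tau> i \<in> {0..1}"
  shows "(LINT x|M. cis (\<Sum>i\<in>I. c i * W (\<tau> i) x)) = of_real (exp (- (LINT v|I01. (\<Sum>i\<in>I. c i * of_bool (v \<le> \<tau> i))\<^sup>2) / 2))"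
proof -
  define d where "d s = (\<Sum>i\<in>{i\<in>I. \<tau> i = s}. c i)" for s
  have g: "(\<Sum>i\<in>I. c i * f (\<tau> i)) = (\<Sum>s\<in>\<tau> ` I. d s * f s)" for f :: "real \<Rightarrow> real"
  proof -
    have "(\<Sum>i\<in>I. c i * f (\<tau> i)) = (\<Sum>s\<in>\<tau> ` I. \<Sum>i\<in>{i\<in>I. \<tau> i = s}. c i * f (\<tau> i))"
      by (rule sum.image_gen[OF I])
    also have "\<dots> = (\<Sum>s\<in>\<tau> ` I. d s * f s)"
      unfolding d_def sum_distrib_right by (intro sum.cong refl) auto
    finally show ?thesis .
  qed
  show ?thesis unfolding g[of "\<lambda>s. W s x" for x] g[of "\<lambda>s. of_bool (v \<le> s)" for v]
    by (rule wiener_cis_finite[OF W]) (use I \<tau> in auto)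
qed

section \<open>The centered time-changed Wiener process\<close>

lemma riemann_sum_tendsto:
  fixes f :: "real \<Rightarrow> real"
  assumes f: "continuous_on {0..1} f"
  shows "(\<lambda>n. (\<Sum>k=1..n. f (real k / real n)) / real n) \<longlonglongrightarrow> integral {0..1} f"
proof (rule LIMSEQ_I)
  fix r :: real assume r: "0 < r"
  have "uniformly_continuous_on {0..1} f" by (rule compact_uniformly_continuous[OF f]) simp
  then obtain d where d: "0 < d" "\<And>x y. x \<in> {0..1} \<Longrightarrow> y \<in> {0..1} \<Longrightarrow> dist x y < d \<Longrightarrow> dist (f x) (f y) < r / 2"
    using r unfolding uniformly_continuous_on_def by (metis half_gt_zero)
  obtain n0 where n0: "0 < n0" "1 / real n0 < d" using d(1) by (metis nat_approx_posE zero_less_Suc)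
  have main: "\<bar>(\<Sum>k=1..n. f (real k / real n)) / real n - integral {0..1} f\<bar> \<le> r / 2" if n: "n \<ge> n0" for n
  proof -
    have n': "0 < real n" using n n0 by simp
    have nd: "1 / real n < d"
    proof -
      have "1 / real n \<le> 1 / real n0" using n n0 by (intro divide_left_mono) auto
      then show ?thesis using n0 by simp
    qed
    have "\<bar>(\<Sum>k=1..m. f (real k / real n)) / real n - integral {0..real m / real n} f\<bar> \<le> real m * (r / 2) / real n"
      if "m \<le> n" for m
      using that
    proof (induction m)
      case (Suc m)
      let ?x = "real m / real n" and ?y = "real (Suc m) / real n"
      have xy: "0 \<le> ?x" "?x \<le> ?y" "?y \<le> 1" "?y - ?x = 1 / real n"
        using Suc.prems n' by (auto simp: divide_right_mono field_simps)
      have i1: "f integrable_on {0..?y}"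
        by (rule integrable_continuous_real[OF continuous_on_subset[OF f]]) (use xy in auto)
      have c2: "continuous_on {?x..?y} (\<lambda>u. f ?y - f u)"
        by (intro continuous_on_diff continuous_on_const continuous_on_subset[OF f]) (use xy in auto)
      have i2: "f integrable_on {?x..?y}"
        by (rule integrable_continuous_real[OF continuous_on_subset[OF f]]) (use xy in auto)
      have "norm (integral {?x..?y} (\<lambda>u. f ?y - f u)) \<le> r / 2 * (?y - ?x)"
      proof (rule integral_bound[OF xy(2) c2])
        fix u assume u: "u \<in> {?x..?y}"
        have "dist ?y u < d" using u xy(4) nd by (auto simp: dist_real_def)
        then have "dist (f ?y) (f u) < r / 2" using u xy(2,3) order_trans[OF xy(1), of u] order_trans[OF xy(1,2)] by (intro d(2)) auto
        then show "norm (f ?y - f u) \<le> r / 2" by (simp add: dist_real_def)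
      qed
      moreover have "integral {?x..?y} (\<lambda>u. f ?y - f u) = f ?y / real n - integral {?x..?y} f"
      proof -
        have "integral {?x..?y} (\<lambda>u. f ?y - f u) = integral {?x..?y} (\<lambda>u. f ?y) - integral {?x..?y} f"
          by (rule Henstock_Kurzweil_Integration.integral_diff[OF integrable_const_ivl i2])
        also have "integral {?x..?y} (\<lambda>u. f ?y) = (?y - ?x) * f ?y"
          using xy(2) by (simp del: of_nat_Suc)
        finally show ?thesis unfolding xy(4) by simp
      qed
      ultimately have "\<bar>f ?y / real n - integral {?x..?y} f\<bar> \<le> r / 2 / real n" using xy(4) by simp
      moreover have "integral {0..?x} f + integral {?x..?y} f = integral {0..?y} f"
        by (rule Henstock_Kurzweil_Integration.integral_combine[OF xy(1,2) i1])
      moreover have "(\<Sum>k=1..Suc m. f (real k / real n)) / real n = (\<Sum>k=1..m. f (real k / real n)) / real n + f ?y / real n"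
        by (simp add: add_divide_distrib del: of_nat_Suc)
      moreover have "real (Suc m) * (r / 2) / real n = real m * (r / 2) / real n + r / 2 / real n"
        by (simp add: add_divide_distrib distrib_right)
      ultimately show ?case using Suc by linarith
    qed simp
    from this[OF order_refl] show ?thesis using n' by simp
  qed
  show "\<exists>no. \<forall>n\<ge>no. norm ((\<Sum>k=1..n. f (real k / real n)) / real n - integral {0..1} f) < r"
  proof (intro exI allI impI)
    fix n assume "n0 \<le> n"
    from main[OF this] r show "norm ((\<Sum>k=1..n. f (real k / real n)) / real n - integral {0..1} f) < r" by simp
  qed
qed

text \<open>Riemann sums for the indicator of \<open>{y..1}\<close>, which is not
  continuous.\<close>

lemma riemann_count_tendsto:
  assumes y: "y \<in> {0..1::real}"
  shows "(\<lambda>n. (\<Sum>k=1..n. of_bool (y \<le> real k / real n)) / real n) \<longlonglongrightarrow> 1 - y"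
proof -
  have b: "\<bar>(\<Sum>k=1..n. of_bool (y \<le> real k / real n)) / real n - (1 - y)\<bar> \<le> 1 / real n" if n: "1 \<le> n" for n
  proof -
    define m where "m = max 1 (nat \<lceil>real n * y\<rceil>)"
    have nn: "0 < real n" using n by simp
    have ny: "0 \<le> real n * y" "real n * y \<le> real n" using y nn by (auto simp: mult_le_cancel_left1)
    have m1: "real n * y \<le> real m" unfolding m_def using ny by linarith
    have m2: "real m \<le> real n * y + 1" unfolding m_def using ny by linarith
    have m3: "m \<le> n" unfolding m_def using ny n by (simp add: nat_le_iff ceiling_le_iff)
    have iff: "y \<le> real k / real n \<longleftrightarrow> m \<le> k" if "1 \<le> k" for k
    proof -
      have "y \<le> real k / real n \<longleftrightarrow> real n * y \<le> real k" using nn by (simp add: pos_le_divide_eq mult.commute)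
      also have "\<dots> \<longleftrightarrow> nat \<lceil>real n * y\<rceil> \<le> k" by (simp add: nat_le_iff ceiling_le_iff)
      finally show ?thesis using that by (simp add: m_def)
    qed
    have "(\<Sum>k=1..n. of_bool (y \<le> real k / real n) :: real) = (\<Sum>k=1..n. of_bool (m \<le> k))"
      by (intro sum.cong refl) (simp add: iff)
    also have "\<dots> = real (card {k\<in>{1..n}. m \<le> k})" by (simp add: of_bool_def sum.If_cases Int_def)
    also have "{k\<in>{1..n}. m \<le> k} = {m..n}" by (auto simp: m_def)
    finally have s: "(\<Sum>k=1..n. of_bool (y \<le> real k / real n) :: real) = real n + 1 - real m" using m3 by simp
    have "(real n + 1 - real m) / real n - (1 - y) = (real n * y + 1 - real m) / real n" using nn by (simp add: field_simps)
    moreover have "\<bar>(real n * y + 1 - real m) / real n\<bar> \<le> 1 / real n"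
      using m1 m2 nn by (simp add: divide_right_mono)
    ultimately show ?thesis unfolding s by simp
  qed
  have "(\<lambda>n. (\<Sum>k=1..n. of_bool (y \<le> real k / real n)) / real n - (1 - y)) \<longlonglongrightarrow> 0"
    by (rule Lim_null_comparison[OF _ lim_1_over_n]) (use b in \<open>auto intro!: eventually_sequentiallyI[of 1]\<close>)
  then show ?thesis by (simp add: LIM_zero_iff)
qed

lemma sum_cis_tendsto:
  fixes Z :: "nat \<Rightarrow> 'a \<Rightarrow> real"
  assumes M: "prob_space M" and Zn: "\<And>n. Z n \<in> borel_measurable M" and Z': "Z' \<in> borel_measurable M"
    and lim: "AE x in M. (\<lambda>n. Z n x) \<longlonglongrightarrow> Z' x"
  shows "(\<lambda>n. LINT x|M. cis (Z n x)) \<longlonglongrightarrow> (LINT x|M. cis (Z' x))"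
proof -
  interpret prob_space M by fact
  note [measurable] = Zn Z'
  show ?thesis
  proof (rule integral_dominated_convergence[where w = "\<lambda>_. 1"])
    show "AE x in M. (\<lambda>n. cis (Z n x)) \<longlonglongrightarrow> cis (Z' x)"
      using lim by eventually_elim (intro tendsto_cis)
  qed auto
qed

context
  fixes q :: real
  assumes q: "1 < q"
begin

lemma cstep_sum_sq:
  assumes "finite J" "J \<subseteq> {0..1}"
  shows "(LINT v|I01. (\<Sum>t\<in>J. c t * cstep q t v)\<^sup>2) = (q - 1) * (\<Sum>s\<in>J. \<Sum>t\<in>J. c s * c t * Kq q s t)"
proof -
  have i: "integrable I01 (\<lambda>v. cstep q s v * cstep q t v)" "(LINT v|I01. cstep q s v * cstep q t v) = (q - 1) * Kq q s t"
    if "s \<in> J" "t \<in> J" for s t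
    using cstep_inner[OF q subsetD[OF assms(2) that(1)] subsetD[OF assms(2) that(2)]] by auto
  have e: "(\<Sum>t\<in>J. c t * cstep q t v)\<^sup>2 = (\<Sum>s\<in>J. \<Sum>t\<in>J. c s * c t * (cstep q s v * cstep q t v))" for v
    unfolding power2_eq_square sum_product by (intro sum.cong refl) (simp add: mult_ac)
  have "(LINT v|I01. (\<Sum>t\<in>J. c t * cstep q t v)\<^sup>2) = (\<Sum>s\<in>J. \<Sum>t\<in>J. c s * c t * (LINT v|I01. cstep q s v * cstep q t v))"
    unfolding e using i(1) by simp
  also have "\<dots> = (q - 1) * (\<Sum>s\<in>J. \<Sum>t\<in>J. c s * c t * Kq q s t)"
    unfolding sum_distrib_left by (intro sum.cong refl) (simp add: i(2) mult_ac)
  finally show ?thesis .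
qed

text \<open>By continuity of the paths the time average of the process is a limit of Riemann sums,
  so a linear combination of values of the centered process is a pointwise limit of linear
  combinations of Wiener values. In the variance the Riemann sums become averages of indicators,
  which converge to \<open>1 - v^(1/(q-1))\<close>; dominated convergence on both sides gives the
  claim.\<close>

lemma
  fixes W :: "real \<Rightarrow> 'a \<Rightarrow> real"
  assumes W: "wiener_process M W" and \<gamma>: "1 + 2 * \<gamma> = q - 1"
  shows W_gamma_measurable: "\<And>t. t \<in> {0..1} \<Longrightarrow> W_gamma \<gamma> W t \<in> borel_measurable M"
    and W_gamma_cis: "\<And>J c. finite J \<Longrightarrow> J \<subseteq> {0..1} \<Longrightarrow>
      (LINT x|M. cis (\<Sum>t\<in>J. c t * W_gamma \<gamma> W t x)) = of_real (exp (- (\<Sum>s\<in>J. \<Sum>t\<in>J. c s * c t * Kq q s t) / 2))"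
proof -
  interpret prob_space M using W by (simp add: wiener_process_def)
  let ?a = "q - 1"
  define \<kappa> where "\<kappa> = 1 / sqrt ?a"
  define I where "I x = (LINT u|I01. W (u powr ?a) x)" for x
  define R where "R n x = (\<Sum>k=1..n. W ((real k / real n) powr ?a) x) / real n" for n x
  have Wm [measurable]: "W (t powr ?a) \<in> borel_measurable M" for t
  proof -
    have "\<forall>t\<ge>0. W t \<in> borel_measurable M" using W unfolding wiener_process_def by (elim conjE)
    then show ?thesis by simp
  qed
  have Rm [measurable]: "R n \<in> borel_measurable M" for n unfolding R_def by measurable
  have RI: "(\<lambda>n. R n x) \<longlonglongrightarrow> I x" if x: "x \<in> space M" for x
  proof -
    have "\<forall>\<omega>\<in>space M. continuous_on {0..} (\<lambda>t. W t \<omega>)" using W unfolding wiener_process_def by (elim conjE)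
    then have Wc: "continuous_on {0..} (\<lambda>t. W t x)" using x by blast
    have "continuous_on {0..1} (\<lambda>u. u powr ?a)" by (rule continuous_on_powr_q1[OF q])
    then have c: "continuous_on {0..1} (\<lambda>u. W (u powr ?a) x)"
      by (rule continuous_on_compose2[OF Wc]) auto
    have "I x = integral {0..1} (\<lambda>u. W (u powr ?a) x)"
      unfolding I_def by (rule integral_unique[OF I01_continuous(2)[OF c], symmetric])
    then show ?thesis unfolding R_def using riemann_sum_tendsto[OF c] by simp
  qed
  have Im [measurable]: "I \<in> borel_measurable M" by (rule borel_measurable_LIMSEQ_metric[OF Rm RI])
  have Wg: "W_gamma \<gamma> W t x = \<kappa> * (W (t powr ?a) x - I x)" for t x
    unfolding W_gamma_def \<gamma> \<kappa>_def I_def ..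
  show "W_gamma \<gamma> W t \<in> borel_measurable M" for t unfolding Wg[abs_def] by measurable
  fix J :: "real set" and c :: "real \<Rightarrow> real" assume J: "finite J" "J \<subseteq> {0..1}"
  define d where "d = (\<Sum>t\<in>J. c t)"
  define Z where "Z n x = (\<Sum>t\<in>J. \<kappa> * c t * W (t powr ?a) x) - \<kappa> * d * R n x" for n x
  define Z' where "Z' x = (\<Sum>t\<in>J. c t * W_gamma \<gamma> W t x)" for x
  define h where "h n v = (\<Sum>t\<in>J. \<kappa> * c t * of_bool (v \<le> t powr ?a)) - \<kappa> * d * ((\<Sum>k=1..n. of_bool (v \<le> (real k / real n) powr ?a)) / real n)" for n v
  define h' where "h' v = \<kappa> * (\<Sum>t\<in>J. c t * cstep q t v)" for v
  have Z'_eq: "Z' x = (\<Sum>t\<in>J. \<kappa> * c t * W (t powr ?a) x) - \<kappa> * d * I x" for x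
    unfolding Z'_def Wg d_def by (simp add: algebra_simps sum_subtractf sum_distrib_left sum_distrib_right)
  have h'_eq: "h' v = (\<Sum>t\<in>J. \<kappa> * c t * of_bool (v \<le> t powr ?a)) - \<kappa> * d * (1 - v powr (1 / ?a))" for v
    unfolding h'_def cstep_def d_def by (simp add: algebra_simps sum_subtractf sum.distrib sum_distrib_left sum_distrib_right)
  have char_n: "(LINT x|M. cis (Z n x)) = of_real (exp (- (LINT v|I01. (h n v)\<^sup>2) / 2))" for n
  proof -
    let ?S = "J <+> {1..n}"
    \<comment> \<open>left summands index the given times, right summands the points of the Riemann sum\<close>
    define \<tau> where "\<tau> i = (case i of Inl t \<Rightarrow> t powr ?a | Inr k \<Rightarrow> (real k / real n) powr ?a)" for i :: "real + nat"
    define e where "e i = (case i of Inl t \<Rightarrow> \<kappa> * c t | Inr k \<Rightarrow> - \<kappa> * d / real n)" for i :: "real + nat"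
    have s: "(\<Sum>i\<in>?S. e i * f (\<tau> i)) = (\<Sum>t\<in>J. \<kappa> * c t * f (t powr ?a)) - \<kappa> * d * ((\<Sum>k=1..n. f ((real k / real n) powr ?a)) / real n)" for f :: "real \<Rightarrow> real"
      using J(1) by (simp add: sum.Plus o_def e_def \<tau>_def sum_distrib_left sum_divide_distrib sum_negf)
    have \<tau>01: "\<tau> i \<in> {0..1}" if i: "i \<in> ?S" for i
    proof (cases i)
      case (Inl t)
      then show ?thesis using i J(2) powr_q1_01[OF q, of t] by (auto simp: \<tau>_def)
    next
      case (Inr k)
      then have "real k / real n \<in> {0..1}" using i by (auto simp: divide_le_eq_1)
      then show ?thesis using Inr powr_q1_01[OF q] by (simp add: \<tau>_def)
    qed
    have fin: "finite ?S" using J(1) by simp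
    from wiener_cis[where I = ?S and \<tau> = \<tau> and c = e, OF W fin \<tau>01]
    show ?thesis
      unfolding s[of "\<lambda>s. W s x" for x] s[of "\<lambda>s. of_bool (v \<le> s)" for v] Z_def h_def R_def .
  qed
  have [measurable]: "Z n \<in> borel_measurable M" "Z' \<in> borel_measurable M" for n
    unfolding Z_def Z'_eq[abs_def] by measurable
  have "(\<lambda>n. LINT x|M. cis (Z n x)) \<longlonglongrightarrow> (LINT x|M. cis (Z' x))"
  proof (rule sum_cis_tendsto)
    show "AE x in M. (\<lambda>n. Z n x) \<longlonglongrightarrow> Z' x"
    proof (rule AE_I2)
      fix x assume "x \<in> space M"
      from RI[OF this] show "(\<lambda>n. Z n x) \<longlonglongrightarrow> Z' x"
        unfolding Z_def Z'_eq by (intro tendsto_diff tendsto_mult tendsto_const)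
    qed
  qed (simp_all add: prob_space_axioms)
  moreover have "(\<lambda>n. LINT v|I01. (h n v)\<^sup>2) \<longlonglongrightarrow> (LINT v|I01. (h' v)\<^sup>2)"
  proof (rule integral_dominated_convergence[where w = "\<lambda>_. ((\<Sum>t\<in>J. \<bar>\<kappa> * c t\<bar>) + \<bar>\<kappa> * d\<bar>)\<^sup>2"])
    interpret I: prob_space I01 by (rule prob_space_I01)
    show "integrable I01 (\<lambda>_. ((\<Sum>t\<in>J. \<bar>\<kappa> * c t\<bar>) + \<bar>\<kappa> * d\<bar>)\<^sup>2)" by simp
    have ob: "(\<lambda>v. of_bool (v \<le> y) :: real) \<in> borel_measurable I01" for y
      by (rule measurable_restrict_space1) measurable
    show "(\<lambda>v. (h n v)\<^sup>2) \<in> borel_measurable I01" for n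
      unfolding h_def by (intro borel_measurable_power borel_measurable_diff borel_measurable_sum borel_measurable_times
        borel_measurable_divide borel_measurable_const ob)
    have po: "(\<lambda>v::real. v powr (1 / ?a)) \<in> borel_measurable I01" by (rule measurable_restrict_space1) measurable
    show "(\<lambda>v. (h' v)\<^sup>2) \<in> borel_measurable I01"
      unfolding h'_eq by (intro borel_measurable_power borel_measurable_diff borel_measurable_sum borel_measurable_times
        borel_measurable_const ob po)
    show "AE v in I01. (\<lambda>n. (h n v)\<^sup>2) \<longlonglongrightarrow> (h' v)\<^sup>2"
    proof (rule AE_I2)
      fix v assume "v \<in> space I01"
      then have v: "v \<in> {0..1}" by simp
      have iff: "v \<le> (real k / real n) powr ?a \<longleftrightarrow> v powr (1 / ?a) \<le> real k / real n" for k n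
      proof -
        have k: "((real k / real n) powr ?a) powr (1 / ?a) = real k / real n" by (rule powr_inverse_q1[OF q]) simp
        have v': "(v powr (1 / ?a)) powr ?a = v" using v q by (simp add: powr_powr)
        show ?thesis
        proof
          assume "v \<le> (real k / real n) powr ?a"
          from powr_mono2[OF _ _ this, of "1 / ?a"] v q show "v powr (1 / ?a) \<le> real k / real n" unfolding k by simp
        next
          assume "v powr (1 / ?a) \<le> real k / real n"
          from powr_mono2[OF _ _ this, of ?a] v q show "v \<le> (real k / real n) powr ?a" unfolding v' by simp
        qed
      qed
      have "(\<lambda>n. (\<Sum>k=1..n. of_bool (v \<le> (real k / real n) powr ?a)) / real n) \<longlonglongrightarrow> 1 - v powr (1 / ?a)"
        unfolding iff by (rule riemann_count_tendsto[OF root_01[OF q v]])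
      then show "(\<lambda>n. (h n v)\<^sup>2) \<longlonglongrightarrow> (h' v)\<^sup>2"
        unfolding h_def h'_eq by (intro tendsto_power tendsto_diff tendsto_mult tendsto_const)
    qed
    show "AE v in I01. norm ((h n v)\<^sup>2) \<le> ((\<Sum>t\<in>J. \<bar>\<kappa> * c t\<bar>) + \<bar>\<kappa> * d\<bar>)\<^sup>2" for n
    proof (rule AE_I2)
      fix v
      have "\<bar>h n v\<bar> \<le> \<bar>\<Sum>t\<in>J. \<kappa> * c t * of_bool (v \<le> t powr ?a)\<bar> + \<bar>\<kappa> * d * ((\<Sum>k=1..n. of_bool (v \<le> (real k / real n) powr ?a)) / real n)\<bar>"
        unfolding h_def by (rule abs_triangle_ineq4)
      also have "\<dots> \<le> (\<Sum>t\<in>J. \<bar>\<kappa> * c t\<bar>) + \<bar>\<kappa> * d\<bar> * 1"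
      proof (rule add_mono)
        have "\<bar>\<Sum>t\<in>J. \<kappa> * c t * of_bool (v \<le> t powr ?a)\<bar> \<le> (\<Sum>t\<in>J. \<bar>\<kappa> * c t * of_bool (v \<le> t powr ?a)\<bar>)" by (rule sum_abs)
        also have "\<dots> \<le> (\<Sum>t\<in>J. \<bar>\<kappa> * c t\<bar>)" by (rule sum_mono) (simp add: of_bool_def)
        finally show "\<bar>\<Sum>t\<in>J. \<kappa> * c t * of_bool (v \<le> t powr ?a)\<bar> \<le> (\<Sum>t\<in>J. \<bar>\<kappa> * c t\<bar>)" .
        have "(\<Sum>k=1..n. of_bool (v \<le> (real k / real n) powr ?a) :: real) \<le> (\<Sum>k=1..n. 1)" by (rule sum_mono) (simp add: of_bool_def)
        then have "(\<Sum>k=1..n. of_bool (v \<le> (real k / real n) powr ?a) :: real) \<le> real n" by simp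
        then have u: "(\<Sum>k=1..n. of_bool (v \<le> (real k / real n) powr ?a) :: real) / real n \<le> 1" by (cases "n = 0") (simp_all add: divide_le_eq_1)
        have "0 \<le> (\<Sum>k=1..n. of_bool (v \<le> (real k / real n) powr ?a) :: real) / real n" by (intro divide_nonneg_nonneg sum_nonneg) auto
        with u show "\<bar>\<kappa> * d * ((\<Sum>k=1..n. of_bool (v \<le> (real k / real n) powr ?a)) / real n)\<bar> \<le> \<bar>\<kappa> * d\<bar> * 1"
          unfolding abs_mult[of "\<kappa> * d"] by (intro mult_left_mono) auto
      qed
      finally have "\<bar>h n v\<bar>\<^sup>2 \<le> ((\<Sum>t\<in>J. \<bar>\<kappa> * c t\<bar>) + \<bar>\<kappa> * d\<bar>)\<^sup>2" by (intro power_mono) auto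
      then show "norm ((h n v)\<^sup>2) \<le> ((\<Sum>t\<in>J. \<bar>\<kappa> * c t\<bar>) + \<bar>\<kappa> * d\<bar>)\<^sup>2" by simp
    qed
  qed
  then have "(\<lambda>n. LINT x|M. cis (Z n x)) \<longlonglongrightarrow> of_real (exp (- (LINT v|I01. (h' v)\<^sup>2) / 2))"
    unfolding char_n by (intro tendsto_of_real tendsto_exp tendsto_divide tendsto_minus tendsto_const) auto
  ultimately have "(LINT x|M. cis (Z' x)) = of_real (exp (- (LINT v|I01. (h' v)\<^sup>2) / 2))"
    by (rule LIMSEQ_unique)
  also have "(LINT v|I01. (h' v)\<^sup>2) = \<kappa>\<^sup>2 * (LINT v|I01. (\<Sum>t\<in>J. c t * cstep q t v)\<^sup>2)"
    unfolding h'_def by (simp add: power_mult_distrib)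
  also have "\<dots> = (\<Sum>s\<in>J. \<Sum>t\<in>J. c s * c t * Kq q s t)"
    unfolding cstep_sum_sq[OF J] \<kappa>_def using q by (simp add: power_divide)
  finally show "(LINT x|M. cis (\<Sum>t\<in>J. c t * W_gamma \<gamma> W t x)) = of_real (exp (- (\<Sum>s\<in>J. \<Sum>t\<in>J. c s * c t * Kq q s t) / 2))"
    unfolding Z'_def .
qed

lemma Kq_quadratic_nonneg:
  assumes "finite J" "J \<subseteq> {0..1}"
  shows "0 \<le> (\<Sum>s\<in>J. \<Sum>t\<in>J. c s * c t * Kq q s t)"
proof -
  have "0 \<le> (LINT v|I01. (\<Sum>t\<in>J. c t * cstep q t v)\<^sup>2)" by simp
  then show ?thesis unfolding cstep_sum_sq[OF assms] using q by (simp add: zero_le_mult_iff)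
qed

lemma W_gamma_gaussian:
  fixes c :: "real \<Rightarrow> real"
  assumes W: "wiener_process M W" and \<gamma>: "1 + 2 * \<gamma> = q - 1" and J: "finite J" "J \<subseteq> {0..1}"
  defines "V \<equiv> \<Sum>s\<in>J. \<Sum>t\<in>J. c s * c t * Kq q s t"
  shows "distr M borel (\<lambda>\<omega>. \<Sum>t\<in>J. c t * W_gamma \<gamma> W t \<omega>) =
      (if sqrt V = 0 then return borel 0 else density lborel (\<lambda>x. ennreal (normal_density 0 (sqrt V) x)))"
    "integrable M (\<lambda>\<omega>. (\<Sum>t\<in>J. c t * W_gamma \<gamma> W t \<omega>)\<^sup>2)"
    "(LINT \<omega>|M. (\<Sum>t\<in>J. c t * W_gamma \<gamma> W t \<omega>)\<^sup>2) = V"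
proof -
  have M: "prob_space M" using W by (simp add: wiener_process_def)
  have m: "(\<lambda>\<omega>. \<Sum>t\<in>J. c t * W_gamma \<gamma> W t \<omega>) \<in> borel_measurable M"
    by (intro borel_measurable_sum borel_measurable_times borel_measurable_const W_gamma_measurable[OF W \<gamma>]) (use J in auto)
  have V: "0 \<le> V" unfolding V_def by (rule Kq_quadratic_nonneg[OF J])
  have ch: "(LINT \<omega>|M. cis (u * (\<Sum>t\<in>J. c t * W_gamma \<gamma> W t \<omega>))) = of_real (exp (- (u\<^sup>2 * V) / 2))" for u
  proof -
    have "(\<Sum>s\<in>J. \<Sum>t\<in>J. u * c s * (u * c t) * Kq q s t) = u\<^sup>2 * V"
      unfolding V_def sum_distrib_left by (intro sum.cong refl) (simp add: power2_eq_square)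
    with W_gamma_cis[OF W \<gamma> J, of "\<lambda>t. u * c t"] show ?thesis by (simp add: sum_distrib_left mult.assoc)
  qed
  from gaussian_of_char[OF M m V ch]
  show "distr M borel (\<lambda>\<omega>. \<Sum>t\<in>J. c t * W_gamma \<gamma> W t \<omega>) =
      (if sqrt V = 0 then return borel 0 else density lborel (\<lambda>x. ennreal (normal_density 0 (sqrt V) x)))"
    "integrable M (\<lambda>\<omega>. (\<Sum>t\<in>J. c t * W_gamma \<gamma> W t \<omega>)\<^sup>2)"
    "(LINT \<omega>|M. (\<Sum>t\<in>J. c t * W_gamma \<gamma> W t \<omega>)\<^sup>2) = V" .
qed

lemma W_gamma_covariance:
  assumes W: "wiener_process M W" and \<gamma>: "1 + 2 * \<gamma> = q - 1" and s: "s \<in> {0..1}" and t: "t \<in> {0..1}"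
  shows "covariance M (W_gamma \<gamma> W) s t = Kq q s t"
proof -
  let ?X = "W_gamma \<gamma> W"
  have sq: "integrable M (\<lambda>\<omega>. (?X t \<omega>)\<^sup>2)" "(LINT \<omega>|M. (?X t \<omega>)\<^sup>2) = Kq q t t" if "t \<in> {0..1}" for t
    using W_gamma_gaussian(2,3)[OF W \<gamma>, of "{t}" "\<lambda>_. 1"] that by simp_all
  show ?thesis
  proof (cases "s = t")
    case True
    then show ?thesis using sq(2)[OF t] by (simp add: covariance_def power2_eq_square)
  next
    case False
    have st: "integrable M (\<lambda>\<omega>. (?X s \<omega> + ?X t \<omega>)\<^sup>2)" "(LINT \<omega>|M. (?X s \<omega> + ?X t \<omega>)\<^sup>2) = Kq q s s + 2 * Kq q s t + Kq q t t"
      using W_gamma_gaussian(2,3)[OF W \<gamma>, of "{s, t}" "\<lambda>_. 1"] s t False Kq_commute[of q t s] by simp_all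
    have e: "?X s \<omega> * ?X t \<omega> = ((?X s \<omega> + ?X t \<omega>)\<^sup>2 - (?X s \<omega>)\<^sup>2 - (?X t \<omega>)\<^sup>2) / 2" for \<omega>
      by (simp add: power2_eq_square algebra_simps)
    show ?thesis unfolding covariance_def e using st sq[OF s] sq[OF t] by simp
  qed
qed

end

section \<open>Convergence of the random series\<close>

lemma
  fixes \<xi> :: "nat \<Rightarrow> 'b \<Rightarrow> real"
  assumes iid: "iid_std_normal N \<xi>"
  shows iid_measurable: "\<And>k. 1 \<le> k \<Longrightarrow> \<xi> k \<in> borel_measurable N"
    and iid_cis: "\<And>B b. finite B \<Longrightarrow> B \<subseteq> {1..} \<Longrightarrow>
      (LINT x|N. cis (\<Sum>k\<in>B. b k * \<xi> k x)) = of_real (exp (- (\<Sum>k\<in>B. (b k)\<^sup>2) / 2))"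
proof -
  have P: "prob_space N" and ind: "prob_space.indep_vars N (\<lambda>_. borel) \<xi> {1..}"
    and dist: "\<forall>k\<ge>1. distributed N lborel (\<xi> k) (\<lambda>x. ennreal (std_normal_density x))"
    using iid unfolding iid_std_normal_def by blast+
  interpret prob_space N by (rule P)
  show m: "\<xi> k \<in> borel_measurable N" if "1 \<le> k" for k
    using distributed_measurable[of N lborel "\<xi> k"] dist that by force
  fix B :: "nat set" and b :: "nat \<Rightarrow> real" assume B: "finite B" "B \<subseteq> {1..}"
  have mB: "(\<lambda>x. b k * \<xi> k x) \<in> borel_measurable N" if "k \<in> B" for k
    using m[of k] B that by (intro borel_measurable_times borel_measurable_const) auto
  have "(LINT x|N. cis (\<Sum>k\<in>B. b k * \<xi> k x)) = char (distr N borel (\<lambda>x. \<Sum>k\<in>B. b k * \<xi> k x)) 1"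
    unfolding char_eq_cis by (subst integral_distr) (auto intro!: borel_measurable_sum mB)
  also have "\<dots> = (\<Prod>k\<in>B. char (distr N borel (\<lambda>x. b k * \<xi> k x)) 1)"
    by (rule char_distr_sum, rule indep_vars_compose2[OF indep_vars_subset[OF ind B(2)], where Y = "\<lambda>k x. b k * x"]) auto
  also have "\<dots> = (\<Prod>k\<in>B. of_real (exp (- (b k)\<^sup>2 / 2)))"
  proof (rule prod.cong[OF refl])
    fix k assume k: "k \<in> B"
    have "distributed N lborel (\<xi> k) (\<lambda>x. ennreal (normal_density 0 1 x))" using dist k B by auto
    from integral_cis_normal[OF this, of "b k"]
    show "char (distr N borel (\<lambda>x. b k * \<xi> k x)) 1 = of_real (exp (- (b k)\<^sup>2 / 2))"
      unfolding char_eq_cis by (subst integral_distr) (use mB[OF k] in auto)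
  qed
  also have "\<dots> = of_real (exp (- (\<Sum>k\<in>B. (b k)\<^sup>2) / 2))"
  proof -
    have "(\<Sum>k\<in>B. - (b k)\<^sup>2 / 2) = - (\<Sum>k\<in>B. (b k)\<^sup>2) / 2" by (simp add: sum_negf sum_divide_distrib)
    from arg_cong[OF this, of exp] show ?thesis
      unfolding of_real_prod[symmetric] by (simp only: exp_sum[OF B(1)])
  qed
  finally show "(LINT x|N. cis (\<Sum>k\<in>B. b k * \<xi> k x)) = of_real (exp (- (\<Sum>k\<in>B. (b k)\<^sup>2) / 2))" .
qed

text \<open>Read off from the characteristic function of the linear combination, which is that of
  a centered normal law.\<close>

lemma iid_second_moment:
  assumes iid: "iid_std_normal N \<xi>" and B: "finite B" "B \<subseteq> {1..}"
  shows "(\<integral>\<^sup>+x. ennreal ((\<Sum>k\<in>B. b k * \<xi> k x)\<^sup>2) \<partial>N) = ennreal (\<Sum>k\<in>B. (b k)\<^sup>2)"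
proof -
  have P: "prob_space N" using iid by (simp add: iid_std_normal_def)
  have m: "(\<lambda>x. \<Sum>k\<in>B. b k * \<xi> k x) \<in> borel_measurable N"
    by (intro borel_measurable_sum borel_measurable_times borel_measurable_const iid_measurable[OF iid]) (use B in auto)
  have V: "0 \<le> (\<Sum>k\<in>B. (b k)\<^sup>2)" by (intro sum_nonneg) simp
  have ch: "(LINT x|N. cis (u * (\<Sum>k\<in>B. b k * \<xi> k x))) = of_real (exp (- (u\<^sup>2 * (\<Sum>k\<in>B. (b k)\<^sup>2)) / 2))" for u
    using iid_cis[OF iid B, of "\<lambda>k. u * b k"] by (simp add: sum_distrib_left mult.assoc power_mult_distrib)
  note g = gaussian_of_char(2,3)[OF P m V ch]
  show ?thesis by (subst nn_integral_eq_integral[OF g(1)]) (simp_all add: g(2))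
qed

lemma convergent_of_summable_differences:
  fixes f :: "nat \<Rightarrow> real"
  assumes "summable (\<lambda>j. \<bar>f (Suc j) - f j\<bar>)"
  shows "convergent f"
proof -
  have "summable (\<lambda>j. f (Suc j) - f j)" using assms by (rule summable_rabs_cancel)
  then have "(\<lambda>n. \<Sum>j<n. f (Suc j) - f j) \<longlonglongrightarrow> (\<Sum>j. f (Suc j) - f j)" by (rule summable_LIMSEQ)
  from tendsto_add[OF this tendsto_const[of "f 0"]]
  have "f \<longlonglongrightarrow> (\<Sum>j. f (Suc j) - f j) + f 0" by (simp add: sum_lessThan_telescope)
  then show ?thesis by (rule convergentI)
qed

text \<open>The expectations of the absolute increments are summable, so the sum of the increments
  is finite almost everywhere.\<close>

lemma L2_fast_cauchy_AE_convergent: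
  fixes X :: "nat \<Rightarrow> 'b \<Rightarrow> real"
  assumes P: "prob_space N" and X: "\<And>j. X j \<in> borel_measurable N"
    and le: "\<And>j. (\<integral>\<^sup>+x. ennreal ((X (Suc j) x - X j x)\<^sup>2) \<partial>N) \<le> ennreal ((1 / 4) ^ j)"
  shows "AE x in N. convergent (\<lambda>j. X j x)"
proof -
  interpret prob_space N by fact
  note [measurable] = X
  have d: "(\<integral>\<^sup>+x. ennreal \<bar>X (Suc j) x - X j x\<bar> \<partial>N) \<le> ennreal ((1 / 2) ^ j)" for j
  proof -
    let ?d = "\<lambda>x. X (Suc j) x - X j x"
    \<comment> \<open>the weights are chosen so that a second moment of at most \<open>4^(-j)\<close> gives a first moment of at most \<open>2^(-j)\<close>\<close>
    have am: "\<bar>y\<bar> \<le> (1 / 2) ^ j / 2 + 2 ^ j / 2 * y\<^sup>2" for y :: real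
    proof -
      have "0 \<le> ((1 / 2) ^ j - \<bar>y\<bar>)\<^sup>2 * 2 ^ j" by simp
      also have "\<dots> = (1 / 2) ^ j * ((1 / 2) ^ j * 2 ^ j) - 2 * \<bar>y\<bar> * ((1 / 2) ^ j * 2 ^ j) + y\<^sup>2 * 2 ^ j"
        by (simp add: power2_eq_square algebra_simps)
      also have "(1 / 2 :: real) ^ j * 2 ^ j = 1" by (simp flip: power_mult_distrib)
      finally show ?thesis by (simp add: field_simps)
    qed
    have "(\<integral>\<^sup>+x. ennreal \<bar>?d x\<bar> \<partial>N) \<le> (\<integral>\<^sup>+x. ennreal ((1 / 2) ^ j / 2) + ennreal (2 ^ j / 2) * ennreal ((?d x)\<^sup>2) \<partial>N)"
      using am by (intro nn_integral_mono) (auto simp: ennreal_mult[symmetric] simp flip: ennreal_plus intro!: ennreal_leI)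
    also have "\<dots> = ennreal ((1 / 2) ^ j / 2) + ennreal (2 ^ j / 2) * (\<integral>\<^sup>+x. ennreal ((?d x)\<^sup>2) \<partial>N)"
      by (subst nn_integral_add; (subst nn_integral_cmult)?) (auto simp: emeasure_space_1)
    also have "\<dots> \<le> ennreal ((1 / 2) ^ j / 2) + ennreal (2 ^ j / 2) * ennreal ((1 / 4) ^ j)"
      by (intro add_left_mono mult_left_mono le) simp
    also have "\<dots> = ennreal ((1 / 2) ^ j / 2 + 2 ^ j / 2 * (1 / 4) ^ j)"
      by (simp add: ennreal_mult[symmetric] flip: ennreal_plus)
    also have "(1 / 2) ^ j / 2 + 2 ^ j / 2 * (1 / 4) ^ j = (1 / 2 :: real) ^ j"
    proof -
      have "(2 :: real) ^ j * (1 / 4) ^ j = (1 / 2) ^ j" by (simp flip: power_mult_distrib)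
      then show ?thesis by simp
    qed
    finally show ?thesis .
  qed
  have "(\<integral>\<^sup>+x. (\<Sum>j. ennreal \<bar>X (Suc j) x - X j x\<bar>) \<partial>N) = (\<Sum>j. \<integral>\<^sup>+x. ennreal \<bar>X (Suc j) x - X j x\<bar> \<partial>N)"
    by (rule nn_integral_suminf) measurable
  also have "\<dots> \<le> (\<Sum>j. ennreal ((1 / 2) ^ j))" by (intro suminf_le d) auto
  also have "\<dots> = ennreal (\<Sum>j. (1 / 2) ^ j)" by (rule suminf_ennreal2) auto
  finally have "(\<integral>\<^sup>+x. (\<Sum>j. ennreal \<bar>X (Suc j) x - X j x\<bar>) \<partial>N) \<noteq> \<infinity>"
    by (auto simp: top_unique)
  then have "AE x in N. (\<Sum>j. ennreal \<bar>X (Suc j) x - X j x\<bar>) \<noteq> \<infinity>"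
    by (intro nn_integral_PInf_AE) measurable
  then show ?thesis
  proof eventually_elim
    case (elim x)
    then have "summable (\<lambda>j. \<bar>X (Suc j) x - X j x\<bar>)"
      by (intro summable_suminf_not_top) auto
    then show ?case by (rule convergent_of_summable_differences)
  qed
qed

definition series_sum :: "real \<Rightarrow> (nat \<Rightarrow> 'b \<Rightarrow> real) \<Rightarrow> nat \<Rightarrow> real \<Rightarrow> 'b \<Rightarrow> real" where
  "series_sum q \<xi> n t x = (\<Sum>k=1..n. scaled_e q k t * \<xi> k x)"

context
  fixes q :: real
  assumes q: "1 < q"
begin

lemma series_sum_measurable: "iid_std_normal N \<xi> \<Longrightarrow> series_sum q \<xi> n t \<in> borel_measurable N"
  unfolding series_sum_def[abs_def]
  by (intro borel_measurable_sum borel_measurable_times borel_measurable_const iid_measurable) auto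

text \<open>The second moment of a block of the series is the sum of the squared coefficients,
  hence a difference of two Mercer remainders.\<close>

lemma series_sum_diff_sq:
  assumes iid: "iid_std_normal N \<xi>" and mn: "m \<le> n" and t: "t \<in> {0..1}"
  shows "(\<integral>\<^sup>+x. ennreal ((series_sum q \<xi> n t x - series_sum q \<xi> m t x)\<^sup>2) \<partial>N) \<le> ennreal (mercer_rem q m t)"
proof -
  have split: "(\<Sum>k=1..n. g k) = (\<Sum>k=1..m. g k) + (\<Sum>k\<in>{m<..n}. g k)" for g :: "nat \<Rightarrow> real"
  proof -
    have "{1..n} = {1..m} \<union> {m<..n}" using mn by auto
    then show ?thesis by (simp only:) (rule sum.union_disjoint; auto)
  qed
  have "(\<integral>\<^sup>+x. ennreal ((series_sum q \<xi> n t x - series_sum q \<xi> m t x)\<^sup>2) \<partial>N) = (\<integral>\<^sup>+x. ennreal ((\<Sum>k\<in>{m<..n}. scaled_e q k t * \<xi> k x)\<^sup>2) \<partial>N)"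
    unfolding series_sum_def split by simp
  also have "\<dots> = ennreal (\<Sum>k\<in>{m<..n}. (scaled_e q k t)\<^sup>2)" by (rule iid_second_moment[OF iid]) auto
  also have "(\<Sum>k\<in>{m<..n}. (scaled_e q k t)\<^sup>2) \<le> mercer_rem q m t"
    using mercer_rem_nonneg[OF q t, of n] unfolding mercer_rem_def split by simp
  finally show ?thesis by (simp add: ennreal_leI)
qed

text \<open>One subsequence serves all \<open>t\<close>, because the remainder tends to 0
  uniformly.\<close>

lemma fast_subsequence:
  obtains r where "mono r" "filterlim r at_top sequentially"
    "\<And>j t. t \<in> {0..1} \<Longrightarrow> mercer_rem q (r j) t \<le> (1 / 4) ^ j"
proof -
  have "\<forall>j. \<exists>n0. \<forall>n\<ge>n0. \<forall>t\<in>{0..1}. mercer_rem q n t \<le> (1 / 4) ^ j"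
    by (intro allI mercer_rem_uniform_tendsto[OF q]) simp
  then obtain n0 where n0: "\<And>j n t. n0 j \<le> n \<Longrightarrow> t \<in> {0..1} \<Longrightarrow> mercer_rem q n t \<le> (1 / 4) ^ j" by metis
  \<comment> \<open>partial sums exceed every summand and increase strictly\<close>
  define r where "r j = (\<Sum>i\<le>j. Suc (n0 i))" for j
  have "strict_mono r" unfolding strict_mono_Suc_iff r_def by simp
  moreover have "n0 j \<le> r j" for j
    unfolding r_def by (rule order_trans[OF _ member_le_sum[of j "{..j}" "\<lambda>i. Suc (n0 i)"]]) auto
  ultimately show ?thesis
    using that[of r] n0 by (simp add: strict_mono_mono filterlim_subseq)
qed

text \<open>The limit \<open>Y\<close> is taken pointwise along the fast subsequence. Fatou's
  lemma turns the Cauchy estimate into an estimate for \<open>Y\<close> and the full sequence, and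
  the characteristic functions of the Gaussian partial sums pass to the limit.\<close>

lemma series_limit:
  assumes iid: "iid_std_normal N (\<xi> :: nat \<Rightarrow> 'b \<Rightarrow> real)"
  shows "\<exists>Y. (\<forall>t\<in>{0..1}. Y t \<in> borel_measurable N) \<and>
    (\<forall>n. \<forall>t\<in>{0..1}. (\<integral>\<^sup>+x. ennreal ((series_sum q \<xi> n t x - Y t x)\<^sup>2) \<partial>N) \<le> ennreal (mercer_rem q n t)) \<and>
    (\<forall>J c. finite J \<longrightarrow> J \<subseteq> {0..1} \<longrightarrow>
      (LINT x|N. cis (\<Sum>t\<in>J. c t * Y t x)) = of_real (exp (- (\<Sum>s\<in>J. \<Sum>t\<in>J. c s * c t * Kq q s t) / 2)))"
proof -
  have P: "prob_space N" using iid by (simp add: iid_std_normal_def)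
  interpret prob_space N by (rule P)
  obtain r where r: "mono r" "filterlim r at_top sequentially"
    "\<And>j t. t \<in> {0..1} \<Longrightarrow> mercer_rem q (r j) t \<le> (1 / 4) ^ j"
    using fast_subsequence by blast
  note Sm [measurable] = series_sum_measurable[OF iid]
  define Y where "Y t x = lim (\<lambda>j. series_sum q \<xi> (r j) t x)" for t x
  have Ym [measurable]: "Y t \<in> borel_measurable N" for t
    unfolding Y_def[abs_def] by (rule borel_measurable_lim_metric) (rule Sm)
  have conv: "AE x in N. (\<lambda>j. series_sum q \<xi> (r j) t x) \<longlonglongrightarrow> Y t x" if t: "t \<in> {0..1}" for t
  proof -
    have "AE x in N. convergent (\<lambda>j. series_sum q \<xi> (r j) t x)"
    proof (rule L2_fast_cauchy_AE_convergent[OF P Sm])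
      fix j
      have "(\<integral>\<^sup>+x. ennreal ((series_sum q \<xi> (r (Suc j)) t x - series_sum q \<xi> (r j) t x)\<^sup>2) \<partial>N) \<le> ennreal (mercer_rem q (r j) t)"
        by (rule series_sum_diff_sq[OF iid monoD[OF r(1)] t]) simp
      also have "\<dots> \<le> ennreal ((1 / 4) ^ j)" by (rule ennreal_leI[OF r(3)[OF t]])
      finally show "(\<integral>\<^sup>+x. ennreal ((series_sum q \<xi> (r (Suc j)) t x - series_sum q \<xi> (r j) t x)\<^sup>2) \<partial>N) \<le> ennreal ((1 / 4) ^ j)" .
    qed
    then show ?thesis by eventually_elim (simp add: Y_def convergent_LIMSEQ_iff)
  qed
  have sq: "(\<integral>\<^sup>+x. ennreal ((series_sum q \<xi> n t x - Y t x)\<^sup>2) \<partial>N) \<le> ennreal (mercer_rem q n t)" if t: "t \<in> {0..1}" for n t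
  proof -
    let ?u = "\<lambda>j x. ennreal ((series_sum q \<xi> (r j) t x - series_sum q \<xi> n t x)\<^sup>2)"
    have "(\<integral>\<^sup>+x. ennreal ((series_sum q \<xi> n t x - Y t x)\<^sup>2) \<partial>N) = (\<integral>\<^sup>+x. liminf (\<lambda>j. ?u j x) \<partial>N)"
    proof (rule nn_integral_cong_AE)
      show "AE x in N. ennreal ((series_sum q \<xi> n t x - Y t x)\<^sup>2) = liminf (\<lambda>j. ?u j x)"
        using conv[OF t]
      proof eventually_elim
        case (elim x)
        then have "(\<lambda>j. ?u j x) \<longlonglongrightarrow> ennreal ((Y t x - series_sum q \<xi> n t x)\<^sup>2)"
          by (intro tendsto_ennrealI tendsto_power tendsto_diff tendsto_const)
        then have "liminf (\<lambda>j. ?u j x) = ennreal ((Y t x - series_sum q \<xi> n t x)\<^sup>2)"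
          by (intro lim_imp_Liminf) auto
        then show ?case by (simp add: power2_commute)
      qed
    qed
    also have "\<dots> \<le> liminf (\<lambda>j. \<integral>\<^sup>+x. ?u j x \<partial>N)" by (rule nn_integral_liminf) measurable
    also have "\<dots> \<le> limsup (\<lambda>j. \<integral>\<^sup>+x. ?u j x \<partial>N)" by (rule Liminf_le_Limsup) simp
    also have "\<dots> \<le> ennreal (mercer_rem q n t)"
    proof (rule Limsup_bounded)
      have "\<forall>\<^sub>F j in sequentially. n \<le> r j" using r(2) unfolding filterlim_at_top by blast
      then show "\<forall>\<^sub>F j in sequentially. (\<integral>\<^sup>+x. ?u j x \<partial>N) \<le> ennreal (mercer_rem q n t)"
        by eventually_elim (rule series_sum_diff_sq[OF iid _ t])
    qed
    finally show ?thesis .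
  qed
  have law: "(LINT x|N. cis (\<Sum>t\<in>J. c t * Y t x)) = of_real (exp (- (\<Sum>s\<in>J. \<Sum>t\<in>J. c s * c t * Kq q s t) / 2))"
    if J: "finite J" "J \<subseteq> {0..1}" for J c
  proof -
    define V where "V n = (\<Sum>k=1..n. (\<Sum>t\<in>J. c t * scaled_e q k t)\<^sup>2)" for n
    have char_n: "(LINT x|N. cis (\<Sum>t\<in>J. c t * series_sum q \<xi> n t x)) = of_real (exp (- V n / 2))" for n
    proof -
      have "(\<Sum>t\<in>J. c t * series_sum q \<xi> n t x) = (\<Sum>k=1..n. (\<Sum>t\<in>J. c t * scaled_e q k t) * \<xi> k x)" for x
        unfolding series_sum_def sum_distrib_left sum_distrib_right by (subst sum.swap) (simp add: mult.assoc)
      moreover have "finite {1..n}" "{1..n} \<subseteq> {1..}" by auto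
      note iid_cis[OF iid this, of "\<lambda>k. \<Sum>t\<in>J. c t * scaled_e q k t"]
      ultimately show ?thesis unfolding V_def by (simp only:)
    qed
    have "V \<longlonglongrightarrow> (\<Sum>s\<in>J. \<Sum>t\<in>J. c s * c t * Kq q s t)"
    proof -
      have Veq: "V n = (\<Sum>s\<in>J. \<Sum>t\<in>J. c s * c t * (\<Sum>k=1..n. scaled_e q k s * scaled_e q k t))" for n
      proof -
        have "V n = (\<Sum>k=1..n. \<Sum>s\<in>J. \<Sum>t\<in>J. c s * c t * (scaled_e q k s * scaled_e q k t))"
          unfolding V_def power2_eq_square sum_product by (intro sum.cong refl) (simp add: mult_ac)
        also have "\<dots> = (\<Sum>s\<in>J. \<Sum>t\<in>J. \<Sum>k=1..n. c s * c t * (scaled_e q k s * scaled_e q k t))"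
          by (subst sum.swap, rule sum.cong[OF refl], rule sum.swap)
        finally show ?thesis by (simp only: sum_distrib_left)
      qed
      have "(\<lambda>n. V n) \<longlonglongrightarrow> (\<Sum>s\<in>J. \<Sum>t\<in>J. c s * c t * Kq q s t)"
        unfolding Veq by (intro tendsto_sum tendsto_mult tendsto_const scaled_e_product_sum[OF q]) (use J in auto)
      then show ?thesis .
    qed
    then have "(\<lambda>j. V (r j)) \<longlonglongrightarrow> (\<Sum>s\<in>J. \<Sum>t\<in>J. c s * c t * Kq q s t)"
      using r(2) by (rule filterlim_compose)
    then have "(\<lambda>j. LINT x|N. cis (\<Sum>t\<in>J. c t * series_sum q \<xi> (r j) t x)) \<longlonglongrightarrow> of_real (exp (- (\<Sum>s\<in>J. \<Sum>t\<in>J. c s * c t * Kq q s t) / 2))"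
      unfolding char_n by (intro tendsto_of_real tendsto_exp tendsto_divide tendsto_minus tendsto_const) auto
    moreover have "(\<lambda>j. LINT x|N. cis (\<Sum>t\<in>J. c t * series_sum q \<xi> (r j) t x)) \<longlonglongrightarrow> (LINT x|N. cis (\<Sum>t\<in>J. c t * Y t x))"
    proof (rule sum_cis_tendsto[OF P])
      have "AE x in N. \<forall>t\<in>J. (\<lambda>j. series_sum q \<xi> (r j) t x) \<longlonglongrightarrow> Y t x"
        using J conv by (intro AE_finite_allI) auto
      then show "AE x in N. (\<lambda>j. \<Sum>t\<in>J. c t * series_sum q \<xi> (r j) t x) \<longlonglongrightarrow> (\<Sum>t\<in>J. c t * Y t x)"
        by eventually_elim (intro tendsto_sum tendsto_mult tendsto_const, blast)
    qed (intro borel_measurable_sum borel_measurable_times borel_measurable_const Sm Ym)+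
    ultimately show ?thesis using LIMSEQ_unique by blast
  qed
  show ?thesis
    by (rule exI[of _ Y], intro conjI allI ballI impI) (rule Ym sq law; assumption)+
qed

end

section \<open>The Karhunen--Loeve expansion\<close>

lemma fredholm_cong:
  assumes "\<And>s. s \<in> {0..1} \<Longrightarrow> K s t = K' s t"
  shows "fredholm K h t = fredholm K' h t"
  unfolding fredholm_def using assms by (intro Bochner_Integration.integral_cong) auto

lemma eigenspace_cong:
  assumes "\<And>s t. s \<in> {0..1} \<Longrightarrow> t \<in> {0..1} \<Longrightarrow> K s t = K' s t"
  shows "eigenspace K \<mu> = eigenspace K' \<mu>"
proof -
  have "(AE t in I01. fredholm K h t = \<mu> * h t) \<longleftrightarrow> (AE t in I01. fredholm K' h t = \<mu> * h t)" for h
    by (rule AE_cong) (use fredholm_cong[of K _ K'] assms in auto)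
  then show ?thesis unfolding eigenspace_def by simp
qed

lemma eigenvalue_sequence_cong:
  assumes "\<And>s t. s \<in> {0..1} \<Longrightarrow> t \<in> {0..1} \<Longrightarrow> K s t = K' s t"
  shows "eigenvalue_sequence K l = eigenvalue_sequence K' l"
proof -
  have "eigenspace K = eigenspace K'" by (rule ext) (rule eigenspace_cong, rule assms)
  then show ?thesis unfolding eigenvalue_sequence_def has_multiplicity_def by (simp only:)
qed

lemma L2_kernel_cong:
  assumes "\<And>s t. s \<in> {0..1} \<Longrightarrow> t \<in> {0..1} \<Longrightarrow> K s t = K' s t"
  shows "L2_kernel K = L2_kernel K'"
proof -
  have e: "K (fst x) (snd x) = K' (fst x) (snd x)" if "x \<in> space (I01 \<Otimes>\<^sub>M I01)" for x
    using that assms by (auto simp: space_pair_measure)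
  have "(\<lambda>(s, t). K s t) \<in> borel_measurable (I01 \<Otimes>\<^sub>M I01) \<longleftrightarrow> (\<lambda>(s, t). K' s t) \<in> borel_measurable (I01 \<Otimes>\<^sub>M I01)"
    by (rule measurable_cong) (simp add: case_prod_beta e)
  moreover have "integrable (I01 \<Otimes>\<^sub>M I01) (\<lambda>(s, t). (K s t)\<^sup>2) \<longleftrightarrow> integrable (I01 \<Otimes>\<^sub>M I01) (\<lambda>(s, t). (K' s t)\<^sup>2)"
    by (rule Bochner_Integration.integrable_cong[OF refl]) (simp add: case_prod_beta e)
  ultimately show ?thesis unfolding L2_kernel_def by blast
qed

lemma continuous_in_L2:
  assumes "continuous_on {0..1} f" shows "f \<in> L2"
  unfolding L2_def using assms by (auto intro!: I01_measurable I01_continuous(1) continuous_on_power)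

context
  fixes q :: real
  assumes q: "1 < q"
begin

lemma Kq_L2_kernel: "L2_kernel (Kq q)"
proof -
  interpret I: prob_space I01 by (rule prob_space_I01)
  interpret II: pair_prob_space I01 I01 ..
  have i: "(\<lambda>x. x) \<in> measurable I01 borel" by (rule measurable_restrict_space1) simp
  have [measurable]: "fst \<in> measurable (I01 \<Otimes>\<^sub>M I01) borel" by (rule measurable_compose[OF measurable_fst i])
  have [measurable]: "snd \<in> measurable (I01 \<Otimes>\<^sub>M I01) borel" by (rule measurable_compose[OF measurable_snd i])
  have m: "(\<lambda>x. Kq q (fst x) (snd x)) \<in> borel_measurable (I01 \<Otimes>\<^sub>M I01)"
    unfolding Kq_def by measurable
  obtain B where B: "\<And>s t. s \<in> {0..1} \<Longrightarrow> t \<in> {0..1} \<Longrightarrow> \<bar>Kq q s t\<bar> \<le> B" using Kq_bounded[OF q] by blast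
  have "integrable (I01 \<Otimes>\<^sub>M I01) (\<lambda>x. (Kq q (fst x) (snd x))\<^sup>2)"
  proof (rule II.P.integrable_const_bound[where B = "B\<^sup>2"])
    show "AE x in I01 \<Otimes>\<^sub>M I01. norm ((Kq q (fst x) (snd x))\<^sup>2) \<le> B\<^sup>2"
    proof (rule AE_I2)
      fix x assume "x \<in> space (I01 \<Otimes>\<^sub>M I01)"
      then have "\<bar>Kq q (fst x) (snd x)\<bar> \<le> B" by (intro B) (auto simp: space_pair_measure)
      from power_mono[OF this, of 2] show "norm ((Kq q (fst x) (snd x))\<^sup>2) \<le> B\<^sup>2" by simp
    qed
  qed (use m in measurable)
  with m show ?thesis unfolding L2_kernel_def case_prod_beta by blast
qed

lemma Psi_inv_eig_ne_0: "1 \<le> k \<Longrightarrow> Psi q (inv_eig q k) \<noteq> 0"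
  using Psi_ne_0[OF q inv_eig_pos[OF q] Phi_inv_eig[OF q]] .

lemma continuous_on_KL_eigenfun:
  assumes k: "1 \<le> k" shows "continuous_on {0..1} (KL_eigenfun (1 / q) k)"
proof -
  have "continuous_on {0..1} (\<lambda>t. sqrt q * Gsol q (inv_eig q k) t / Psi q (inv_eig q k))"
    using Psi_inv_eig_ne_0[OF k] by (intro continuous_on_divide continuous_on_mult continuous_on_const continuous_on_Gsol_01[OF q]) auto
  then show ?thesis
    by (rule continuous_on_eq) (simp add: KL_eigenfun_eq[OF q k])
qed

lemma KL_eigenfun_orthonormal: "orthonormal_L2 (KL_eigenfun (1 / q))"
  unfolding orthonormal_L2_def
proof (intro conjI allI impI)
  show "KL_eigenfun (1 / q) k \<in> L2" if "1 \<le> k" for k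
    by (rule continuous_in_L2[OF continuous_on_KL_eigenfun[OF that]])
  fix i j :: nat assume ij: "1 \<le> i" "1 \<le> j"
  let ?P = "\<lambda>k. Psi q (inv_eig q k)"
  have "(LINT t|I01. KL_eigenfun (1 / q) i t * KL_eigenfun (1 / q) j t) =
      (LINT t|I01. q / (?P i * ?P j) * (Gsol q (inv_eig q i) t * Gsol q (inv_eig q j) t))"
    using q by (intro Bochner_Integration.integral_cong) (auto simp: KL_eigenfun_eq[OF q ij(1)] KL_eigenfun_eq[OF q ij(2)])
  also have "\<dots> = q / (?P i * ?P j) * (LINT t|I01. Gsol q (inv_eig q i) t * Gsol q (inv_eig q j) t)" by simp
  also have "\<dots> = (if i = j then 1 else 0)"
  proof (cases "i = j")
    case True
    then show ?thesis using Gsol_inner_self[OF q Phi_inv_eig[OF q ij(1)]] Psi_inv_eig_ne_0[OF ij(1)] q by (simp add: power2_eq_square)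
  next
    case False
    then show ?thesis using Gsol_inner_0[OF q Phi_inv_eig[OF q ij(1)] Phi_inv_eig[OF q ij(2)]] inv_eig_inj[OF q ij] by simp
  qed
  finally show "(LINT t|I01. KL_eigenfun (1 / q) i t * KL_eigenfun (1 / q) j t) = (if i = j then 1 else 0)" .
qed

lemma KL_eigenfun_in_eigenspace:
  assumes k: "1 \<le> k" shows "KL_eigenfun (1 / q) k \<in> eigenspace (Kq q) (KL_eigenvalue (1 / q) k)"
proof -
  let ?c = "inv_eig q k" and ?P = "Psi q (inv_eig q k)"
  have c: "Phi q ?c = 0" "?c \<noteq> 0" using Phi_inv_eig[OF q k] inv_eig_pos[OF q k] by auto
  have "fredholm (Kq q) (KL_eigenfun (1 / q) k) t = KL_eigenvalue (1 / q) k * KL_eigenfun (1 / q) k t" if t: "t \<in> {0..1}" for t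
  proof -
    have "fredholm (Kq q) (KL_eigenfun (1 / q) k) t = (LINT s|I01. sqrt q / ?P * (Kq q s t * Gsol q ?c s))"
      unfolding fredholm_def by (intro Bochner_Integration.integral_cong) (auto simp: KL_eigenfun_eq[OF q k])
    also have "\<dots> = sqrt q / ?P * fredholm (Kq q) (Gsol q ?c) t" unfolding fredholm_def by simp
    also have "\<dots> = KL_eigenvalue (1 / q) k * KL_eigenfun (1 / q) k t"
      using t by (simp add: fredholm_Kq_Gsol[OF q c t] KL_eigenvalue_eq[OF q] KL_eigenfun_eq[OF q k])
    finally show ?thesis .
  qed
  then show ?thesis unfolding eigenspace_def
    using continuous_in_L2[OF continuous_on_KL_eigenfun[OF k]] by (auto intro!: AE_I2)
qed

text \<open>Eigenvalues are distinct and each eigenspace for a nonzero number is spanned by the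
  corresponding eigenfunction, or is trivial when that number is not an eigenvalue.\<close>

lemma KL_eigenvalue_sequence: "eigenvalue_sequence (Kq q) (KL_eigenvalue (1 / q))"
  unfolding eigenvalue_sequence_def
proof (intro conjI allI impI)
  fix i j :: nat assume "1 \<le> i" "i \<le> j"
  then show "KL_eigenvalue (1 / q) j \<le> KL_eigenvalue (1 / q) i"
    using inv_eig_mono[OF q, of i j] inv_eig_pos[OF q, of i]
    by (cases "i = j") (auto simp: KL_eigenvalue_eq[OF q] intro!: divide_left_mono)
next
  show "0 \<le> KL_eigenvalue (1 / q) k" for k by (simp add: KL_eigenvalue_def)
next
  fix \<mu> :: real assume mu: "\<mu> \<noteq> 0"
  let ?A = "{k. 1 \<le> k \<and> KL_eigenvalue (1 / q) k = \<mu>}"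
  have "finite ?A \<and> has_multiplicity (Kq q) \<mu> (card ?A)"
  proof (cases "\<exists>k\<ge>1. KL_eigenvalue (1 / q) k = \<mu>")
    case True
    then obtain k where k: "1 \<le> k" "KL_eigenvalue (1 / q) k = \<mu>" by blast
    have c: "1 / \<mu> = inv_eig q k" using k(2) by (auto simp: KL_eigenvalue_eq[OF q])
    have A: "?A = {k}"
    proof (intro set_eqI iffI)
      fix j assume "j \<in> ?A"
      then have "1 \<le> j" "1 / inv_eig q j = 1 / inv_eig q k" using k by (auto simp: KL_eigenvalue_eq[OF q])
      then show "j \<in> {k}" using inv_eig_inj[OF q _ k(1)] by simp
    qed (use k in simp)
    have "has_multiplicity (Kq q) \<mu> (Suc 0)"
      unfolding has_multiplicity_def
    proof (intro exI[of _ "\<lambda>_. KL_eigenfun (1 / q) k"] conjI allI impI ballI)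
      show "KL_eigenfun (1 / q) k \<in> eigenspace (Kq q) \<mu>"
        using KL_eigenfun_in_eigenspace[OF k(1)] k(2) by simp
    next
      fix c :: "nat \<Rightarrow> real" and i :: nat
      assume ae: "AE t in I01. (\<Sum>i<Suc 0. c i * KL_eigenfun (1 / q) k t) = 0" and i: "i < Suc 0"
      have "(LINT t|I01. KL_eigenfun (1 / q) k t * KL_eigenfun (1 / q) k t) = 1"
        using KL_eigenfun_orthonormal k(1) unfolding orthonormal_L2_def by simp
      moreover have "(LINT t|I01. c 0 * (KL_eigenfun (1 / q) k t * KL_eigenfun (1 / q) k t)) = (LINT t|I01. 0)"
      proof (rule integral_cong_AE)
        show "(\<lambda>t. c 0 * (KL_eigenfun (1 / q) k t * KL_eigenfun (1 / q) k t)) \<in> borel_measurable I01"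
          by (intro I01_measurable continuous_on_mult continuous_on_const continuous_on_KL_eigenfun k(1))
        show "AE t in I01. c 0 * (KL_eigenfun (1 / q) k t * KL_eigenfun (1 / q) k t) = 0"
          using ae by eventually_elim auto
      qed simp
      ultimately show "c i = 0" using i by simp
    next
      fix h assume "h \<in> eigenspace (Kq q) \<mu>"
      from eigenspace_Kq[OF q this mu] obtain \<kappa> where ae: "AE t in I01. h t = \<kappa> * Gsol q (inv_eig q k) t"
        unfolding c by blast
      have "AE t in I01. h t = (\<Sum>i<Suc 0. (\<kappa> * Psi q (inv_eig q k) / sqrt q) * KL_eigenfun (1 / q) k t)"
        using ae AE_space
      proof eventually_elim
        case (elim t)
        then show ?case using Psi_inv_eig_ne_0[OF k(1)] q by (simp add: KL_eigenfun_eq[OF q k(1)])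
      qed
      then show "\<exists>c. AE t in I01. h t = (\<Sum>i<Suc 0. c i * KL_eigenfun (1 / q) k t)"
        by (rule exI[of _ "\<lambda>_. \<kappa> * Psi q (inv_eig q k) / sqrt q"])
    qed
    then show ?thesis unfolding A by simp
  next
    case False
    then have A: "?A = {}" by blast
    have "AE t in I01. h t = 0" if h: "h \<in> eigenspace (Kq q) \<mu>" for h
    proof -
      obtain \<kappa> where \<kappa>: "AE t in I01. h t = \<kappa> * Gsol q (1 / \<mu>) t" "\<kappa> = 0 \<or> Phi q (1 / \<mu>) = 0"
        using eigenspace_Kq[OF q h mu] by blast
      have "Phi q (1 / \<mu>) \<noteq> 0"
      proof
        assume "Phi q (1 / \<mu>) = 0"
        then obtain k where k: "1 \<le> k" "1 / \<mu> = inv_eig q k" using Phi_zero_imp_inv_eig[OF q] by blast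
        then have "KL_eigenvalue (1 / q) k = \<mu>" unfolding KL_eigenvalue_eq[OF q] k(2)[symmetric] using mu by simp
        with False k(1) show False by blast
      qed
      with \<kappa> show ?thesis by simp
    qed
    then have "has_multiplicity (Kq q) \<mu> 0" unfolding has_multiplicity_def by simp
    then show ?thesis unfolding A by simp
  qed
  then show "finite ?A" "has_multiplicity (Kq q) \<mu> (card ?A)" by blast+
qed

lemma KL_series:
  assumes iid: "iid_std_normal N (\<xi> :: nat \<Rightarrow> 'b \<Rightarrow> real)"
  shows "\<exists>Y. KL_series_converges N \<xi> (KL_eigenvalue (1 / q)) (KL_eigenfun (1 / q)) Y \<and>
    (\<forall>J c. finite J \<longrightarrow> J \<subseteq> {0..1} \<longrightarrow>
      (LINT x|N. cis (\<Sum>t\<in>J. c t * Y t x)) = of_real (exp (- (\<Sum>s\<in>J. \<Sum>t\<in>J. c s * c t * Kq q s t) / 2)))"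
proof -
  obtain Y where Y': "\<forall>t\<in>{0..1}. Y t \<in> borel_measurable N"
    "\<forall>n. \<forall>t\<in>{0..1}. (\<integral>\<^sup>+x. ennreal ((series_sum q \<xi> n t x - Y t x)\<^sup>2) \<partial>N) \<le> ennreal (mercer_rem q n t)"
    and law: "\<forall>J c. finite J \<longrightarrow> J \<subseteq> {0..1} \<longrightarrow>
      (LINT x|N. cis (\<Sum>t\<in>J. c t * Y t x)) = of_real (exp (- (\<Sum>s\<in>J. \<Sum>t\<in>J. c s * c t * Kq q s t) / 2))"
    using series_limit[OF q iid] by (elim exE conjE)
  have Y: "Y t \<in> borel_measurable N" 
    "(\<integral>\<^sup>+x. ennreal ((series_sum q \<xi> n t x - Y t x)\<^sup>2) \<partial>N) \<le> ennreal (mercer_rem q n t)" if "t \<in> {0..1}" for n t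
    using Y' that by blast+
  let ?S = "KL_partial_sum \<xi> (KL_eigenvalue (1 / q)) (KL_eigenfun (1 / q))"
  have S: "?S n t x = series_sum q \<xi> n t x" if "t \<in> {0..1}" for n t x
    unfolding KL_partial_sum_def series_sum_def
  proof (rule sum.cong[OF refl])
    fix k assume "k \<in> {1..n}"
    then have "scaled_e q k t = sqrt (KL_eigenvalue (1 / q) k) * KL_eigenfun (1 / q) k t"
      using that scaled_e_eq[OF q, of k t] by simp
    then show "\<xi> k x * sqrt (KL_eigenvalue (1 / q) k) * KL_eigenfun (1 / q) k t = scaled_e q k t * \<xi> k x"
      by (simp only: mult_ac)
  qed
  have le: "(\<integral>\<^sup>+x. ennreal ((?S n t x - Y t x)\<^sup>2) \<partial>N) \<le> ennreal (mercer_rem q n t)" if "t \<in> {0..1}" for n t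
    using Y(2)[OF that] unfolding S[OF that] .
  have "KL_series_converges N \<xi> (KL_eigenvalue (1 / q)) (KL_eigenfun (1 / q)) Y"
    unfolding KL_series_converges_def
  proof (intro conjI ballI)
    fix t :: real assume t: "t \<in> {0..1}"
    show "Y t \<in> borel_measurable N" by (rule Y(1)[OF t])
    have "(\<lambda>n. Kq q t t - (\<Sum>k=1..n. scaled_e q k t * scaled_e q k t)) \<longlonglongrightarrow> Kq q t t - Kq q t t"
      by (intro tendsto_diff tendsto_const scaled_e_product_sum[OF q t t])
    then have "(\<lambda>n. mercer_rem q n t) \<longlonglongrightarrow> 0" unfolding mercer_rem_def power2_eq_square by simp
    from tendsto_ennrealI[OF this] have "(\<lambda>n. ennreal (mercer_rem q n t)) \<longlonglongrightarrow> 0" by simp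
    then show "(\<lambda>n. \<integral>\<^sup>+x. ennreal ((?S n t x - Y t x)\<^sup>2) \<partial>N) \<longlonglongrightarrow> 0"
      by (rule tendsto_sandwich[OF _ _ tendsto_const, rotated 2]) (use le[OF t] in auto)
  next
    have "(\<integral>\<^sup>+t. (\<integral>\<^sup>+x. ennreal ((?S n t x - Y t x)\<^sup>2) \<partial>N) \<partial>I01) \<le> ennreal (LINT t|I01. mercer_rem q n t)" for n
    proof -
      have "(\<integral>\<^sup>+t. (\<integral>\<^sup>+x. ennreal ((?S n t x - Y t x)\<^sup>2) \<partial>N) \<partial>I01) \<le> (\<integral>\<^sup>+t. ennreal (mercer_rem q n t) \<partial>I01)"
        by (rule nn_integral_mono) (use le in auto)
      also have "\<dots> = ennreal (LINT t|I01. mercer_rem q n t)"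
        by (rule nn_integral_eq_integral[OF I01_continuous(1)[OF continuous_on_mercer_rem[OF q]]])
           (use mercer_rem_nonneg[OF q] in \<open>auto intro!: AE_I2\<close>)
      finally show ?thesis .
    qed
    note le' = this
    have "(\<lambda>n. ennreal (LINT t|I01. mercer_rem q n t)) \<longlonglongrightarrow> 0"
      using tendsto_ennrealI[OF mercer_rem_integral_tendsto[OF q]] by simp
    then show "(\<lambda>n. \<integral>\<^sup>+t. (\<integral>\<^sup>+x. ennreal ((?S n t x - Y t x)\<^sup>2) \<partial>N) \<partial>I01) \<longlonglongrightarrow> 0"
      by (rule tendsto_sandwich[OF _ _ tendsto_const, rotated 2]) (use le' in auto)
  qed
  with law show ?thesis by (intro exI[of _ Y] conjI)
qed

end

theorem theorem1p3:
  fixes \<gamma> \<nu> :: real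
    and M :: "'a measure" and W :: "real \<Rightarrow> 'a \<Rightarrow> real"
    and N :: "'b measure" and \<xi> :: "nat \<Rightarrow> 'b \<Rightarrow> real"
  assumes "\<gamma> > - 1 / 2"
    and "\<nu> = 1 / (2 * (1 + \<gamma>))"
    and "wiener_process M W"
    and "iid_std_normal N \<xi>"
  shows "0 < \<nu> \<and> \<nu> < 1 \<and>
    KL_expansion M (W_gamma \<gamma> W) N \<xi> (KL_eigenvalue \<nu>) (KL_eigenfun \<nu>)"
proof -
  define q where "q = 2 * (1 + \<gamma>)"
  have q: "1 < q" and \<gamma>: "1 + 2 * \<gamma> = q - 1" and \<nu>: "\<nu> = 1 / q" using assms(1,2) by (auto simp: q_def)
  note W = assms(3) and iid = assms(4)
  have M: "prob_space M" using W by (simp add: wiener_process_def)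
  have N: "prob_space N" using iid by (simp add: iid_std_normal_def)
  let ?X = "W_gamma \<gamma> W"
  have K: "covariance M ?X s t = Kq q s t" if "s \<in> {0..1}" "t \<in> {0..1}" for s t
    by (rule W_gamma_covariance[OF q W \<gamma> that])
  have "centered_gaussian_process M {0..1} ?X"
    unfolding centered_gaussian_process_def
  proof (intro conjI ballI allI impI)
    show "?X t \<in> borel_measurable M" if "t \<in> {0..1}" for t by (rule W_gamma_measurable[OF q W \<gamma> that])
    fix J :: "real set" and c :: "real \<Rightarrow> real" assume J: "finite J \<and> J \<subseteq> {0..1}"
    define V where "V = (\<Sum>s\<in>J. \<Sum>t\<in>J. c s * c t * Kq q s t)"
    have "distr M borel (\<lambda>\<omega>. \<Sum>t\<in>J. c t * ?X t \<omega>) =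
        (if sqrt V = 0 then return borel 0 else density lborel (\<lambda>x. ennreal (normal_density 0 (sqrt V) x)))"
      unfolding V_def using J by (intro W_gamma_gaussian(1)[OF q W \<gamma>]) auto
    moreover have "0 \<le> sqrt V" unfolding V_def using J by (intro real_sqrt_ge_zero Kq_quadratic_nonneg[OF q]) auto
    ultimately show "\<exists>\<sigma>\<ge>0. distr M borel (\<lambda>\<omega>. \<Sum>t\<in>J. c t * ?X t \<omega>) =
           (if \<sigma> = 0 then return borel 0 else density lborel (\<lambda>x. ennreal (normal_density 0 \<sigma> x)))"
      by (intro exI[of _ "sqrt V"] conjI)
  qed (rule M)
  moreover have "L2_kernel (covariance M ?X)"
    using Kq_L2_kernel[OF q] L2_kernel_cong[of "covariance M ?X" "Kq q", OF K] by blast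
  moreover have "eigenvalue_sequence (covariance M ?X) (KL_eigenvalue \<nu>)"
    using KL_eigenvalue_sequence[OF q] eigenvalue_sequence_cong[of "covariance M ?X" "Kq q", OF K] unfolding \<nu> by blast
  moreover have "\<forall>k\<ge>1. KL_eigenfun \<nu> k \<in> eigenspace (covariance M ?X) (KL_eigenvalue \<nu> k)"
    using KL_eigenfun_in_eigenspace[OF q] eigenspace_cong[of "covariance M ?X" "Kq q", OF K] unfolding \<nu> by blast
  moreover have "\<exists>Y. KL_series_converges N \<xi> (KL_eigenvalue \<nu>) (KL_eigenfun \<nu>) Y \<and> equal_in_law {0..1} M ?X N Y"
  proof -
    obtain Y where Y: "KL_series_converges N \<xi> (KL_eigenvalue \<nu>) (KL_eigenfun \<nu>) Y"
      "\<forall>J c. finite J \<longrightarrow> J \<subseteq> {0..1} \<longrightarrow>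
        (LINT x|N. cis (\<Sum>t\<in>J. c t * Y t x)) = of_real (exp (- (\<Sum>s\<in>J. \<Sum>t\<in>J. c s * c t * Kq q s t) / 2))"
      using KL_series[OF q iid, folded \<nu>] by (elim exE conjE)
    have "equal_in_law {0..1} M ?X N Y"
    proof (rule equal_in_law_of_char[OF M N])
      show "?X t \<in> borel_measurable M" if "t \<in> {0..1}" for t by (rule W_gamma_measurable[OF q W \<gamma> that])
      show "Y t \<in> borel_measurable N" if "t \<in> {0..1}" for t
        using Y(1) that unfolding KL_series_converges_def by (elim conjE) (rule bspec)
    qed (simp only: W_gamma_cis[OF q W \<gamma>] Y(2)[rule_format])
    with Y(1) show ?thesis by (intro exI[of _ Y] conjI)
  qed
  ultimately have "KL_expansion M ?X N \<xi> (KL_eigenvalue \<nu>) (KL_eigenfun \<nu>)"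
    unfolding KL_expansion_def using iid KL_eigenfun_orthonormal[OF q, folded \<nu>] by (intro conjI)
  then show ?thesis using q \<nu> by simp
qed

end
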